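(* Let $r \ge 4$ be even. There exists a value $n_1(r)$ such that for every $n \ge n_1(r)$ and every bipartite biconnected digraph $D$ of order $n$ and outradius $r$, $$\lvert A(D)\rvert \le \left\lvert A\left(B_{n,r}\right)\right\rvert,$$ where $B_{n,r}=D_{n,r,\lfloor \frac n2 -(r-1)\rfloor} \cap K_{\lfloor \frac n2\rfloor, \lceil \frac n2\rceil}$. Furthermore, $B_{n,r}$ is (up to isomorphism) the unique bipartite biconnected digraph of order $n$ and outradius $r$ attaining this maximum size.
   Context: Digraphs are finite, without loops or multiple arcs; $A(D)$ is the arc set. $d(u,v)$ is the length of a shortest directed path; the outradius is $\min_v\max_u d(v,u)$; biconnected (strongly connected) means all distances are finite; bipartite means the vertex set splits into two classes with no arcs inside a class. For $r\ge1$, $D_{2r,r,1}$ has vertex set $\{v_1,\dots,v_r\}\cup\{w_1,\dots,w_r\}$ and arcs $\{\vec{v_iv_j}: i\ne j,\ i\ge j-1\}\cup\{\vec{w_iw_j}: i\ne j,\ i\ge j-1\}\cup\{\vec{v_iw_1}\}_{1\le i\le r}\cup\{\vec{w_iv_1}\}_{1\le i\le r}$. For $n\ge 2r$ and $1\le s\le \frac{n-2r+2}{2}$, $D_{n,r,s}$ is obtained by replacing $v_1$ by $s$ vertices and $w_1$ by $n-2r+2-s$ vertices, each new vertex inheriting all arcs (with directions) of the vertex it replaces, with all copies of $v_1$ and $w_1$ mutually joined in both directions (bidirected cliques). $B_{n,r}$ is the spanning subdigraph of $D_{n,r,s}$ with $s=\lfloor \frac n2-(r-1)\rfloor$ keeping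 exactly the arcs between the classes $V_1=\{\text{copies of } v_1\}\cup\{v_i : i\ge3 \text{ odd}\}\cup\{w_i: i \text{ even}\}$ and $V_2=\{\text{copies of } w_1\}\cup\{v_i: i \text{ even}\}\cup\{w_i: i\ge 3\text{ odd}\}$ (these classes have sizes $\lfloor n/2\rfloor$ and $\lceil n/2\rceil$). *)

theory Defs
  imports "Graph_Theory.Graph_Theory"
begin

definition bipartite :: "('a, 'b) pre_digraph \<Rightarrow> bool" where
  "bipartite G \<longleftrightarrow> (\<exists>X Y. verts G = X \<union> Y \<and> X \<inter> Y = {} \<and>
     (\<forall>e \<in> arcs G. \<not> (tail G e \<in> X \<and> head G e \<in> X) \<and> \<not> (tail G e \<in> Y \<and> head G e \<in> Y)))"

text \<open>
  With unit arc weights, the library's shortest-path cost is the number of arcs on a shortest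
  directed path; it is \<open>\<infinity>\<close> if there is none.
\<close>

definition distance :: "('a, 'b) pre_digraph \<Rightarrow> 'a \<Rightarrow> 'a \<Rightarrow> ereal" where
  "distance G u v = wf_digraph.\<mu> G (\<lambda>_. 1) u v"

definition outradius :: "('a, 'b) pre_digraph \<Rightarrow> ereal" where
  "outradius G = (MIN v\<in>verts G. MAX u\<in>verts G. distance G v u)"

definition bip_biconn_digraph :: "nat \<Rightarrow> nat \<Rightarrow> ('a, 'b) pre_digraph \<Rightarrow> bool" where
  "bip_biconn_digraph n r G \<longleftrightarrow>
     digraph G \<and> bipartite G \<and> strongly_connected G \<and>
     card (verts G) = n \<and> outradius G = ereal (real r)"

datatype base_vert = V nat | W nat

text \<open>The digraph $D_{2r,r,1}$.\<close>

definition D_base :: "nat \<Rightarrow> base_vert pair_pre_digraph" where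
  "D_base r = \<lparr>
     pverts = V ` {1..r} \<union> W ` {1..r},
     parcs =
       {(V i, V j) | i j. i \<in> {1..r} \<and> j \<in> {1..r} \<and> i \<noteq> j \<and> i \<ge> j - 1} \<union>
       {(W i, W j) | i j. i \<in> {1..r} \<and> j \<in> {1..r} \<and> i \<noteq> j \<and> i \<ge> j - 1} \<union>
       {(V i, W 1) | i. i \<in> {1..r}} \<union>
       {(W i, V 1) | i. i \<in> {1..r}} \<rparr>"

text \<open>
  The copies of a base vertex \<open>x\<close> are the pairs \<open>(x, k)\<close> with \<open>k < copies n r s x\<close>. The
  subtractions are exact in the intended range $n \ge 2r$, $1 \le s \le (n-2r+2)/2$.
\<close>

fun copies :: "nat \<Rightarrow> nat \<Rightarrow> nat \<Rightarrow> base_vert \<Rightarrow> nat" where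
  "copies n r s (V i) = (if i = 1 then s else 1)"
| "copies n r s (W i) = (if i = 1 then n - 2 * r + 2 - s else 1)"

definition D_verts :: "nat \<Rightarrow> nat \<Rightarrow> nat \<Rightarrow> (base_vert \<times> nat) set" where
  "D_verts n r s = (SIGMA x : pverts (D_base r). {..<copies n r s x})"

definition D_graph :: "nat \<Rightarrow> nat \<Rightarrow> nat \<Rightarrow> (base_vert \<times> nat) pair_pre_digraph" where
  "D_graph n r s = \<lparr>
     pverts = D_verts n r s,
     parcs = {(p, q). p \<in> D_verts n r s \<and> q \<in> D_verts n r s \<and>
       ((fst p, fst q) \<in> parcs (D_base r) \<or>
        p \<noteq> q \<and> fst p \<in> {V 1, W 1} \<and> fst q \<in> {V 1, W 1})} \<rparr>"

definition B_class1 :: "base_vert set" where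
  "B_class1 = {V 1} \<union> {V i | i. i \<ge> 3 \<and> odd i} \<union> {W i | i. even i}"

definition B_class2 :: "base_vert set" where
  "B_class2 = {W 1} \<union> {V i | i. even i} \<union> {W i | i. i \<ge> 3 \<and> odd i}"

text \<open>For $n \ge 2r$ the value of \<open>s\<close> below is $\lfloor n/2 - (r-1) \rfloor$.\<close>

definition B_graph :: "nat \<Rightarrow> nat \<Rightarrow> (base_vert \<times> nat) pair_pre_digraph" where
  "B_graph n r = (let D = D_graph n r (n div 2 - (r - 1)) in \<lparr>
     pverts = pverts D,
     parcs = {(p, q) \<in> parcs D.
       fst p \<in> B_class1 \<and> fst q \<in> B_class2 \<or> fst p \<in> B_class2 \<and> fst q \<in> B_class1} \<rparr>)"

end

theory Submission
  imports Defs
begin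

text \<open>
  Call the arcs between opposite classes that are absent from a bipartite digraph \<^emph>\<open>missing\<close>;
  $B_{n,r}$ has $(r-2)n + O(1)$ of them, and it is balanced.

  Local step: fix vertices $x \leftrightarrow y$ and let the level of a vertex be its distance
  from $\{x,y\}$. Every vertex has out-eccentricity at least $r$. If at most $2r-4$ arcs are missing
  at $x$ and $y$ together, this forces all levels to be at most $r-1$, and the vertices of
  level at least $2$ then form exactly two disjoint paths, one starting at $x$ and one at $y$. The same
  eccentricity condition then shows that the digraph embeds into a blow-up of the template
  $D_{2r,r,1} \cap K_{r,r}$, in which only $v_1, w_1, v_2, w_2$ may have several copies.
  Counting shows that missing arcs are fewest when only $v_1$ and $w_1$ are repeated.

  Existence of such a pair for large $n$: all vertices of small in-degree and the vertices far
  from vertices of small out-degree can be joined into a strongly connected set $K$ of bounded size, containing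
  a vertex at distance at least $r$ from any given vertex. Charging to $x$ only its missing arcs to and
  from $K$, an averaging argument yields a pair $x \leftrightarrow y$ with at most $2r-4$ of them. The
  local step applies to the subdigraph induced by $K$ and the vertices joined both ways to $x$ or $y$, which is
  all but a bounded number of vertices. Hence almost all missing arcs run from copies of $v_1,w_1$
  to the two paths, and a pair avoiding the remaining ones satisfies the local hypothesis in
  the whole digraph.
\<close>

section \<open>Distances and levels\<close>

text \<open>The threshold \<open>2 * r - 4\<close> is twice \<open>r - 2\<close>, the number of arcs
  missing at each copy of \<open>V 1\<close> or \<open>W 1\<close> in \<open>B_graph\<close>. This
  shapes the search for a pair: the deficits of all vertices sum to twice the number of missing
  arcs, so an average pair from opposite classes would have about \<open>4 * r - 8\<close> of them,
  far too many. Counting only arcs between a bounded set and its complement charges each arc once;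
  the average drops to about \<open>2 * r - 4\<close>, and since counts are integers any average
  below \<open>2 * r - 3\<close> suffices. The price is that only a subdigraph gets labelled. The
  vertices left out are not placed by hand: the labelling only locates nearly all missing arcs,
  after which the local step can be run again on the whole digraph. Evenness of \<open>r\<close>
  enters by parity: the last path index \<open>r - 1\<close> is odd, which decides to which end of
  the pair the last path vertices send arcs. The number \<open>card (nonarcs r)\<close> cancels in
  every comparison, so a crude bound on it is enough.\<close>

definition hops :: "'a rel \<Rightarrow> 'a \<Rightarrow> 'a \<Rightarrow> nat" where
  "hops E u v = (LEAST k. (u, v) \<in> E ^^ k)"

lemma relpow_comp: "(u, v) \<in> E ^^ i \<Longrightarrow> (v, w) \<in> E ^^ j \<Longrightarrow> (u, w) \<in> E ^^ (i + j)"
  by (metis relcompI relpow_add)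

lemma hops_le: "(u, v) \<in> E ^^ k \<Longrightarrow> hops E u v \<le> k"
  unfolding hops_def by (rule Least_le)

lemma hops_relpow: "(u, v) \<in> E\<^sup>* \<Longrightarrow> (u, v) \<in> E ^^ hops E u v"
  unfolding hops_def by (metis LeastI_ex rtrancl_power)

lemma hops_self [simp]: "hops E u u = 0"
  using hops_le[where k = 0 and u = u and v = u and E = E] by simp

text \<open>One class is \<open>X\<close>, the other \<open>U - X\<close>. The bound
  \<open>far\<close> on the outradius uses relational powers, which are monotone in the relation and
  so pass easily to induced subdigraphs.\<close>

locale bip_rel =
  fixes U :: "'a set" and E :: "'a rel" and X :: "'a set" and r :: nat
  assumes finV: "finite U"
    and E_sub: "E \<subseteq> U \<times> U"
    and X_sub: "X \<subseteq> U"
    and bip: "\<And>u v. (u, v) \<in> E \<Longrightarrow> u \<in> X \<longleftrightarrow> v \<notin> X"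
    and strong: "\<And>u v. u \<in> U \<Longrightarrow> v \<in> U \<Longrightarrow> (u, v) \<in> E\<^sup>*"
    and far: "\<And>u. u \<in> U \<Longrightarrow> \<exists>v\<in>U. \<forall>k<r. (u, v) \<notin> E ^^ k"
    and r4: "4 \<le> r" and evr: "even r"
begin

abbreviation d :: "'a \<Rightarrow> 'a \<Rightarrow> nat" where "d \<equiv> hops E"

lemma E_V: "(u, v) \<in> E \<Longrightarrow> u \<in> U" "(u, v) \<in> E \<Longrightarrow> v \<in> U"
  using E_sub by auto

lemma d_relpow: "u \<in> U \<Longrightarrow> v \<in> U \<Longrightarrow> (u, v) \<in> E ^^ d u v"
  by (rule hops_relpow[OF strong])

lemma d_triangle: "u \<in> U \<Longrightarrow> v \<in> U \<Longrightarrow> w \<in> U \<Longrightarrow> d u w \<le> d u v + d v w"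
  by (rule hops_le, rule relpow_comp[OF d_relpow d_relpow])

lemma d_eq_0: "u \<in> U \<Longrightarrow> v \<in> U \<Longrightarrow> d u v = 0 \<longleftrightarrow> u = v"
  using d_relpow[of u v] by auto

lemma d_arc_le: "(u, v) \<in> E \<Longrightarrow> d u v \<le> 1"
  by (rule hops_le) simp

lemma d_eq_1: "u \<in> U \<Longrightarrow> v \<in> U \<Longrightarrow> d u v = 1 \<longleftrightarrow> (u, v) \<in> E"
proof
  assume "u \<in> U" "v \<in> U" "d u v = 1" then show "(u, v) \<in> E" using d_relpow[of u v] by simp
next
  assume a: "u \<in> U" "v \<in> U" "(u, v) \<in> E"
  then have "d u v \<noteq> 0" using d_eq_0 bip by metis
  then show "d u v = 1" using d_arc_le[OF a(3)] by simp
qed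

lemma d_arc_step: "w \<in> U \<Longrightarrow> (u, v) \<in> E \<Longrightarrow> d w v \<le> Suc (d w u)"
  using d_triangle[of w u v] d_arc_le[of u v] E_V by fastforce

lemma d_arc_step': "w \<in> U \<Longrightarrow> (u, v) \<in> E \<Longrightarrow> d u w \<le> Suc (d v w)"
  using d_triangle[of u v w] d_arc_le[of u v] E_V by fastforce

lemma relpow_parity: "(u, v) \<in> E ^^ k \<Longrightarrow> even k \<longleftrightarrow> (u \<in> X \<longleftrightarrow> v \<in> X)"
proof (induction k arbitrary: v)
  case 0 then show ?case by simp
next
  case (Suc k)
  then obtain w where "(u, w) \<in> E ^^ k" "(w, v) \<in> E" by auto
  then show ?case using Suc.IH bip by auto
qed

lemma d_parity: "u \<in> U \<Longrightarrow> v \<in> U \<Longrightarrow> even (d u v) \<longleftrightarrow> (u \<in> X \<longleftrightarrow> v \<in> X)"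
  using relpow_parity d_relpow by blast

lemma far_d: "u \<in> U \<Longrightarrow> \<exists>v\<in>U. r \<le> d u v"
  using far[of u] d_relpow by (metis not_le_imp_less)

lemma d_between:
  assumes "u \<in> U" "v \<in> U" "i \<le> d u v"
  shows "\<exists>w\<in>U. d u w = i \<and> d w v = d u v - i"
proof -
  have "(u, v) \<in> E ^^ (i + (d u v - i))" using d_relpow assms by simp
  then obtain w where w: "(u, w) \<in> E ^^ i" "(w, v) \<in> E ^^ (d u v - i)"
    unfolding relpow_add by blast
  have "w \<in> U"
  proof (cases i)
    case 0 then show ?thesis using w assms by simp
  next
    case (Suc j) then show ?thesis using w(1) E_V by auto
  qed
  moreover have "d u w \<le> i" "d w v \<le> d u v - i" using w by (auto intro: hops_le)
  ultimately show ?thesis using d_triangle[of u w v] assms by (intro bexI[of _ w]) auto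
qed

lemma d_pred:
  assumes "u \<in> U" "v \<in> U" "0 < d u v"
  shows "\<exists>w\<in>U. Suc (d u w) = d u v \<and> (w, v) \<in> E"
proof -
  obtain w where "w \<in> U" "d u w = d u v - 1" "d w v = 1"
    using d_between[of u v "d u v - 1"] assms by auto
  then show ?thesis using assms d_eq_1[of w v] by (intro bexI[of _ w]) auto
qed

lemma d_path:
  assumes "u \<in> U" "v \<in> U"
  shows "\<exists>p. p 0 = u \<and> p (d u v) = v \<and> (\<forall>i<d u v. (p i, p (Suc i)) \<in> E) \<and>
     (\<forall>i\<le>d u v. p i \<in> U) \<and> (\<forall>i j. i \<le> j \<longrightarrow> j \<le> d u v \<longrightarrow> d (p i) (p j) = j - i)"
proof -
  obtain p where p: "p 0 = u" "p (d u v) = v" "\<And>i. i < d u v \<Longrightarrow> (p i, p (Suc i)) \<in> E"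
    using d_relpow[OF assms] relpow_fun_conv by metis
  have pV: "p i \<in> U" if "i \<le> d u v" for i
  proof (cases i)
    case 0 then show ?thesis using p assms by simp
  next
    case (Suc j) then show ?thesis using p(3)[of j] E_V that by auto
  qed
  have le: "d (p i) (p j) \<le> j - i" if "i \<le> j" "j \<le> d u v" for i j
    using that
  proof (induction j)
    case 0 then show ?case by simp
  next
    case (Suc j)
    show ?case
    proof (cases "i = Suc j")
      case False
      then show ?thesis using Suc d_arc_step[of "p i" "p j" "p (Suc j)"] p(3) pV by fastforce
    qed simp
  qed
  have "d (p i) (p j) = j - i" if "i \<le> j" "j \<le> d u v" for i j
  proof -
    have "d u v \<le> d u (p i) + d (p i) (p j) + d (p j) v"
      using d_triangle[of u "p i" v] d_triangle[of "p i" "p j" v] pV[of i] pV[of j] assms that by fastforce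
    then show ?thesis
      using le[of 0 i] le[of i j] le[of j "d u v"] that p by simp
  qed
  then show ?thesis using p pV by blast
qed

end

section \<open>Levels around a bidirected pair\<close>

locale bip_pair = bip_rel +
  fixes x y :: 'a
  assumes xX: "x \<in> X" and yV: "y \<in> U" and yX: "y \<notin> X"
    and xy: "(x, y) \<in> E" and yx: "(y, x) \<in> E"
begin

lemma xV: "x \<in> U" using xX X_sub by auto

text \<open>
  The opposite-class vertices that receive no arc from, respectively send no arc to, the pair;
  their number is the total count of arcs missing at \<open>x\<close> and \<open>y\<close>.
\<close>
definition unseen :: "'a set" where
  "unseen = {u \<in> U - X. (x, u) \<notin> E} \<union> {u \<in> X. (y, u) \<notin> E}"

definition unseeing :: "'a set" where
  "unseeing = {u \<in> U - X. (u, x) \<notin> E} \<union> {u \<in> X. (u, y) \<notin> E}"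

abbreviation f :: "'a \<Rightarrow> nat" where "f \<equiv> d x"
abbreviation g :: "'a \<Rightarrow> nat" where "g \<equiv> d y"

text \<open>\<open>h\<close> is the level; \<open>hm\<close> is its counterpart for distances
  towards the pair.\<close>

definition h :: "'a \<Rightarrow> nat" where "h u = min (f u) (g u)"
definition hm :: "'a \<Rightarrow> nat" where "hm u = min (d u x) (d u y)"

text \<open>The two ends are interchangeable. Instantiating a lemma through \<open>swap\<close>
  turns a statement about \<open>x\<close> and \<open>X\<close> into one about \<open>y\<close> and
  \<open>U - X\<close>, which halves the case analyses below.\<close>

lemma swap: "bip_pair U E (U - X) r y x"
proof (intro bip_pair.intro bip_rel.intro bip_pair_axioms.intro)
  show "u \<in> U - X \<longleftrightarrow> v \<notin> U - X" if "(u, v) \<in> E" for u v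
    using bip[OF that] E_V[OF that] by simp
qed (fact finV E_sub r4 evr yx xy xV strong far | use xX yV yX in blast)+

lemma unseen_swap: "bip_pair.unseen U E (U - X) y x = unseen"
  unfolding bip_pair.unseen_def[OF swap] unseen_def using X_sub by auto

lemma unseeing_swap: "bip_pair.unseeing U E (U - X) y x = unseeing"
  unfolding bip_pair.unseeing_def[OF swap] unseeing_def using X_sub by auto

text \<open>The arcs between \<open>x\<close> and \<open>y\<close> bound the difference by 1; the
  two ends lie in different classes, so parity excludes equality.\<close>

lemma f_g: "u \<in> U \<Longrightarrow> f u = Suc (g u) \<or> g u = Suc (f u)"
proof -
  assume u: "u \<in> U"
  have "f u \<le> Suc (g u)" "g u \<le> Suc (f u)" using d_arc_step' u xy yx by auto
  moreover have "f u \<noteq> g u" using d_parity[OF xV u] d_parity[OF yV u] xX yX by auto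
  ultimately show ?thesis by linarith
qed

lemma d_to: "u \<in> U \<Longrightarrow> d u x = Suc (d u y) \<or> d u y = Suc (d u x)"
proof -
  assume u: "u \<in> U"
  have "d u x \<le> Suc (d u y)" "d u y \<le> Suc (d u x)" using d_arc_step u xy yx by auto
  moreover have "d u x \<noteq> d u y" using d_parity[OF u xV] d_parity[OF u yV] xX yX by auto
  ultimately show ?thesis by linarith
qed

text \<open>The distance from the end in the class opposite to \<open>u\<close> is odd, hence 1 or
  at least 3, and by \<open>f_g\<close> the distance from the other end differs from it by
  1.\<close>

lemma unseen_iff: "u \<in> U \<Longrightarrow> u \<in> unseen \<longleftrightarrow> 2 \<le> h u"
proof -
  assume u: "u \<in> U"
  have "u \<in> unseen \<longleftrightarrow> (if u \<in> X then g u \<noteq> 1 else f u \<noteq> 1)"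
    unfolding unseen_def using d_eq_1[OF xV u] d_eq_1[OF yV u] u by auto
  moreover have "u \<in> X \<Longrightarrow> odd (g u)" "u \<notin> X \<Longrightarrow> odd (f u)"
    using d_parity[OF xV u] d_parity[OF yV u] xX yX by auto
  moreover have "odd k \<Longrightarrow> k = 1 \<or> 3 \<le> k" for k :: nat by presburger
  ultimately have e: "u \<in> unseen \<longleftrightarrow> (if u \<in> X then 3 \<le> g u else 3 \<le> f u)"
    "u \<in> X \<Longrightarrow> g u = 1 \<or> 3 \<le> g u" "u \<notin> X \<Longrightarrow> f u = 1 \<or> 3 \<le> f u"
    by (metis numeral_le_one_iff semiring_norm(70))+
  have "2 \<le> min a b \<longleftrightarrow> 3 \<le> b" if "a = Suc b \<or> b = Suc a" "b = 1 \<or> 3 \<le> b" for a b :: nat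
    using that by auto
  then show ?thesis unfolding h_def using f_g[OF u] e by (metis min.commute)
qed

lemma unseeing_iff: "u \<in> U \<Longrightarrow> u \<in> unseeing \<longleftrightarrow> 2 \<le> hm u"
proof -
  assume u: "u \<in> U"
  have "u \<in> unseeing \<longleftrightarrow> (if u \<in> X then d u y \<noteq> 1 else d u x \<noteq> 1)"
    unfolding unseeing_def using d_eq_1[OF u xV] d_eq_1[OF u yV] u by auto
  moreover have "u \<in> X \<Longrightarrow> odd (d u y)" "u \<notin> X \<Longrightarrow> odd (d u x)"
    using d_parity[OF u xV] d_parity[OF u yV] xX yX by auto
  moreover have "odd k \<Longrightarrow> k = 1 \<or> 3 \<le> k" for k :: nat by presburger
  ultimately have e: "u \<in> unseeing \<longleftrightarrow> (if u \<in> X then 3 \<le> d u y else 3 \<le> d u x)"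
    "u \<in> X \<Longrightarrow> d u y = 1 \<or> 3 \<le> d u y" "u \<notin> X \<Longrightarrow> d u x = 1 \<or> 3 \<le> d u x"
    by (metis numeral_le_one_iff semiring_norm(70))+
  have "2 \<le> min a b \<longleftrightarrow> 3 \<le> b" if "a = Suc b \<or> b = Suc a" "b = 1 \<or> 3 \<le> b" for a b :: nat
    using that by auto
  then show ?thesis unfolding hm_def using d_to[OF u] e by (metis min.commute)
qed

lemma unseen_V: "unseen \<subseteq> U" and unseeing_V: "unseeing \<subseteq> U"
  unfolding unseen_def unseeing_def using X_sub by auto

lemma fin_unseen: "finite unseen" and fin_unseeing: "finite unseeing"
  using unseen_V unseeing_V finV finite_subset by blast+

lemma h_triangle: "u \<in> U \<Longrightarrow> v \<in> U \<Longrightarrow> h v \<le> h u + d u v"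
  unfolding h_def using d_triangle[OF xV, of u v] d_triangle[OF yV, of u v] by linarith

lemma hm_triangle: "u \<in> U \<Longrightarrow> v \<in> U \<Longrightarrow> hm u \<le> d u v + hm v"
  unfolding hm_def using d_triangle[OF _ _ xV, of u v] d_triangle[OF _ _ yV, of u v] by linarith

text \<open>The summand 1 pays for crossing between \<open>x\<close> and \<open>y\<close> when the
  end nearest from \<open>u\<close> is not the end nearest to \<open>v\<close>.\<close>

lemma d_via: "u \<in> U \<Longrightarrow> v \<in> U \<Longrightarrow> d u v \<le> hm u + 1 + h v"
  unfolding h_def hm_def
  using d_triangle[of u x v] d_triangle[of u y v] f_g[of v] d_to[of u] xV yV by auto

lemma h_between:
  assumes "v \<in> U" "i \<le> h v"
  shows "\<exists>w\<in>U. h w = i \<and> d w v = h v - i"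
proof -
  obtain s where s: "s \<in> U" "s = x \<or> s = y" "h v = d s v" using that xV yV
    unfolding h_def min_def by (cases "f v \<le> g v") auto
  obtain w where w: "w \<in> U" "d s w = i" "d w v = h v - i" using d_between[of s v i] s assms by auto
  have "h w \<le> i" using s w unfolding h_def by auto
  moreover have "h v \<le> h w + d w v" using h_triangle w assms by blast
  ultimately show ?thesis using w assms by (intro bexI[of _ w]) auto
qed

lemma hm_between:
  assumes "v \<in> U" "i \<le> hm v"
  shows "\<exists>w\<in>U. hm w = i"
proof -
  obtain s where s: "s \<in> U" "s = x \<or> s = y" "hm v = d v s" using that xV yV
    unfolding hm_def min_def by (cases "d v x \<le> d v y") auto
  obtain w where w: "w \<in> U" "d v w = hm v - i" "d w s = i" using d_between[of v s "hm v - i"] s assms by auto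
  have "hm w \<le> i" using s w unfolding hm_def by auto
  moreover have "hm v \<le> d v w + hm w" using hm_triangle w assms by blast
  ultimately show ?thesis using w assms by (intro bexI[of _ w]) auto
qed

text \<open>On the way from \<open>v\<close> to the pair every value of \<open>hm\<close> from 2 to
  \<open>hm v\<close> occurs, each at a different vertex of \<open>unseeing\<close>.\<close>

lemma hm_card_unseeing:
  assumes "v \<in> U" shows "hm v \<le> Suc (card unseeing)"
proof -
  have "{2..hm v} \<subseteq> hm ` unseeing"
  proof
    fix i assume "i \<in> {2..hm v}"
    then obtain w where "w \<in> U" "hm w = i" "2 \<le> i" using hm_between[OF assms, of i] by auto
    then show "i \<in> hm ` unseeing" using unseeing_iff by blast
  qed
  then have "card {2..hm v} \<le> card unseeing"
    by (meson card_image_le card_mono fin_unseeing finite_imageI le_trans)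
  then show ?thesis by simp
qed

definition lvl :: "nat \<Rightarrow> 'a set" where "lvl i = {u \<in> U. h u = i}"

lemma fin_lvl: "finite (lvl i)" unfolding lvl_def using finV by simp

definition T :: nat where "T = Max (h ` U)"

lemma h_le_T: "u \<in> U \<Longrightarrow> h u \<le> T"
  unfolding T_def using finV by simp

lemma T_attained: "\<exists>u\<in>U. h u = T"
  proof -
  have "T \<in> h ` U" unfolding T_def by (rule Max_in) (use finV xV in auto)
  then show ?thesis by auto
qed

lemma lvl_ne: "i \<le> T \<Longrightarrow> lvl i \<noteq> {}"
proof -
  assume "i \<le> T"
  then obtain u where "u \<in> U" "i \<le> h u" using T_attained by auto
  then show ?thesis using h_between[of u i] unfolding lvl_def by auto
qed

text \<open>
  If a level is a single vertex \<open>c\<close>, every vertex of a higher level is reached through \<open>c\<close>. So the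
  vertex far from \<open>c\<close> is either much higher, or it is lower and \<open>c\<close> must be far from \<open>{x, y}\<close>.
\<close>
lemma single_level:
  assumes i: "2 \<le> i" and c: "lvl i = {c}"
  shows "r + i \<le> T \<or> r \<le> hm c + i"
proof -
  have cV: "c \<in> U" and hc: "h c = i" using c unfolding lvl_def by auto
  obtain c' where c': "c' \<in> U" "r \<le> d c c'" using far_d[OF cV] by auto
  show ?thesis
  proof (cases "i \<le> h c'")
    case True
    then obtain w where "w \<in> U" "h w = i" "d w c' = h c' - i" using h_between[OF c'(1)] by auto
    then have "w = c" using c unfolding lvl_def by auto
    then have "r + i \<le> h c'" using c' \<open>d w c' = _\<close> r4 by auto
    then show ?thesis using h_le_T[OF c'(1)] by linarith
  next
    case False
    then show ?thesis using d_via[OF cV c'(1)] c' by linarith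
  qed
qed

definition dbl :: "nat set" where "dbl = {i \<in> {2..T}. 2 \<le> card (lvl i)}"

lemma card_unseen_sum: "card unseen = (\<Sum>i=2..T. card (lvl i))"
proof -
  have "unseen = (\<Union>i\<in>{2..T}. lvl i)"
    unfolding lvl_def using unseen_iff h_le_T unseen_V by auto
  moreover have "card (\<Union>i\<in>{2..T}. lvl i) = (\<Sum>i=2..T. card (lvl i))"
    by (rule card_UN_disjoint) (use fin_lvl in \<open>auto simp: lvl_def\<close>)
  ultimately show ?thesis by simp
qed

lemma card_unseen_dbl: "T - 1 + card dbl \<le> card unseen"
proof -
  have "(\<Sum>i=2..T. 1 + (if i \<in> dbl then 1 else 0)) \<le> (\<Sum>i=2..T. card (lvl i))"
  proof (rule sum_mono)
    fix i assume i: "i \<in> {2..T}"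
    then have "card (lvl i) \<noteq> 0" using lvl_ne fin_lvl by simp
    then show "1 + (if i \<in> dbl then 1 else 0) \<le> card (lvl i)" using i unfolding dbl_def by auto
  qed
  also have "(\<Sum>i=2..T. 1 + (if i \<in> dbl then 1 else 0)) = card {2..T} + card dbl"
  proof -
    have "{2..T} \<inter> dbl = dbl" unfolding dbl_def by auto
    then show ?thesis by (subst sum.distrib) (simp add: sum.If_cases)
  qed
  finally show ?thesis unfolding card_unseen_sum by simp
qed

lemma not_dbl_single: "2 \<le> i \<Longrightarrow> i \<le> T \<Longrightarrow> i \<notin> dbl \<Longrightarrow> \<exists>c. lvl i = {c}"
proof -
  assume a: "2 \<le> i" "i \<le> T" "i \<notin> dbl"
  then have "\<not> 2 \<le> card (lvl i)" unfolding dbl_def by simp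
  moreover have "card (lvl i) \<noteq> 0" using lvl_ne[OF a(2)] fin_lvl[of i] by simp
  ultimately have "card (lvl i) = 1" by linarith
  then show ?thesis using card_1_singletonE by blast
qed

text \<open>Both alternatives of \<open>single_level\<close> fail in this range: the lower limit
  excludes \<open>r + i \<le> T\<close>, the upper one the bound on \<open>hm c\<close>, which is at
  most \<open>Suc (card unseeing)\<close>. So each vertex of \<open>unseeing\<close> saves at most
  one double level, and the sum of the two counts cannot be pushed down.\<close>

lemma dbl_range: "{max 2 (Suc T - r)..r - 2 - card unseeing} \<inter> {..T} \<subseteq> dbl"
proof
  fix i assume i: "i \<in> {max 2 (Suc T - r)..r - 2 - card unseeing} \<inter> {..T}"
  show "i \<in> dbl"
  proof (rule ccontr)
    assume "i \<notin> dbl"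
    then obtain c where c: "lvl i = {c}" using not_dbl_single i by auto
    have "c \<in> U" using c unfolding lvl_def by auto
    then have "hm c \<le> Suc (card unseeing)" by (rule hm_card_unseeing)
    then show False using single_level[OF _ c] i r4 by auto
  qed
qed

end

section \<open>Two disjoint paths\<close>

context bip_pair
begin

text \<open>In the tight case \<open>T = r\<close> this shows that level \<open>r - 2\<close> has no
  third vertex.\<close>

lemma card_unseen_dbl_excess:
  assumes j: "j \<in> dbl"
  shows "T - 1 + card dbl + (card (lvl j) - 2) \<le> card unseen"
proof -
  have "(\<Sum>i=2..T. (1 + (if i \<in> dbl then 1 else 0)) + (if i = j then card (lvl j) - 2 else 0)) \<le> (\<Sum>i=2..T. card (lvl i))"
  proof (rule sum_mono)
    fix i assume i: "i \<in> {2..T}"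
    then have "card (lvl i) \<noteq> 0" using lvl_ne fin_lvl by simp
    then show "(1 + (if i \<in> dbl then 1 else 0)) + (if i = j then card (lvl j) - 2 else 0) \<le> card (lvl i)"
      using i j unfolding dbl_def by auto
  qed
  also have "(\<Sum>i=2..T. (1 + (if i \<in> dbl then 1 else 0)) + (if i = j then card (lvl j) - 2 else 0))
    = card {2..T} + card dbl + (card (lvl j) - 2)"
  proof -
    have "{2..T} \<inter> dbl = dbl" "2 \<le> j" "j \<le> T" using j unfolding dbl_def by auto
    then show ?thesis by (subst sum.distrib, subst sum.distrib) (simp add: sum.If_cases)
  qed
  finally show ?thesis unfolding card_unseen_sum by simp
qed

text \<open>The count is tight here: \<open>r - 1\<close> levels, at least
  \<open>r - 3 - card unseeing\<close> of them double, together with \<open>unseeing\<close> already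
  give \<open>2 * r - 4\<close>. This fixes which levels are single, and the far vertices of
  \<open>c\<close> and of one further vertex \<open>s\<close> then have no place left.\<close>

lemma T_eq_r_aux:
  assumes T: "T = r" and le: "card unseen + card unseeing \<le> 2 * r - 4"
    and c: "lvl (r - 1) = {c}" and cX: "c \<in> X"
  shows False
proof -
  let ?b = "card unseeing"
  have b: "?b + 3 \<le> r" and cd: "card dbl + 3 + ?b \<le> r"
    using card_unseen_dbl le T r4 by linarith+
  have dblsub: "{2..r - 2 - ?b} \<subseteq> dbl" using dbl_range T b r4 by (auto simp: max_def)
  have findbl: "finite dbl" unfolding dbl_def by simp
  have dbl: "dbl = {2..r - 2 - ?b}"
    by (rule sym, rule card_seteq[OF findbl dblsub]) (use cd in simp)
  have "r \<notin> dbl" "2 \<le> r" using dbl r4 by auto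
  then obtain e where e: "lvl r = {e}" using not_dbl_single[of r] T by auto
  have cV: "c \<in> U" "h c = r - 1" and eV: "e \<in> U" "h e = r" using c e unfolding lvl_def by auto
  have lvlD: "v = c" if "v \<in> U" "h v = r - 1" for v using c that unfolding lvl_def by auto
  have lvlD': "v = e" if "v \<in> U" "h v = r" for v using e that unfolding lvl_def by auto
  \<comment> \<open>These are \<open>card unseeing\<close> single levels, and
    \<open>single_level\<close> puts the vertex of each into \<open>unseeing\<close>. They exhaust
    it, so \<open>c\<close> cannot belong to it.\<close>
  have singles: "{r - 1 - ?b..r - 2} \<subseteq> h ` unseeing"
  proof
    fix i assume i: "i \<in> {r - 1 - ?b..r - 2}"
    then have "2 \<le> i" "i \<le> T" "i \<notin> dbl" using b T dbl r4 by auto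
    then obtain ci where ci: "lvl i = {ci}" using not_dbl_single by blast
    then have "ci \<in> U" "h ci = i" unfolding lvl_def by auto
    moreover have "r \<le> hm ci + i" using single_level[OF \<open>2 \<le> i\<close> ci] T \<open>2 \<le> i\<close> by simp
    ultimately show "i \<in> h ` unseeing" using unseeing_iff[of ci] i r4 by force
  qed
  have "c \<notin> unseeing"
  proof
    assume "c \<in> unseeing"
    then have "insert (r - 1) {r - 1 - ?b..r - 2} \<subseteq> h ` unseeing" using singles cV by force
    then have "card (insert (r - 1) {r - 1 - ?b..r - 2}) \<le> ?b"
      by (meson card_image_le card_mono fin_unseeing finite_imageI le_trans)
    moreover have "r - 1 \<notin> {r - 1 - ?b..r - 2}" "card {r - 1 - ?b..r - 2} = ?b" using b r4 by auto
    then have "card (insert (r - 1) {r - 1 - ?b..r - 2}) = Suc ?b" by simp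
    ultimately show False by simp
  qed
  then have cy: "(c, y) \<in> E" using cX unfolding unseeing_def by auto
  obtain w where "w \<in> U" "h w = r - 1" "d w e = 1" using h_between[OF eV(1), of "r - 1"] eV r4 by auto
  then have ce: "d c e = 1" using lvlD by auto
  obtain c' where c': "c' \<in> U" "r \<le> d c c'" using far_d[OF cV(1)] by auto
  have "h c' \<le> r" using h_le_T[OF c'(1)] T by simp
  moreover have "h c' \<noteq> r" using lvlD' c' ce r4 by auto
  moreover have "h c' \<noteq> r - 1" using lvlD c' r4 by fastforce
  moreover have "d c c' \<le> Suc (g c')" using d_arc_step' c' cy by auto
  ultimately have c'g: "g c' = r - 1" "f c' = r - 2"
    using f_g[OF c'(1)] c' r4 unfolding h_def by auto
  have "odd (g c)" "even (f c)" using d_parity[OF xV cV(1)] d_parity[OF yV cV(1)] cX xX yX by auto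
  moreover have "odd (r - 1)" using evr r4 by auto
  ultimately have gc: "g c = r - 1" "f c = r"
    using f_g[OF cV(1)] cV(2) r4 unfolding h_def min_def by (auto split: if_splits)
  obtain p where p: "p \<in> U" "Suc (g p) = r - 1" "(p, c) \<in> E" using d_pred[OF yV cV(1)] gc r4 by auto
  have "f c \<le> Suc (f p)" using d_arc_step xV p by blast
  then have fp: "f p = r - 1" "g p = r - 2" using f_g[OF p(1)] p gc by auto
  \<comment> \<open>Level \<open>r - 2\<close> contains \<open>p\<close>, nearer to
    \<open>y\<close>, and \<open>c'\<close>, nearer to \<open>x\<close>. It is therefore double,
    which \<open>dbl\<close> allows only if \<open>unseeing\<close> is empty.\<close>
  have hp: "h p = r - 2" "h c' = r - 2" "p \<noteq> c'" using fp c'g r4 unfolding h_def by auto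
  then have sub: "{p, c'} \<subseteq> lvl (r - 2)" using p c' unfolding lvl_def by auto
  then have "2 \<le> card (lvl (r - 2))" using card_mono[OF fin_lvl sub] hp by simp
  then have indbl: "r - 2 \<in> dbl" unfolding dbl_def T using r4 by auto
  then have b0: "?b = 0" using dbl r4 by auto
  have "card (lvl (r - 2)) \<le> 2"
    using card_unseen_dbl_excess[OF indbl] le b0 T dbl r4 by simp
  then have lvl2: "lvl (r - 2) = {p, c'}"
    by (intro sym[OF card_seteq[OF fin_lvl sub]]) (use hp in simp)
  \<comment> \<open>Two steps from \<open>y\<close> towards \<open>p\<close>, so \<open>s\<close> is
    in the class of \<open>y\<close> and sends an arc to \<open>x\<close>. Its far vertex has
    \<open>f\<close> at least \<open>r - 1\<close>, but in the three top levels \<open>p\<close>,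
    \<open>c\<close> and \<open>e\<close> are too close to \<open>s\<close>, and \<open>c'\<close>
    is too close to \<open>x\<close>.\<close>
  obtain s where s: "s \<in> U" "g s = 2" "d s p = r - 4"
    using d_between[OF yV p(1), of 2] fp(2) r4 by (auto simp: le_diff_conv2)
  have "s \<notin> X" using d_parity[OF yV s(1)] s yX by auto
  then have sx: "(s, x) \<in> E" using b0 fin_unseeing s unfolding unseeing_def by auto
  obtain v where v: "v \<in> U" "r \<le> d s v" using far_d[OF s(1)] by auto
  have "d s v \<le> Suc (f v)" using d_arc_step' v sx by auto
  then have fv: "r - 1 \<le> f v" using v by simp
  have sc: "d s c \<le> r - 3" using d_triangle[OF s(1) p(1) cV(1)] d_arc_le[OF p(3)] s r4 by linarith
  have se: "d s e \<le> r - 2" using d_triangle[OF s(1) cV(1) eV(1)] sc ce r4 by linarith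
  have "h v = r - 2 \<or> h v = r - 1 \<or> h v = r"
    using fv f_g[OF v(1)] h_le_T[OF v(1)] T unfolding h_def by linarith
  then show False
  proof (elim disjE)
    assume "h v = r - 2"
    then have "v = p \<or> v = c'" using lvl2 v unfolding lvl_def by auto
    then show False using v s fv c'g r4 by auto
  next
    assume "h v = r - 1" then show False using lvlD v sc r4 by fastforce
  next
    assume "h v = r" then show False using lvlD' v se r4 by fastforce
  qed
qed

lemma h_swap: "bip_pair.h E y x = h"
  unfolding bip_pair.h_def[OF swap] h_def by (simp add: min.commute)

lemma lvl_swap: "bip_pair.lvl U E y x = lvl"
  unfolding bip_pair.lvl_def[OF swap] lvl_def h_swap ..

lemma T_swap: "bip_pair.T U E y x = T"
  unfolding bip_pair.T_def[OF swap] T_def h_swap ..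

text \<open>For \<open>T > r\<close> the range of \<open>dbl_range\<close> starts at
  \<open>Suc T - r\<close> and the count gives the bound directly. For \<open>T = r\<close> it would
  start at 1, while double levels are counted only from 2; one unit is lost and
  \<open>T_eq_r_aux\<close> recovers it.\<close>

lemma deficit_high:
  assumes "r \<le> T"
  shows "2 * r - 3 \<le> card unseen + card unseeing"
proof (cases "T = r")
  case False
  then have T: "r + 1 \<le> T" using assms by simp
  have "{Suc T - r..r - 2 - card unseeing} \<subseteq> dbl"
    using dbl_range T max.absorb2[of 2 "Suc T - r"] by auto
  moreover have "finite dbl" unfolding dbl_def by simp
  ultimately have "card {Suc T - r..r - 2 - card unseeing} \<le> card dbl" by (rule card_mono[rotated])
  then show ?thesis using card_unseen_dbl T r4 by simp
next
  case T: True
  show ?thesis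
  proof (rule ccontr)
    assume "\<not> ?thesis"
    then have le: "card unseen + card unseeing \<le> 2 * r - 4" by simp
    have "{2..r - 2 - card unseeing} \<subseteq> dbl" using dbl_range T r4 by (auto simp: max_def)
    moreover have findbl: "finite dbl" unfolding dbl_def by simp
    ultimately have "card {2..r - 2 - card unseeing} \<le> card dbl" by (rule card_mono[rotated])
    moreover have dblsub: "{2..r - 2 - card unseeing} \<subseteq> dbl" by fact
    ultimately have "dbl = {2..r - 2 - card unseeing}"
      using card_unseen_dbl le T r4 by (intro sym[OF card_seteq[OF findbl dblsub]]) auto
    then have "r - 1 \<notin> dbl" using r4 by auto
    moreover have "2 \<le> r - 1" "r - 1 \<le> T" using T r4 by linarith+
    ultimately obtain c where c: "lvl (r - 1) = {c}" using not_dbl_single by blast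
    show False
    proof (cases "c \<in> X")
      case True then show False using T_eq_r_aux T le c by blast
    next
      case False
      moreover have "c \<in> U" using c unfolding lvl_def by auto
      ultimately show False
        using bip_pair.T_eq_r_aux[OF swap, of c] T le c
        unfolding T_swap lvl_swap unseen_swap unseeing_swap by blast
    qed
  qed
qed

text \<open>A vertex at distance at least \<open>r\<close> from \<open>x\<close> has level below
  \<open>r\<close>, so its distances from \<open>x\<close> and \<open>y\<close> are exactly
  \<open>r\<close> and \<open>r - 1\<close>. A shortest path to it from \<open>y\<close> stays
  strictly nearer to \<open>y\<close>; this is \<open>q\<close>. Dually \<open>p\<close> leads from
  \<open>x\<close> to a vertex far from \<open>y\<close>.\<close>

lemma two_paths:
  assumes "T < r"
  obtains p q where
    "\<And>i. i < r \<Longrightarrow> p i \<in> U" "\<And>i. i < r \<Longrightarrow> q i \<in> U"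
    "p 0 = x" "q 0 = y"
    "\<And>i. Suc i < r \<Longrightarrow> (p i, p (Suc i)) \<in> E" "\<And>i. Suc i < r \<Longrightarrow> (q i, q (Suc i)) \<in> E"
    "\<And>i. i < r \<Longrightarrow> f (p i) = i" "\<And>i. i < r \<Longrightarrow> g (p i) = Suc i"
    "\<And>i. i < r \<Longrightarrow> g (q i) = i" "\<And>i. i < r \<Longrightarrow> f (q i) = Suc i"
proof -
  obtain u where u: "u \<in> U" "r \<le> f u" using far_d[OF xV] by auto
  obtain u' where u': "u' \<in> U" "r \<le> g u'" using far_d[OF yV] by auto
  have U: "g u = r - 1" "f u = r" and U': "f u' = r - 1" "g u' = r"
    using f_g[OF u(1)] f_g[OF u'(1)] h_le_T[OF u(1)] h_le_T[OF u'(1)] u u' assms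
    unfolding h_def by linarith+
  obtain p where p: "p 0 = x" "p (f u') = u'" "\<forall>i<f u'. (p i, p (Suc i)) \<in> E"
     "\<forall>i\<le>f u'. p i \<in> U" "\<forall>i j. i \<le> j \<longrightarrow> j \<le> f u' \<longrightarrow> d (p i) (p j) = j - i"
    using d_path[OF xV u'(1)] by blast
  obtain q where q: "q 0 = y" "q (g u) = u" "\<forall>i<g u. (q i, q (Suc i)) \<in> E"
     "\<forall>i\<le>g u. q i \<in> U" "\<forall>i j. i \<le> j \<longrightarrow> j \<le> g u \<longrightarrow> d (q i) (q j) = j - i"
    using d_path[OF yV u(1)] by blast
  have pV: "p i \<in> U" and qV: "q i \<in> U" if "i < r" for i
    using p(4) q(4) U U' that by auto
  have fp: "f (p i) = i" and gq: "g (q i) = i" if "i < r" for i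
    using p(5)[rule_format, of 0 i] q(5)[rule_format, of 0 i] p(1) q(1) U U' that by auto
  have "d (p i) u' = r - 1 - i" "d (q i) u = r - 1 - i" if "i < r" for i
    using p(5)[rule_format, of i "r - 1"] q(5)[rule_format, of i "r - 1"] p(2) q(2) U U' that by auto
  then have gp: "g (p i) = Suc i" and fq: "f (q i) = Suc i" if "i < r" for i
    using d_triangle[OF yV pV[OF that] u'(1)] d_triangle[OF xV qV[OF that] u(1)] u u' that
      f_g[OF pV[OF that]] f_g[OF qV[OF that]] fp[OF that] gq[OF that] by force+
  show ?thesis
    by (rule that[of p q]) (use p q pV qV fp gq gp fq U U' in auto)
qed

definition pqs :: "(nat \<Rightarrow> 'a) \<Rightarrow> (nat \<Rightarrow> 'a) \<Rightarrow> bool" where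
  "pqs p q \<longleftrightarrow>
    (\<forall>i<r. p i \<in> U \<and> q i \<in> U \<and> f (p i) = i \<and> g (p i) = Suc i \<and> g (q i) = i \<and> f (q i) = Suc i) \<and>
    p 0 = x \<and> q 0 = y \<and>
    (\<forall>i. Suc i < r \<longrightarrow> (p i, p (Suc i)) \<in> E \<and> (q i, q (Suc i)) \<in> E) \<and>
    unseen = p ` {2..<r} \<union> q ` {2..<r} \<and> unseeing = {}"

text \<open>The two paths are disjoint, \<open>p\<close> being nearer to \<open>x\<close> and
  \<open>q\<close> nearer to \<open>y\<close>, and each has \<open>r - 2\<close> vertices in
  \<open>unseen\<close>. They use up the whole allowance.\<close>

lemma deficit_low:
  assumes "T < r"
    and le: "card unseen + card unseeing \<le> 2 * r - 4"
  shows "\<exists>p q. pqs p q"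
proof -
  obtain p q where pq:
    "\<And>i. i < r \<Longrightarrow> p i \<in> U" "\<And>i. i < r \<Longrightarrow> q i \<in> U"
    "p 0 = x" "q 0 = y"
    "\<And>i. Suc i < r \<Longrightarrow> (p i, p (Suc i)) \<in> E" "\<And>i. Suc i < r \<Longrightarrow> (q i, q (Suc i)) \<in> E"
    "\<And>i. i < r \<Longrightarrow> f (p i) = i" "\<And>i. i < r \<Longrightarrow> g (p i) = Suc i"
    "\<And>i. i < r \<Longrightarrow> g (q i) = i" "\<And>i. i < r \<Longrightarrow> f (q i) = Suc i"
    using two_paths[OF assms(1)] by blast
  let ?S = "p ` {2..<r} \<union> q ` {2..<r}"
  have sub: "?S \<subseteq> unseen" using pq unseen_iff unfolding h_def by auto
  have "inj_on p {2..<r}" using pq(7) by (intro inj_on_inverseI[of _ f]) auto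
  moreover have "inj_on q {2..<r}" using pq(9) by (intro inj_on_inverseI[of _ g]) auto
  moreover have "p ` {2..<r} \<inter> q ` {2..<r} = {}"
  proof -
    have "p i \<noteq> q j" if "i < r" "j < r" for i j
    proof
      assume "p i = q j"
      then have "i = Suc j" "Suc i = j" using pq(7)[OF that(1)] pq(10)[OF that(2)] pq(8)[OF that(1)] pq(9)[OF that(2)] by auto
      then show False by simp
    qed
    then show ?thesis by auto
  qed
  ultimately have cS: "card ?S = 2 * r - 4"
    by (subst card_Un_disjoint) (auto simp: card_image)
  then have "?S = unseen" using le by (intro card_seteq[OF fin_unseen sub]) (use cS in simp)
  moreover have "card unseeing = 0" using le card_mono[OF fin_unseen sub] cS by linarith
  then have "unseeing = {}" using fin_unseeing by simp
  ultimately have "pqs p q" unfolding pqs_def using pq by simp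
  then show "\<exists>p q. pqs p q" by blast
qed

theorem deficit_eq:
  assumes "card unseen + card unseeing \<le> 2 * r - 4"
  shows "\<exists>p q. pqs p q"
  using deficit_low[OF _ assms] deficit_high assms r4 by (cases "T < r") auto

lemma pqs_swap: "pqs p q \<Longrightarrow> bip_pair.pqs U E (U - X) r y x q p"
  unfolding bip_pair.pqs_def[OF swap] pqs_def unseen_swap unseeing_swap by auto

end

section \<open>Labelling by the template\<close>

definition bverts :: "nat \<Rightarrow> base_vert set" where
  "bverts r = V ` {1..r} \<union> W ` {1..r}"

definition tmpl :: "nat \<Rightarrow> base_vert rel" where
  "tmpl r = parcs (D_base r) \<inter> (B_class1 \<times> B_class2 \<union> B_class2 \<times> B_class1)"

lemma class_iff [simp]:
  "V i \<in> B_class1 \<longleftrightarrow> odd i" "V i \<in> B_class2 \<longleftrightarrow> even i"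
  "W i \<in> B_class1 \<longleftrightarrow> even i" "W i \<in> B_class2 \<longleftrightarrow> odd i"
proof -
  have "odd i \<Longrightarrow> i = 1 \<or> 3 \<le> i" by presburger
  then show "V i \<in> B_class1 \<longleftrightarrow> odd i" "V i \<in> B_class2 \<longleftrightarrow> even i"
    "W i \<in> B_class1 \<longleftrightarrow> even i" "W i \<in> B_class2 \<longleftrightarrow> odd i"
    unfolding B_class1_def B_class2_def by auto
qed

lemma bverts_iff [simp]: "V i \<in> bverts r \<longleftrightarrow> 1 \<le> i \<and> i \<le> r" "W i \<in> bverts r \<longleftrightarrow> 1 \<le> i \<and> i \<le> r"
  unfolding bverts_def by auto

lemma finite_bverts: "finite (bverts r)" unfolding bverts_def by simp

lemma class_compl: "s \<in> B_class2 \<longleftrightarrow> s \<notin> B_class1"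
  by (cases s) auto

lemma tmpl_iff:
  "(V i, V j) \<in> tmpl r \<longleftrightarrow> i \<in> {1..r} \<and> j \<in> {1..r} \<and> odd (i + j) \<and> j \<le> Suc i"
  "(W i, W j) \<in> tmpl r \<longleftrightarrow> i \<in> {1..r} \<and> j \<in> {1..r} \<and> odd (i + j) \<and> j \<le> Suc i"
  "(V i, W j) \<in> tmpl r \<longleftrightarrow> i \<in> {1..r} \<and> j = 1 \<and> odd i"
  "(W i, V j) \<in> tmpl r \<longleftrightarrow> i \<in> {1..r} \<and> j = 1 \<and> odd i"
proof -
  have base: "(V i, V j) \<in> parcs (D_base r) \<longleftrightarrow> i \<in> {1..r} \<and> j \<in> {1..r} \<and> i \<noteq> j \<and> j - 1 \<le> i"
    "(W i, W j) \<in> parcs (D_base r) \<longleftrightarrow> i \<in> {1..r} \<and> j \<in> {1..r} \<and> i \<noteq> j \<and> j - 1 \<le> i"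
    "(V i, W j) \<in> parcs (D_base r) \<longleftrightarrow> i \<in> {1..r} \<and> j = 1"
    "(W i, V j) \<in> parcs (D_base r) \<longleftrightarrow> i \<in> {1..r} \<and> j = 1"
    by (simp_all add: D_base_def) blast+
  have "odd (i + j) \<Longrightarrow> i \<noteq> j" by auto
  moreover have "j - 1 \<le> i \<longleftrightarrow> j \<le> Suc i" by auto
  ultimately show "(V i, V j) \<in> tmpl r \<longleftrightarrow> i \<in> {1..r} \<and> j \<in> {1..r} \<and> odd (i + j) \<and> j \<le> Suc i"
    "(W i, W j) \<in> tmpl r \<longleftrightarrow> i \<in> {1..r} \<and> j \<in> {1..r} \<and> odd (i + j) \<and> j \<le> Suc i"
    unfolding tmpl_def Int_iff base Un_iff mem_Times_iff fst_conv snd_conv class_iff even_add by blast+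
  show "(V i, W j) \<in> tmpl r \<longleftrightarrow> i \<in> {1..r} \<and> j = 1 \<and> odd i"
    "(W i, V j) \<in> tmpl r \<longleftrightarrow> i \<in> {1..r} \<and> j = 1 \<and> odd i"
    unfolding tmpl_def Int_iff base Un_iff mem_Times_iff fst_conv snd_conv class_iff by auto
qed

text \<open>This encodes the embedding into a blow-up. Only one direction is demanded of arcs: arcs
  allowed by the template may be absent, and the counting measures how many are forced to
  be.\<close>

definition tmpl_lab :: "nat \<Rightarrow> 'a set \<Rightarrow> 'a rel \<Rightarrow> 'a set \<Rightarrow> ('a \<Rightarrow> base_vert) \<Rightarrow> bool" where
  "tmpl_lab r U E X l \<longleftrightarrow>
    (\<forall>a b. (a, b) \<in> E \<longrightarrow> (l a, l b) \<in> tmpl r) \<and>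
    (\<forall>u\<in>U. l u \<in> bverts r \<and> (l u \<in> B_class1 \<longleftrightarrow> u \<in> X)) \<and>
    (\<forall>s\<in>bverts r. \<exists>u\<in>U. l u = s) \<and>
    (\<forall>s\<in>bverts r - {V 1, W 1, V 2, W 2}. \<forall>u\<in>U. \<forall>v\<in>U. l u = s \<longrightarrow> l v = s \<longrightarrow> u = v)"

text \<open>An automorphism of the template that exchanges its classes, the counterpart of
  \<open>swap\<close>.\<close>

fun flip :: "base_vert \<Rightarrow> base_vert" where
  "flip (V i) = W i" | "flip (W i) = V i"

lemma flip_flip [simp]: "flip (flip s) = s" by (cases s) auto

lemma tmpl_flip: "(flip s, flip t) \<in> tmpl r \<longleftrightarrow> (s, t) \<in> tmpl r"
  by (cases s; cases t) (auto simp: tmpl_iff)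

context bip_pair
begin

text \<open>Indices shift by one because \<open>p 0 = x\<close> should carry \<open>V 1\<close>.
  Since \<open>q 2\<close> carries \<open>W 3\<close>, a seen vertex of \<open>X\<close> with an arc
  into \<open>q 2\<close> must act as a copy of \<open>q 1\<close>, that is \<open>W 2\<close>; any
  other seen vertex of \<open>X\<close> acts as a copy of \<open>x\<close>. Dually outside
  \<open>X\<close>.\<close>

definition lab :: "(nat \<Rightarrow> 'a) \<Rightarrow> (nat \<Rightarrow> 'a) \<Rightarrow> 'a \<Rightarrow> base_vert" where
  "lab p q u = (if u \<in> unseen then (if f u < g u then V (Suc (f u)) else W (Suc (g u)))
     else if u \<in> X then (if (u, q 2) \<in> E then W 2 else V 1)
     else (if (u, p 2) \<in> E then V 2 else W 1))"

lemma lab_swap: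
  assumes "u \<in> U" shows "bip_pair.lab U E (U - X) y x q p u = flip (lab p q u)"
proof -
  have "g u < f u \<longleftrightarrow> \<not> f u < g u" using f_g[OF assms] by linarith
  moreover have "u \<in> U - X \<longleftrightarrow> u \<notin> X" using assms by simp
  ultimately show ?thesis unfolding bip_pair.lab_def[OF swap] lab_def unseen_swap
    by (simp split: if_split)
qed

context
  fixes p q assumes pq: "pqs p q"
begin

lemma pqs_simps:
  "i < r \<Longrightarrow> p i \<in> U" "i < r \<Longrightarrow> q i \<in> U" "i < r \<Longrightarrow> f (p i) = i" "i < r \<Longrightarrow> g (p i) = Suc i"
  "i < r \<Longrightarrow> g (q i) = i" "i < r \<Longrightarrow> f (q i) = Suc i"
  "Suc i < r \<Longrightarrow> (p i, p (Suc i)) \<in> E" "Suc i < r \<Longrightarrow> (q i, q (Suc i)) \<in> E"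
  "unseen = p ` {2..<r} \<union> q ` {2..<r}" "unseeing = {}"
  using pq unfolding pqs_def by (elim conjE; simp)+

lemma unseen_cases:
  assumes "u \<in> unseen"
  obtains (P) i where "2 \<le> i" "i < r" "u = p i" "f u = i" "g u = Suc i"
  | (Q) i where "2 \<le> i" "i < r" "u = q i" "g u = i" "f u = Suc i"
proof -
  from assms have "u \<in> p ` {2..<r} \<or> u \<in> q ` {2..<r}" unfolding pqs_simps(9) by simp
  then show ?thesis using P Q pqs_simps(3-6) by auto
qed

text \<open>As \<open>unseeing\<close> is empty, every vertex has \<open>hm\<close> at most 1, so a
  seen vertex is within distance 3, which is less than \<open>r\<close>.\<close>

lemma far_unseen: "u \<in> U \<Longrightarrow> \<exists>v\<in>unseen. r \<le> d u v"
proof -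
  assume u: "u \<in> U"
  obtain v where v: "v \<in> U" "r \<le> d u v" using far_d[OF u] by auto
  have "hm u < 2" using unseeing_iff[OF u] pqs_simps(10) by auto
  moreover have "v \<notin> unseen \<Longrightarrow> h v < 2" using unseen_iff[OF v(1)] by auto
  ultimately show ?thesis using d_via[OF u v(1)] v r4 by fastforce
qed

lemma d_pp: "i \<le> j \<Longrightarrow> j < r \<Longrightarrow> d (p i) (p j) \<le> j - i"
proof (induction j)
  case (Suc j)
  show ?case
  proof (cases "i = Suc j")
    case False
    then show ?thesis using Suc d_arc_step[of "p i" "p j" "p (Suc j)"] pqs_simps by fastforce
  qed simp
qed simp

lemma d_qq: "i \<le> j \<Longrightarrow> j < r \<Longrightarrow> d (q i) (q j) \<le> j - i"
proof (induction j)
  case (Suc j)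
  show ?case
  proof (cases "i = Suc j")
    case False
    then show ?thesis using Suc d_arc_step[of "q i" "q j" "q (Suc j)"] pqs_simps by fastforce
  qed simp
qed simp

lemma X_even_f: "u \<in> U \<Longrightarrow> u \<in> X \<longleftrightarrow> even (f u)" "u \<in> U \<Longrightarrow> u \<in> X \<longleftrightarrow> odd (g u)"
  using d_parity[OF xV] d_parity[OF yV] xX yX by auto

lemma sees_y: "u \<in> X \<Longrightarrow> (u, y) \<in> E" and sees_x: "u \<in> U - X \<Longrightarrow> (u, x) \<in> E"
  using pqs_simps(10) unfolding unseeing_def by auto

text \<open>\<open>p i\<close> sends an arc to \<open>y\<close>, so its far vertex is at distance at
  least \<open>r - 1\<close> from \<open>y\<close>. On \<open>p\<close> only the last two vertices
  qualify, and \<open>p i\<close> reaches them along \<open>p\<close>, because an even index below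
  the even \<open>r\<close> is at most \<open>r - 2\<close>. Only the end of \<open>q\<close>
  remains.\<close>

lemma far_p_even:
  assumes i: "2 \<le> i" "i < r" "even i"
  shows "r \<le> d (p i) (q (r - 1))"
proof -
  have U: "p i \<in> U" using pqs_simps i by auto
  have "p i \<in> X" using X_even_f(1)[OF U] pqs_simps(3) i by auto
  then have s: "(p i, y) \<in> E" by (rule sees_y)
  have "i \<noteq> r - 1" using i evr r4 by auto
  obtain v where v: "v \<in> unseen" "r \<le> d (p i) v" using far_unseen[OF U] by auto
  have "d (p i) v \<le> Suc (g v)" using d_arc_step' s v unseen_V by auto
  with v(2) have gv: "r \<le> Suc (g v)" by simp
  from v(1) show ?thesis
  proof (cases rule: unseen_cases)
    case (P m)
    then have "m < i \<or> d (p i) v \<le> m - i" using d_pp[of i m] by (metis not_le)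
    then show ?thesis using P gv v \<open>i \<noteq> r - 1\<close> i by auto
  next
    case (Q m)
    then have "m = r - 1" using gv by auto
    then show ?thesis using Q v by simp
  qed
qed

lemma arc_p_even:
  assumes i: "2 \<le> i" "i < r" "even i" and j: "2 \<le> j" "j < r"
  shows "(p i, q j) \<notin> E"
proof
  assume a: "(p i, q j) \<in> E"
  have "d (p i) (q (r - 1)) \<le> Suc (d (q j) (q (r - 1)))" using d_arc_step'[OF _ a] pqs_simps r4 by auto
  moreover have "d (q j) (q (r - 1)) \<le> r - 1 - j" using d_qq[of j "r - 1"] j by linarith
  ultimately show False using far_p_even[OF i] j by linarith
qed

text \<open>Here the arc goes to \<open>x\<close>. The only vertex of \<open>p\<close> far enough
  from \<open>x\<close> is its last one, which is reached along \<open>p\<close>, so one of the last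
  two vertices of \<open>q\<close> is far.\<close>

lemma far_p_odd:
  assumes i: "2 \<le> i" "i < r" "odd i"
  shows "\<exists>m. r \<le> m + 2 \<and> m < r \<and> r \<le> d (p i) (q m)"
proof -
  have U: "p i \<in> U" using pqs_simps i by auto
  have "p i \<notin> X" using X_even_f(1)[OF U] pqs_simps(3) i by auto
  then have s: "(p i, x) \<in> E" using sees_x U by auto
  obtain v where v: "v \<in> unseen" "r \<le> d (p i) v" using far_unseen[OF U] by auto
  have "d (p i) v \<le> Suc (f v)" using d_arc_step' s v unseen_V by auto
  with v(2) have gv: "r \<le> Suc (f v)" by simp
  from v(1) show ?thesis
  proof (cases rule: unseen_cases)
    case (P m)
    then have "m < i \<or> d (p i) v \<le> m - i" using d_pp[of i m] by (metis not_le)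
    then show ?thesis using P gv v i by auto
  next
    case (Q m)
    then show ?thesis using v gv by auto
  qed
qed

lemma arc_p_odd:
  assumes i: "2 \<le> i" "i < r" "odd i" and j: "2 \<le> j" "j < r"
  shows "(p i, q j) \<notin> E"
proof
  assume a: "(p i, q j) \<in> E"
  have U: "p i \<in> U" "q j \<in> U" using pqs_simps i j by auto
  have "q j \<in> X" using bip[OF a] X_even_f(1)[OF U(1)] pqs_simps(3) i by auto
  then have oj: "odd j" using X_even_f(2)[OF U(2)] pqs_simps(5) j by auto
  obtain m where m: "r \<le> m + 2" "m < r" "r \<le> d (p i) (q m)" using far_p_odd[OF i] by auto
  have le: "d (p i) (q m) \<le> Suc (d (q j) (q m))" using d_arc_step'[OF _ a] pqs_simps m by auto
  show False
  proof (cases "j \<le> m")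
    case True
    then show False using le d_qq[of j m] m j by simp
  next
    case False
    \<comment> \<open>The far vertex may precede \<open>q j\<close> on the path, so walking along
      \<open>q\<close> gives nothing. But then \<open>i\<close> and \<open>j\<close> are both
      \<open>r - 1\<close>, and \<open>p (r - 2)\<close> would reach \<open>q (r - 1)\<close> in two
      steps, against \<open>far_p_even\<close>.\<close>
    then have jr: "j = r - 1" using m j by auto
    have "f (q j) \<le> Suc (f (p i))" using d_arc_step[OF xV a] .
    then have "i = r - 1" using pqs_simps i j jr by auto
    then have "(p (r - 2), p i) \<in> E" using pqs_simps(7)[of "r - 2"] r4 by (simp add: numeral_2_eq_2 Suc_diff_Suc)
    then have "d (p (r - 2)) (q j) \<le> 2"
      using d_arc_step'[OF U(2)] d_arc_le[OF a] by fastforce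
    moreover have "even (r - 2)" "2 \<le> r - 2" "r - 2 < r" using evr r4 by auto
    then have "r \<le> d (p (r - 2)) (q j)" using far_p_even[of "r - 2"] jr by simp
    ultimately show False using r4 by linarith
  qed
qed

text \<open>Such a \<open>b\<close> gets label \<open>W 2\<close> when seen. Through
  \<open>b\<close> the vertex \<open>q m\<close> of \<open>far_p_odd\<close> would be reached in at
  most \<open>m\<close> steps.\<close>

lemma arc_p_W2:
  assumes i: "2 \<le> i" "i < r" and a: "(p i, b) \<in> E" "(b, q 2) \<in> E" and bX: "b \<in> X"
  shows False
proof -
  have U: "p i \<in> U" "b \<in> U" using E_V a by auto
  have "p i \<notin> X" using bip[OF a(1)] bX by auto
  then have "odd i" using X_even_f(1)[OF U(1)] pqs_simps(3) i by auto
  then obtain m where m: "r \<le> m + 2" "m < r" "r \<le> d (p i) (q m)" using far_p_odd i by blast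
  have mU: "q m \<in> U" using pqs_simps m by auto
  have "d (p i) (q m) \<le> Suc (Suc (d (q 2) (q m)))"
    using d_arc_step'[OF mU a(1)] d_arc_step'[OF mU a(2)] by simp
  then show False using d_qq[of 2 m] m r4 by auto
qed

text \<open>With the arc, \<open>a\<close> would reach \<open>p 2\<close> and \<open>q 2\<close>
  within two steps, hence every unseen vertex in fewer than \<open>r\<close>.\<close>

lemma arc_W2_V2:
  assumes a: "a \<in> X - unseen" "(a, q 2) \<in> E" and b: "(b, p 2) \<in> E"
  shows "(a, b) \<notin> E"
proof
  assume e: "(a, b) \<in> E"
  have U: "a \<in> U" using E_V e by auto
  obtain v where v: "v \<in> unseen" "r \<le> d a v" using far_unseen[OF U] by auto
  then have vU: "v \<in> U" using unseen_V by auto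
  from v(1) show False
  proof (cases rule: unseen_cases)
    case (P i)
    then show False using d_arc_step'[OF vU e] d_arc_step'[OF vU b] d_pp[of 2 i] v by auto
  next
    case (Q i)
    then show False using d_arc_step'[OF vU a(2)] d_qq[of 2 i] v by auto
  qed
qed

lemma lab_unseen:
  assumes "2 \<le> i" "i < r"
  shows "lab p q (p i) = V (Suc i)" "lab p q (q i) = W (Suc i)"
proof -
  have "p i \<in> unseen" "q i \<in> unseen" unfolding pqs_simps(9) using assms by auto
  then show "lab p q (p i) = V (Suc i)" "lab p q (q i) = W (Suc i)"
    unfolding lab_def using pqs_simps(3-6)[OF assms(2)] by simp_all
qed

text \<open>The remaining tails, seen ones outside \<open>X\<close> and those on \<open>q\<close>,
  follow by \<open>swap\<close> and \<open>flip\<close>.\<close>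

lemma arc_lab_half:
  assumes e: "(a, b) \<in> E" and a: "a \<in> X - unseen \<or> (\<exists>i. 2 \<le> i \<and> i < r \<and> a = p i)"
  shows "(lab p q a, lab p q b) \<in> tmpl r"
proof -
  have U: "a \<in> U" "b \<in> U" using E_V e by auto
  show ?thesis using a
  proof
    assume aX: "a \<in> X - unseen"
    then have "(y, a) \<in> E" unfolding unseen_def by auto
    then have gb: "g b \<le> 2" using d_arc_step[OF yV e] d_arc_le[of y a] by simp
    have bX: "b \<notin> X" using bip[OF e] aX by auto
    show ?thesis
    proof (cases "b \<in> unseen")
      case True
      \<comment> \<open>\<open>q 2\<close> is the only unseen vertex at distance at most 2 from
        \<open>y\<close>.\<close>
      then have "b = q 2"
        by (cases rule: unseen_cases) (use gb in auto)
      then show ?thesis using aX e r4 lab_unseen(2)[of 2] unfolding lab_def[of p q a]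
        by (auto simp: tmpl_iff)
    next
      case False
      then show ?thesis using arc_W2_V2[OF aX, of b] aX bX e r4 unfolding lab_def
        by (auto simp: tmpl_iff)
    qed
  next
    assume "\<exists>i. 2 \<le> i \<and> i < r \<and> a = p i"
    then obtain i where i: "2 \<le> i" "i < r" "a = p i" by blast
    have X: "a \<in> X \<longleftrightarrow> even i" using X_even_f(1)[OF U(1)] pqs_simps(3) i by auto
    have bX: "b \<in> X \<longleftrightarrow> odd i" using bip[OF e] X by auto
    have fb: "f b \<le> Suc i" using d_arc_step[OF xV e] pqs_simps(3) i by auto
    have la: "lab p q a = V (Suc i)" using lab_unseen i by simp
    show ?thesis
    proof (cases "b \<in> unseen")
      case True
      then show ?thesis
      proof (cases rule: unseen_cases)
        case (P j)
        then have "lab p q b = V (Suc j)" using lab_unseen by simp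
        moreover have "even j \<longleftrightarrow> odd i" using X_even_f(1)[OF U(2)] bX P by auto
        ultimately show ?thesis using la i P fb by (auto simp: tmpl_iff)
      next
        case (Q j)
        then show ?thesis using arc_p_even[of i j] arc_p_odd[of i j] i e by auto
      qed
    next
      case False
      then show ?thesis using la arc_p_W2[of i b] bX i e r4 unfolding lab_def[of p q b]
        by (auto simp: tmpl_iff)
    qed
  qed
qed

end

lemma arc_lab:
  assumes pq: "pqs p q" and e: "(a, b) \<in> E"
  shows "(lab p q a, lab p q b) \<in> tmpl r"
proof (cases "a \<in> X - unseen \<or> (\<exists>i. 2 \<le> i \<and> i < r \<and> a = p i)")
  case True
  then show ?thesis using arc_lab_half[OF pq e] by blast
next
  case False
  have U: "a \<in> U" "b \<in> U" using E_V e by auto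
  have "a \<in> (U - X) - unseen \<or> (\<exists>i. 2 \<le> i \<and> i < r \<and> a = q i)"
    using False U pqs_simps(9)[OF pq] by auto
  then have "(bip_pair.lab U E (U - X) y x q p a, bip_pair.lab U E (U - X) y x q p b) \<in> tmpl r"
    using bip_pair.arc_lab_half[OF swap pqs_swap[OF pq] e] unfolding unseen_swap by blast
  then show ?thesis unfolding lab_swap[OF U(1)] lab_swap[OF U(2)] tmpl_flip .
qed

theorem labelling:
  assumes "card unseen + card unseeing \<le> 2 * r - 4"
  shows "\<exists>l. tmpl_lab r U E X l"
proof -
  obtain p q where pq: "pqs p q" using deficit_eq[OF assms] by blast
  note ps = pqs_simps[OF pq]
  note Xf = X_even_f[OF pq]
  let ?l = "lab p q"
  have 1: "?l u \<in> bverts r \<and> (?l u \<in> B_class1 \<longleftrightarrow> u \<in> X)" if u: "u \<in> U" for u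
  proof (cases "u \<in> unseen")
    case True
    then show ?thesis
      by (cases rule: unseen_cases[OF pq]) (use lab_unseen[OF pq] Xf[OF u] in auto)
  next
    case False
    then show ?thesis using r4 unfolding lab_def by auto
  qed
  have ns: "x \<notin> unseen" "y \<notin> unseen" "p 1 \<notin> unseen" "q 1 \<notin> unseen"
    using unseen_iff xV yV ps(1)[of 1] ps(2)[of 1] ps(3-6)[of 1] r4 unfolding h_def by auto
  have "(x, q 2) \<notin> E" using d_eq_1[OF xV, of "q 2"] ps(2)[of 2] ps(6)[of 2] r4 by auto
  then have lx: "?l x = V 1" using ns xX unfolding lab_def by auto
  have "(y, p 2) \<notin> E" using d_eq_1[OF yV, of "p 2"] ps(1)[of 2] ps(4)[of 2] r4 by auto
  then have ly: "?l y = W 1" using ns yX unfolding lab_def by auto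
  have lp1: "?l (p 1) = V 2"
    using ns ps(7)[of 1] Xf(1)[OF ps(1)[of 1]] ps(3)[of 1] r4 unfolding lab_def by (simp add: numeral_2_eq_2)
  have lq1: "?l (q 1) = W 2"
    using ns ps(8)[of 1] Xf(2)[OF ps(2)[of 1]] ps(5)[of 1] r4 unfolding lab_def by (simp add: numeral_2_eq_2)
  have 2: "\<exists>u\<in>U. ?l u = s" if s: "s \<in> bverts r" for s
  proof (cases s)
    case (V i)
    then consider "i = 1" | "i = 2" | "3 \<le> i" "i \<le> r" using s by fastforce
    then show ?thesis
    proof cases
      case 3
      then show ?thesis using lab_unseen(1)[OF pq, of "i - 1"] ps(1)[of "i - 1"] V by (intro bexI[of _ "p (i - 1)"]) auto
    qed (use V lx xV lp1 ps(1)[of 1] r4 in auto)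
  next
    case (W i)
    then consider "i = 1" | "i = 2" | "3 \<le> i" "i \<le> r" using s by fastforce
    then show ?thesis
    proof cases
      case 3
      then show ?thesis using lab_unseen(2)[OF pq, of "i - 1"] ps(2)[of "i - 1"] W by (intro bexI[of _ "q (i - 1)"]) auto
    qed (use W ly yV lq1 ps(2)[of 1] r4 in auto)
  qed
  have 3: "u = (case s of V i \<Rightarrow> p (i - 1) | W i \<Rightarrow> q (i - 1))"
    if "s \<in> bverts r - {V 1, W 1, V 2, W 2}" "u \<in> U" "?l u = s" for s u
  proof (cases "u \<in> unseen")
    case True
    then show ?thesis
      by (cases rule: unseen_cases[OF pq]) (use lab_unseen[OF pq] that(3) in auto)
  next
    case False
    then show ?thesis using that unfolding lab_def by (auto split: if_splits)
  qed
  show ?thesis unfolding tmpl_lab_def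
  proof (intro exI[of _ ?l] conjI ballI allI impI)
    fix s u v assume "s \<in> bverts r - {V 1, W 1, V 2, W 2}" "u \<in> U" "v \<in> U" "?l u = s" "?l v = s"
    then show "u = v" using 3[of s u] 3[of s v] by (simp only:)
  qed (use arc_lab[OF pq] 1 2 in blast)+
qed

end

section \<open>Counting missing arcs\<close>

definition nonout :: "nat \<Rightarrow> base_vert \<Rightarrow> base_vert set" where
  "nonout r s = {t \<in> bverts r. (s \<in> B_class1 \<longleftrightarrow> t \<notin> B_class1) \<and> (s, t) \<notin> tmpl r}"

definition nonarcs :: "nat \<Rightarrow> base_vert rel" where
  "nonarcs r = Sigma (bverts r) (nonout r)"

lemma finite_nonout: "finite (nonout r s)" and finite_nonarcs: "finite (nonarcs r)"
  unfolding nonout_def nonarcs_def using finite_bverts by auto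

lemma card_bverts: "card (bverts r) = 2 * r"
proof -
  have "card (bverts r) = card (V ` {1..r}) + card (W ` {1..r})"
    unfolding bverts_def by (rule card_Un_disjoint) auto
  then show ?thesis by (simp add: card_image inj_on_def)
qed

lemma card_V_W_images:
  assumes "inj_on a A" "inj_on b B" "finite A" "finite B"
  shows "card ((\<lambda>k. V (a k)) ` A \<union> (\<lambda>k. W (b k)) ` B) = card A + card B"
proof -
  have "card ((\<lambda>k. V (a k)) ` A \<union> (\<lambda>k. W (b k)) ` B) = card ((\<lambda>k. V (a k)) ` A) + card ((\<lambda>k. W (b k)) ` B)"
    by (rule card_Un_disjoint) (use assms in auto)
  moreover have "card ((\<lambda>k. V (a k)) ` A) = card A" "card ((\<lambda>k. W (b k)) ` B) = card B"
    using assms by (auto intro!: card_image simp: inj_on_def)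
  ultimately show ?thesis by simp
qed

lemma nonout_flip: "nonout r (flip s) = flip ` nonout r s"
proof -
  have b: "flip t \<in> bverts r \<longleftrightarrow> t \<in> bverts r" "flip t \<in> B_class1 \<longleftrightarrow> t \<notin> B_class1" for t
    by (cases t; simp)+
  have *: "t \<in> nonout r (flip s) \<longleftrightarrow> flip t \<in> nonout r s" for t
    using tmpl_flip[of s "flip t" r] b[of t] b[of s] unfolding nonout_def by auto
  show ?thesis
  proof (intro equalityI subsetI)
    fix t assume "t \<in> nonout r (flip s)"
    then have "flip t \<in> nonout r s" using * by simp
    then show "t \<in> flip ` nonout r s" by (rule rev_image_eqI) simp
  next
    fix t assume "t \<in> flip ` nonout r s"
    then show "t \<in> nonout r (flip s)" using *[of t] by auto
  qed
qed

lemma card_nonout_flip: "card (nonout r (flip s)) = card (nonout r s)"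
  unfolding nonout_flip by (rule card_image) (metis flip_flip inj_on_inverseI)

text \<open>A copy of \<open>V 2\<close> misses as many out-arcs as a copy of \<open>V 1\<close>, so
  out-arcs cannot tell which repetition is cheaper; the difference lies in the in-arcs.\<close>

lemma card_nonout_1_2:
  assumes "even r" "4 \<le> r" and s: "s \<in> {V 1, W 1, V 2, W 2}"
  shows "card (nonout r s) = r - 2"
proof -
  obtain m where m: "r = 2 * m" "2 \<le> m" using assms by (auto elim: evenE)
  have "nonout r (V 1) = (\<lambda>k. V (2 * k + 4)) ` {..<m - 1} \<union> (\<lambda>k. W (2 * k + 3)) ` {..<m - 1}" (is "?L = ?R")
  proof (rule set_eqI)
    fix t show "t \<in> ?L \<longleftrightarrow> t \<in> ?R"
    proof (cases t)
      case (V j)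
      have "even j \<and> 2 < j \<and> j \<le> r \<longleftrightarrow> (\<exists>k<m - 1. j = 2 * k + 4)" unfolding m
        by (rule iffI, rule exI[of _ "j div 2 - 2"]) auto
      then show ?thesis using V assms unfolding nonout_def by (auto simp: tmpl_iff)
    next
      case (W j)
      have "odd j \<and> j \<noteq> 1 \<and> j \<le> r \<longleftrightarrow> (\<exists>k<m - 1. j = 2 * k + 3)" unfolding m
        by (rule iffI, rule exI[of _ "(j - 3) div 2"]) (auto, presburger+)
      then show ?thesis using W assms unfolding nonout_def by (auto simp: tmpl_iff)
    qed
  qed
  then have 1: "card (nonout r (V 1)) = r - 2" by (simp add: card_V_W_images inj_on_def m)
  have "nonout r (V 2) = (\<lambda>k. V (2 * k + 5)) ` {..<m - 2} \<union> (\<lambda>k. W (2 * k + 2)) ` {..<m}" (is "?L = ?R")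
  proof (rule set_eqI)
    fix t show "t \<in> ?L \<longleftrightarrow> t \<in> ?R"
    proof (cases t)
      case (V j)
      have "odd j \<and> 3 < j \<and> j \<le> r \<longleftrightarrow> (\<exists>k<m - 2. j = 2 * k + 5)" unfolding m
        by (rule iffI, rule exI[of _ "(j - 5) div 2"]) (auto, presburger+)
      then show ?thesis using V assms unfolding nonout_def by (auto simp: tmpl_iff)
    next
      case (W j)
      have "even j \<and> 1 \<le> j \<and> j \<le> r \<longleftrightarrow> (\<exists>k<m. j = 2 * k + 2)" unfolding m
        by (rule iffI, rule exI[of _ "j div 2 - 1"]) auto
      then show ?thesis using W assms unfolding nonout_def by (auto simp: tmpl_iff)
    qed
  qed
  then have 2: "card (nonout r (V 2)) = r - 2" using m by (simp add: card_V_W_images inj_on_def)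
  show ?thesis using s 1 2 card_nonout_flip[of r "V 1"] card_nonout_flip[of r "V 2"] by auto
qed

lemma nonout_not_1: "s \<in> bverts r \<Longrightarrow> t \<in> nonout r s \<Longrightarrow> t \<notin> {V 1, W 1}"
  unfolding nonout_def by (cases s) (auto simp: tmpl_iff)

lemma nonarcsD:
  assumes "(s, t) \<in> nonarcs r"
  shows "s \<in> bverts r" "t \<in> bverts r" "t \<notin> {V 1, W 1}"
  using assms nonout_not_1[of s r t] unfolding nonarcs_def nonout_def by auto

lemma nonout_1_not_2: "s \<in> {V 1, W 1} \<Longrightarrow> V 2 \<notin> nonout r s \<and> W 2 \<notin> nonout r s" 
  unfolding nonout_def by (auto simp: tmpl_iff)

lemma nonarcs_sum_left:
  fixes n :: "base_vert \<Rightarrow> nat"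
  assumes r: "even r" "4 \<le> r"
    and n1: "\<And>s. s \<in> bverts r \<Longrightarrow> 1 \<le> n s"
    and n2: "\<And>s. s \<in> bverts r - {V 1, W 1, V 2, W 2} \<Longrightarrow> n s = 1"
  shows "(\<Sum>(s, t)\<in>nonarcs r. n s - 1) = (r - 2) * ((\<Sum>s\<in>bverts r. n s) - 2 * r)"
proof -
  have "(\<Sum>(s, t)\<in>nonarcs r. n s - 1) = (\<Sum>s\<in>bverts r. \<Sum>t\<in>nonout r s. n s - 1)"
    unfolding nonarcs_def by (rule sum.Sigma[symmetric]) (auto simp: finite_bverts finite_nonout)
  also have "\<dots> = (\<Sum>s\<in>bverts r. (r - 2) * (n s - 1))"
  proof (rule sum.cong[OF refl])
    fix s assume "s \<in> bverts r"
    then show "(\<Sum>t\<in>nonout r s. n s - 1) = (r - 2) * (n s - 1)"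
      using n2[of s] card_nonout_1_2[OF r, of s] by (cases "s \<in> {V 1, W 1, V 2, W 2}") auto
  qed
  also have "\<dots> = (r - 2) * (\<Sum>s\<in>bverts r. n s - 1)" by (simp add: sum_distrib_left)
  also have "(\<Sum>s\<in>bverts r. n s - 1) = (\<Sum>s\<in>bverts r. n s) - (\<Sum>s\<in>bverts r. 1)"
    by (rule sum_subtractf_nat) (use n1 in auto)
  finally show ?thesis by (simp add: card_bverts)
qed

text \<open>Expand \<open>n s * n t \<ge> 1 + (n s - 1) + (n t - 1)\<close>. The tail terms cost
  \<open>r - 2\<close> per extra copy for all four repeatable labels. For the head terms,
  \<open>V 2\<close> and \<open>W 2\<close> miss both arcs between them, so each extra copy of
  either costs at least one more, whereas by \<open>nonarcsD\<close> nothing is missing into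
  \<open>V 1\<close> or \<open>W 1\<close>.\<close>

lemma nonarcs_sum_ge:
  fixes n :: "base_vert \<Rightarrow> nat"
  assumes r: "even r" "4 \<le> r"
    and n1: "\<And>s. s \<in> bverts r \<Longrightarrow> 1 \<le> n s"
    and n2: "\<And>s. s \<in> bverts r - {V 1, W 1, V 2, W 2} \<Longrightarrow> n s = 1"
  shows "card (nonarcs r) + (r - 2) * ((\<Sum>s\<in>bverts r. n s) - 2 * r) + (n (V 2) - 1) + (n (W 2) - 1)
    \<le> (\<Sum>(s, t)\<in>nonarcs r. n s * n t)"
proof -
  have "(\<Sum>(s, t)\<in>nonarcs r. 1 + (n s - 1) + (n t - 1)) \<le> (\<Sum>(s, t)\<in>nonarcs r. n s * n t)"
  proof (rule sum_mono, clarify)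
    fix s t assume "(s, t) \<in> nonarcs r"
    then have "1 \<le> n s" "1 \<le> n t" using n1 nonarcsD by blast+
    then obtain a b where "n s = Suc a" "n t = Suc b" by (metis One_nat_def Suc_le_D)
    then show "1 + (n s - 1) + (n t - 1) \<le> n s * n t" by simp
  qed
  moreover have "(\<Sum>(s, t)\<in>nonarcs r. 1 + (n s - 1) + (n t - 1))
    = card (nonarcs r) + (\<Sum>(s, t)\<in>nonarcs r. n s - 1) + (\<Sum>(s, t)\<in>nonarcs r. n t - 1)"
    unfolding case_prod_unfold sum.distrib by simp
  moreover have "(\<Sum>(s, t)\<in>{(V 2, W 2), (W 2, V 2)}. n t - 1) \<le> (\<Sum>(s, t)\<in>nonarcs r. n t - 1)"
  proof (rule sum_mono2[OF finite_nonarcs])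
    show "{(V 2, W 2), (W 2, V 2)} \<subseteq> nonarcs r"
      unfolding nonarcs_def nonout_def using r by (auto simp: tmpl_iff)
  qed auto
  moreover have "(\<Sum>(s, t)\<in>nonarcs r. n s - 1) = (r - 2) * ((\<Sum>s\<in>bverts r. n s) - 2 * r)"
    by (rule nonarcs_sum_left) (use assms in auto)
  moreover have "(\<Sum>(s, t)\<in>{(V 2, W 2), (W 2, V 2)}. n t - 1) = (n (W 2) - 1) + (n (V 2) - 1)" by simp
  ultimately show ?thesis by linarith
qed

lemma nonarcs_sum_eq:
  fixes n :: "base_vert \<Rightarrow> nat"
  assumes r: "even r" "4 \<le> r"
    and n1: "\<And>s. s \<in> bverts r \<Longrightarrow> 1 \<le> n s"
    and n2: "\<And>s. s \<in> bverts r - {V 1, W 1} \<Longrightarrow> n s = 1"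
  shows "(\<Sum>(s, t)\<in>nonarcs r. n s * n t) = card (nonarcs r) + (r - 2) * ((\<Sum>s\<in>bverts r. n s) - 2 * r)"
proof -
  have "(\<Sum>(s, t)\<in>nonarcs r. n s * n t) = (\<Sum>(s, t)\<in>nonarcs r. 1 + (n s - 1))"
  proof (rule sum.cong[OF refl], clarify)
    fix s t assume a: "(s, t) \<in> nonarcs r"
    then have "1 \<le> n s" "n t = 1" using n1[of s] n2[of t] nonarcsD[OF a] by auto
    then show "n s * n t = 1 + (n s - 1)" by simp
  qed
  also have "\<dots> = card (nonarcs r) + (\<Sum>(s, t)\<in>nonarcs r. n s - 1)"
    unfolding case_prod_unfold sum.distrib by simp
  also have "(\<Sum>(s, t)\<in>nonarcs r. n s - 1) = (r - 2) * ((\<Sum>s\<in>bverts r. n s) - 2 * r)"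
    by (rule nonarcs_sum_left) (use assms in auto)
  finally show ?thesis .
qed

section \<open>Missing arcs of a labelled digraph\<close>

definition missing :: "'a set \<Rightarrow> 'a rel \<Rightarrow> 'a set \<Rightarrow> 'a rel" where
  "missing U E X = {(a, b). a \<in> U \<and> b \<in> U \<and> (a \<in> X \<longleftrightarrow> b \<notin> X) \<and> (a, b) \<notin> E}"

lemma finite_missing: "finite U \<Longrightarrow> finite (missing U E X)"
  by (rule finite_subset[of _ "U \<times> U"]) (auto simp: missing_def)

lemma card_missing:
  assumes fin: "finite U" and X: "X \<subseteq> U" and E: "E \<subseteq> U \<times> U" and bip: "\<And>a b. (a, b) \<in> E \<Longrightarrow> a \<in> X \<longleftrightarrow> b \<notin> X"
  shows "card (missing U E X) + card E = 2 * (card X * card (U - X))"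
proof -
  have fX: "finite X" "finite (U - X)" using fin X finite_subset by auto
  have "missing U E X \<union> E = X \<times> (U - X) \<union> (U - X) \<times> X"
    unfolding missing_def using X E bip by auto
  moreover have "card (missing U E X \<union> E) = card (missing U E X) + card E"
    by (rule card_Un_disjoint) (use finite_missing[OF fin] finite_subset[OF E] fin in \<open>auto simp: missing_def\<close>)
  moreover have "card (X \<times> (U - X) \<union> (U - X) \<times> X) = card (X \<times> (U - X)) + card ((U - X) \<times> X)"
    by (rule card_Un_disjoint) (use fX in auto)
  ultimately show ?thesis using fX by (simp add: card_cartesian_product mult.commute[of "card (U - X)"])
qed

definition fibre :: "'a set \<Rightarrow> ('a \<Rightarrow> 'l) \<Rightarrow> 'l \<Rightarrow> 'a set" where
  "fibre U l s = {u \<in> U. l u = s}"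

lemma card_pullback:
  assumes "finite U" "finite R"
  shows "card {(a, b). a \<in> U \<and> b \<in> U \<and> (l a, l b) \<in> R} = (\<Sum>(s, t)\<in>R. card (fibre U l s) * card (fibre U l t))"
proof -
  have "{(a, b). a \<in> U \<and> b \<in> U \<and> (l a, l b) \<in> R} = (\<Union>(s, t)\<in>R. fibre U l s \<times> fibre U l t)"
    unfolding fibre_def by auto
  moreover have "card (\<Union>(s, t)\<in>R. fibre U l s \<times> fibre U l t) = (\<Sum>(s, t)\<in>R. card (fibre U l s \<times> fibre U l t))"
    unfolding case_prod_unfold
    by (rule card_UN_disjoint) (use assms in \<open>auto simp: fibre_def\<close>)
  ultimately show ?thesis by (simp add: card_cartesian_product)
qed

lemma sum_fib:
  assumes "finite U" "finite B" "\<forall>u\<in>U. l u \<in> B"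
  shows "(\<Sum>s\<in>B. card (fibre U l s)) = card U"
proof -
  have "U = (\<Union>s\<in>B. fibre U l s)" using assms unfolding fibre_def by auto
  then have "card U = card (\<Union>s\<in>B. fibre U l s)" by simp
  also have "\<dots> = (\<Sum>s\<in>B. card (fibre U l s))"
    by (rule card_UN_disjoint) (use assms in \<open>auto simp: fibre_def\<close>)
  finally show ?thesis by simp
qed

lemma tmpl_lab_fib:
  assumes l: "tmpl_lab r U E X l" and U: "finite U"
  shows "s \<in> bverts r \<Longrightarrow> 1 \<le> card (fibre U l s)"
    and "s \<in> bverts r - {V 1, W 1, V 2, W 2} \<Longrightarrow> card (fibre U l s) = 1"
    and "(\<Sum>s\<in>bverts r. card (fibre U l s)) = card U"
proof -
  have fin: "finite (fibre U l s)" for s unfolding fibre_def using U by simp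
  have ne: "fibre U l s \<noteq> {}" if "s \<in> bverts r" for s using l that unfolding tmpl_lab_def fibre_def by auto
  show 1: "1 \<le> card (fibre U l s)" if "s \<in> bverts r" for s
    using fin ne[OF that] by (simp add: Suc_le_eq card_gt_0_iff)
  show "card (fibre U l s) = 1" if s: "s \<in> bverts r - {V 1, W 1, V 2, W 2}"
  proof -
    obtain u where u: "u \<in> fibre U l s" using ne s by blast
    have "\<And>v. v \<in> fibre U l s \<Longrightarrow> v = u"
      using l s u unfolding tmpl_lab_def fibre_def by blast
    then have "fibre U l s = {u}" using u by blast
    then show ?thesis by simp
  qed
  show "(\<Sum>s\<in>bverts r. card (fibre U l s)) = card U"
    by (rule sum_fib[OF U finite_bverts]) (use l in \<open>auto simp: tmpl_lab_def\<close>)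
qed

lemma tmpl_lab_pull:
  assumes l: "tmpl_lab r U E X l"
  shows "{(a, b). a \<in> U \<and> b \<in> U \<and> (l a, l b) \<in> nonarcs r} \<subseteq> missing U E X"
  using l unfolding tmpl_lab_def nonarcs_def nonout_def missing_def by auto

lemma tmpl_lab_missing_ge:
  assumes l: "tmpl_lab r U E X l" and U: "finite U" and r: "even r" "4 \<le> r"
  shows "card (nonarcs r) + (r - 2) * (card U - 2 * r) + (card (fibre U l (V 2)) - 1) + (card (fibre U l (W 2)) - 1)
    \<le> card (missing U E X)"
proof -
  have "card (nonarcs r) + (r - 2) * (card U - 2 * r) + (card (fibre U l (V 2)) - 1) + (card (fibre U l (W 2)) - 1)
    \<le> (\<Sum>(s, t)\<in>nonarcs r. card (fibre U l s) * card (fibre U l t))"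
    using nonarcs_sum_ge[OF r, of "\<lambda>s. card (fibre U l s)"] tmpl_lab_fib[OF l U] by simp
  also have "\<dots> \<le> card (missing U E X)"
    unfolding card_pullback[OF U finite_nonarcs, symmetric]
    by (rule card_mono[OF finite_missing[OF U] tmpl_lab_pull[OF l]])
  finally show ?thesis .
qed

text \<open>The bound \<open>le\<close> is that of \<open>tmpl_lab_missing_ge\<close> without its
  last two terms, so these vanish. Then the arcs missing are exactly those forced by the labels, and
  every arc allowed by the template is present.\<close>

lemma tmpl_lab_extremal:
  assumes l: "tmpl_lab r U E X l" and U: "finite U" and r: "even r" "4 \<le> r"
    and le: "card (missing U E X) \<le> card (nonarcs r) + (r - 2) * (card U - 2 * r)"
    and E: "E \<subseteq> U \<times> U"
  shows "card (fibre U l (V 2)) = 1" "card (fibre U l (W 2)) = 1"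
    "E = {(a, b). a \<in> U \<and> b \<in> U \<and> (l a, l b) \<in> tmpl r}"
proof -
  have ge1: "1 \<le> card (fibre U l (V 2))" "1 \<le> card (fibre U l (W 2))"
    using tmpl_lab_fib(1)[OF l U] r by auto
  show one: "card (fibre U l (V 2)) = 1" "card (fibre U l (W 2)) = 1"
    using tmpl_lab_missing_ge[OF l U r] le ge1 by linarith+
  have "card (fibre U l s) = 1" if "s \<in> bverts r - {V 1, W 1}" for s
    using tmpl_lab_fib(2)[OF l U, of s] one that by (cases "s \<in> {V 2, W 2}") auto
  then have "(\<Sum>(s, t)\<in>nonarcs r. card (fibre U l s) * card (fibre U l t)) = card (nonarcs r) + (r - 2) * (card U - 2 * r)"
    using nonarcs_sum_eq[OF r, of "\<lambda>s. card (fibre U l s)"] tmpl_lab_fib(1,3)[OF l U] by simp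
  then have "{(a, b). a \<in> U \<and> b \<in> U \<and> (l a, l b) \<in> nonarcs r} = missing U E X"
    by (intro card_seteq[OF finite_missing[OF U] tmpl_lab_pull[OF l]])
      (use le card_pullback[OF U finite_nonarcs] in simp)
  then have *: "(a, b) \<in> E" if "a \<in> U" "b \<in> U" "(l a, l b) \<in> tmpl r" for a b
  proof -
    assume eq: "{(a, b). a \<in> U \<and> b \<in> U \<and> (l a, l b) \<in> nonarcs r} = missing U E X"
    have "(l a, l b) \<notin> nonarcs r" using that unfolding nonarcs_def nonout_def by auto
    then have "(a, b) \<notin> missing U E X" unfolding eq[symmetric] by simp
    moreover have "l a \<in> B_class1 \<longleftrightarrow> l b \<notin> B_class1"
      using that(3) unfolding tmpl_def by (auto simp: class_compl)
    ultimately show ?thesis using l that unfolding missing_def tmpl_lab_def by auto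
  qed
  show "E = {(a, b). a \<in> U \<and> b \<in> U \<and> (l a, l b) \<in> tmpl r}"
    using * E l unfolding tmpl_lab_def by auto
qed

text \<open>The count is exact because the labels in \<open>nonout\<close> of \<open>V 1\<close> and
  \<open>W 1\<close> avoid the four repeatable ones, so each is carried by a single vertex.\<close>

lemma tmpl_lab_missing_1:
  assumes l: "tmpl_lab r U E X l" and U: "finite U" and r: "even r" "4 \<le> r"
  shows "card {(a, b). a \<in> U \<and> b \<in> U \<and> l a \<in> {V 1, W 1} \<and> (l a, l b) \<in> nonarcs r}
    = (r - 2) * (card (fibre U l (V 1)) + card (fibre U l (W 1)))"
proof -
  let ?R = "Sigma {V 1, W 1} (nonout r)"
  have "{(a, b). a \<in> U \<and> b \<in> U \<and> l a \<in> {V 1, W 1} \<and> (l a, l b) \<in> nonarcs r}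
      = {(a, b). a \<in> U \<and> b \<in> U \<and> (l a, l b) \<in> ?R}"
    using r unfolding nonarcs_def by auto
  also have "card \<dots> = (\<Sum>(s, t)\<in>?R. card (fibre U l s) * card (fibre U l t))"
    by (rule card_pullback[OF U]) (simp add: finite_nonout)
  also have "\<dots> = (\<Sum>s\<in>{V 1, W 1}. \<Sum>t\<in>nonout r s. card (fibre U l s) * card (fibre U l t))"
    by (rule sum.Sigma[symmetric]) (auto simp: finite_nonout)
  also have "\<dots> = (\<Sum>s\<in>{V 1, W 1}. (r - 2) * card (fibre U l s))"
  proof (rule sum.cong[OF refl])
    fix s assume s: "s \<in> {V 1, W 1}"
    have "card (fibre U l t) = 1" if "t \<in> nonout r s" for t
    proof (rule tmpl_lab_fib(2)[OF l U])
      have "t \<in> bverts r" using that unfolding nonout_def by simp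
      moreover have "t \<notin> {V 1, W 1}" using nonout_not_1[OF _ that] s r by auto
      ultimately show "t \<in> bverts r - {V 1, W 1, V 2, W 2}" using nonout_1_not_2[OF s] that by auto
    qed
    then show "(\<Sum>t\<in>nonout r s. card (fibre U l s) * card (fibre U l t)) = (r - 2) * card (fibre U l s)"
      using card_nonout_1_2[OF r, of s] s by auto
  qed
  finally show ?thesis by (simp add: algebra_simps)
qed

section \<open>A bounded kernel\<close>

text \<open>Markov's inequality, with the factor \<open>c\<close> in place of a division.\<close>

lemma card_threshold:
  fixes w :: "'a \<Rightarrow> nat"
  assumes "finite A"
  shows "card {u \<in> A. t \<le> c * w u} * t \<le> c * (\<Sum>u\<in>A. w u)"
proof -
  have "card {u \<in> A. t \<le> c * w u} * t = (\<Sum>u\<in>{u \<in> A. t \<le> c * w u}. t)" by simp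
  also have "\<dots> \<le> (\<Sum>u\<in>{u \<in> A. t \<le> c * w u}. c * w u)" by (rule sum_mono) simp
  also have "\<dots> \<le> (\<Sum>u\<in>A. c * w u)" by (rule sum_mono2) (use assms in auto)
  finally show ?thesis by (simp add: sum_distrib_left)
qed

lemma rtrancl_Int_mono: "(u, v) \<in> (E \<inter> K \<times> K)\<^sup>* \<Longrightarrow> K \<subseteq> S \<Longrightarrow> (u, v) \<in> (E \<inter> S \<times> S)\<^sup>*"
  by (erule rtrancl_mono[THEN subsetD, rotated]) auto

lemma relpow_subset: "(A :: 'a rel) \<subseteq> B \<Longrightarrow> A ^^ k \<subseteq> B ^^ k"
  by (induction k) (simp_all add: relcomp_mono)

text \<open>\<open>P\<close> is the vertex set of a walk. Connectivity is asserted inside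
  \<open>P\<close>, so it persists in every larger induced subdigraph by
  \<open>rtrancl_Int_mono\<close>.\<close>

lemma relpow_path_set:
  "(a, b) \<in> E ^^ k \<Longrightarrow> \<exists>P. finite P \<and> card P \<le> Suc k \<and> a \<in> P \<and> b \<in> P \<and> P \<subseteq> insert a (Range E) \<and>
    (\<forall>w\<in>P. (a, w) \<in> (E \<inter> P \<times> P)\<^sup>* \<and> (w, b) \<in> (E \<inter> P \<times> P)\<^sup>*)"
proof (induction k arbitrary: b)
  case 0
  then show ?case by (intro exI[of _ "{a}"]) auto
next
  case (Suc k)
  then obtain c where c: "(a, c) \<in> E ^^ k" "(c, b) \<in> E" by auto
  from Suc.IH[OF c(1)] obtain P where P: "finite P" "card P \<le> Suc k" "a \<in> P" "c \<in> P" "P \<subseteq> insert a (Range E)"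
    "\<And>w. w \<in> P \<Longrightarrow> (a, w) \<in> (E \<inter> P \<times> P)\<^sup>*" "\<And>w. w \<in> P \<Longrightarrow> (w, c) \<in> (E \<inter> P \<times> P)\<^sup>*" by blast
  let ?P = "insert b P"
  have cb: "(c, b) \<in> E \<inter> ?P \<times> ?P" using c P by simp
  have 1: "(a, w) \<in> (E \<inter> ?P \<times> ?P)\<^sup>*" "(w, b) \<in> (E \<inter> ?P \<times> ?P)\<^sup>*" if "w \<in> P" for w
    using rtrancl_Int_mono[OF P(6)[OF that], of ?P]
      rtrancl_into_rtrancl[OF rtrancl_Int_mono[OF P(7)[OF that], of ?P] cb] by auto
  have 2: "(a, b) \<in> (E \<inter> ?P \<times> ?P)\<^sup>*" using 1(2)[OF P(3)] .
  show ?case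
  proof (intro exI[of _ ?P] conjI ballI)
    show "card ?P \<le> Suc (Suc k)" using P(1,2) by (simp add: card_insert_if)
    fix w assume "w \<in> ?P"
    then show "(a, w) \<in> (E \<inter> ?P \<times> ?P)\<^sup>*" "(w, b) \<in> (E \<inter> ?P \<times> ?P)\<^sup>*" using 1 2 by auto
  qed (use P c in auto)
qed

context bip_rel
begin

abbreviation ms :: "'a rel" where "ms \<equiv> missing U E X"

definition out_miss :: "'a \<Rightarrow> 'a set" where "out_miss u = {v. (u, v) \<in> ms}"
definition in_miss :: "'a \<Rightarrow> 'a set" where "in_miss u = {v. (v, u) \<in> ms}"
definition deficit :: "'a \<Rightarrow> nat" where "deficit u = card (out_miss u) + card (in_miss u)"

lemma fin_ms: "finite ms" by (rule finite_missing[OF finV])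

lemma mo_iff: "v \<in> out_miss u \<longleftrightarrow> u \<in> U \<and> v \<in> U \<and> (u \<in> X \<longleftrightarrow> v \<notin> X) \<and> (u, v) \<notin> E"
  and mi_iff: "v \<in> in_miss u \<longleftrightarrow> u \<in> U \<and> v \<in> U \<and> (u \<in> X \<longleftrightarrow> v \<notin> X) \<and> (v, u) \<notin> E"
  unfolding out_miss_def in_miss_def missing_def by auto

lemma fin_mo: "finite (out_miss u)" and fin_mi: "finite (in_miss u)"
  by (rule finite_subset[OF _ finV]; use mo_iff mi_iff in blast)+

lemma sum_mo: "(\<Sum>u\<in>U. card (out_miss u)) = card ms" and sum_mi: "(\<Sum>u\<in>U. card (in_miss u)) = card ms"
proof -
  have "ms = Sigma U out_miss" unfolding out_miss_def by (auto simp: missing_def)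
  then show "(\<Sum>u\<in>U. card (out_miss u)) = card ms" using card_SigmaI[of U out_miss] finV fin_mo by simp
  have "ms = (\<lambda>(u, v). (v, u)) ` Sigma U in_miss" unfolding in_miss_def by (auto simp: missing_def image_iff)
  then have "card ms = card (Sigma U in_miss)" by (simp add: card_image inj_on_def)
  then show "(\<Sum>u\<in>U. card (in_miss u)) = card ms" using card_SigmaI[of U in_miss] finV fin_mi by simp
qed

lemma sum_dfc: "(\<Sum>u\<in>U. deficit u) = 2 * card ms"
  unfolding deficit_def sum.distrib sum_mo sum_mi by simp

text \<open>Passing to an induced subdigraph cannot shorten distances, so far vertices stay far.\<close>
lemma restrict:
  assumes S: "S \<subseteq> U"
    and far: "\<And>u. u \<in> S \<Longrightarrow> \<exists>v\<in>S. r \<le> d u v"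
    and strong: "\<And>u v. u \<in> S \<Longrightarrow> v \<in> S \<Longrightarrow> (u, v) \<in> (E \<inter> S \<times> S)\<^sup>*"
  shows "bip_rel S (E \<inter> S \<times> S) (X \<inter> S) r"
proof unfold_locales
  show "finite S" using S finV finite_subset by blast
  show "u \<in> X \<inter> S \<longleftrightarrow> v \<notin> X \<inter> S" if "(u, v) \<in> E \<inter> S \<times> S" for u v using bip[of u v] that by auto
  show "\<exists>v\<in>S. \<forall>k<r. (u, v) \<notin> (E \<inter> S \<times> S) ^^ k" if u: "u \<in> S" for u
  proof -
    obtain v where v: "v \<in> S" "r \<le> d u v" using far[OF u] by auto
    have "(u, v) \<notin> (E \<inter> S \<times> S) ^^ k" if "k < r" for k
    proof
      assume "(u, v) \<in> (E \<inter> S \<times> S) ^^ k"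
      then have "(u, v) \<in> E ^^ k" using relpow_subset[of "E \<inter> S \<times> S" E k] by blast
      then show False using hops_le[of u v k E] v(2) that by simp
    qed
    then show ?thesis using v by blast
  qed
qed (use strong r4 evr in auto)

lemma restrict_pair:
  assumes R: "bip_rel S (E \<inter> S \<times> S) (X \<inter> S) r" and S: "S \<subseteq> U"
    and xy: "x \<in> X \<inter> S" "y \<in> S - X" "(x, y) \<in> E" "(y, x) \<in> E"
  shows "bip_pair S (E \<inter> S \<times> S) (X \<inter> S) r x y"
    and "bip_pair.unseen S (E \<inter> S \<times> S) (X \<inter> S) x y = out_miss x \<inter> S \<union> out_miss y \<inter> S"
    and "bip_pair.unseeing S (E \<inter> S \<times> S) (X \<inter> S) x y = in_miss x \<inter> S \<union> in_miss y \<inter> S"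
proof -
  show P: "bip_pair S (E \<inter> S \<times> S) (X \<inter> S) r x y"
    using R xy by (intro bip_pair.intro bip_pair_axioms.intro) auto
  show "bip_pair.unseen S (E \<inter> S \<times> S) (X \<inter> S) x y = out_miss x \<inter> S \<union> out_miss y \<inter> S"
    unfolding bip_pair.unseen_def[OF P] using xy S by (auto simp: mo_iff)
  show "bip_pair.unseeing S (E \<inter> S \<times> S) (X \<inter> S) x y = in_miss x \<inter> S \<union> in_miss y \<inter> S"
    unfolding bip_pair.unseeing_def[OF P] using xy S by (auto simp: mi_iff)
qed

text \<open>\<open>z\<close> serves as a hub: for each \<open>v\<close> in \<open>K0\<close> a path
  from \<open>z\<close> to \<open>v\<close> and one back are added, each with at most
  \<open>D + 1\<close> vertices. This keeps the size linear in \<open>card K0\<close>.\<close>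

lemma connector:
  assumes K0: "K0 \<subseteq> U" "z \<in> K0" and D: "\<And>u v. u \<in> U \<Longrightarrow> v \<in> U \<Longrightarrow> d u v \<le> D"
  shows "\<exists>K. K0 \<subseteq> K \<and> K \<subseteq> U \<and> card K \<le> card K0 * (2 * D + 2) \<and>
    (\<forall>u\<in>K. \<forall>v\<in>K. (u, v) \<in> (E \<inter> K \<times> K)\<^sup>*)"
proof -
  have RE: "Range E \<subseteq> U" using E_sub by auto
  have ex: "\<exists>P. finite P \<and> card P \<le> Suc D \<and> a \<in> P \<and> b \<in> P \<and> P \<subseteq> U \<and>
    (\<forall>w\<in>P. (a, w) \<in> (E \<inter> P \<times> P)\<^sup>* \<and> (w, b) \<in> (E \<inter> P \<times> P)\<^sup>*)" if ab: "a \<in> U" "b \<in> U" for a b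
  proof -
    obtain P where P: "finite P" "card P \<le> Suc (d a b)" "a \<in> P" "b \<in> P" "P \<subseteq> insert a (Range E)"
      "\<forall>w\<in>P. (a, w) \<in> (E \<inter> P \<times> P)\<^sup>* \<and> (w, b) \<in> (E \<inter> P \<times> P)\<^sup>*"
      using relpow_path_set[OF d_relpow[OF ab]] by blast
    have "card P \<le> Suc D" using P(2) D[OF ab] by linarith
    moreover have "P \<subseteq> U" using P(5) RE ab by blast
    ultimately show ?thesis using P by blast
  qed
  define \<pi> where "\<pi> a b = (SOME P. finite P \<and> card P \<le> Suc D \<and> a \<in> P \<and> b \<in> P \<and> P \<subseteq> U \<and>
    (\<forall>w\<in>P. (a, w) \<in> (E \<inter> P \<times> P)\<^sup>* \<and> (w, b) \<in> (E \<inter> P \<times> P)\<^sup>*))" for a b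
  have \<pi>: "finite (\<pi> a b) \<and> card (\<pi> a b) \<le> Suc D \<and> a \<in> \<pi> a b \<and> b \<in> \<pi> a b \<and> \<pi> a b \<subseteq> U \<and>
    (\<forall>w\<in>\<pi> a b. (a, w) \<in> (E \<inter> \<pi> a b \<times> \<pi> a b)\<^sup>* \<and> (w, b) \<in> (E \<inter> \<pi> a b \<times> \<pi> a b)\<^sup>*)" if "a \<in> U" "b \<in> U" for a b
    unfolding \<pi>_def by (rule someI_ex[OF ex[OF that]])
  define K where "K = (\<Union>v\<in>K0. \<pi> z v \<union> \<pi> v z)"
  have zU: "z \<in> U" and finK0: "finite K0" using K0 finV finite_subset by auto
  have vU: "v \<in> U" if "v \<in> K0" for v using K0 that by auto
  have sub: "K0 \<subseteq> K"
  proof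
    fix v assume v: "v \<in> K0"
    then have "v \<in> \<pi> z v" using \<pi>[OF zU vU[OF v]] by blast
    then show "v \<in> K" unfolding K_def using v by blast
  qed
  have KU: "K \<subseteq> U" unfolding K_def using \<pi> zU vU by blast
  have "card K \<le> (\<Sum>v\<in>K0. card (\<pi> z v \<union> \<pi> v z))" unfolding K_def by (rule card_UN_le[OF finK0])
  also have "\<dots> \<le> (\<Sum>v\<in>K0. 2 * D + 2)"
  proof (rule sum_mono)
    fix v assume v: "v \<in> K0"
    show "card (\<pi> z v \<union> \<pi> v z) \<le> 2 * D + 2"
      using card_Un_le[of "\<pi> z v" "\<pi> v z"] \<pi>[OF zU vU[OF v]] \<pi>[OF vU[OF v] zU] by linarith
  qed
  finally have cK: "card K \<le> card K0 * (2 * D + 2)" by simp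
  have hub: "(z, w) \<in> (E \<inter> K \<times> K)\<^sup>* \<and> (w, z) \<in> (E \<inter> K \<times> K)\<^sup>*" if w: "w \<in> K" for w
  proof -
    obtain v where v: "v \<in> K0" "w \<in> \<pi> z v \<or> w \<in> \<pi> v z" using w unfolding K_def by blast
    have s: "\<pi> z v \<subseteq> K" "\<pi> v z \<subseteq> K" unfolding K_def using v(1) by blast+
    note a = \<pi>[OF zU vU[OF v(1)]] and b = \<pi>[OF vU[OF v(1)] zU]
    have zv: "(z, v) \<in> (E \<inter> K \<times> K)\<^sup>*" using a rtrancl_Int_mono[OF _ s(1)] by blast
    have vz: "(v, z) \<in> (E \<inter> K \<times> K)\<^sup>*" using b rtrancl_Int_mono[OF _ s(2)] by blast
    from v(2) show ?thesis
    proof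
      assume "w \<in> \<pi> z v"
      then have "(z, w) \<in> (E \<inter> K \<times> K)\<^sup>*" "(w, v) \<in> (E \<inter> K \<times> K)\<^sup>*"
        using a rtrancl_Int_mono[OF _ s(1)] by blast+
      then show ?thesis using vz by (meson rtrancl_trans)
    next
      assume "w \<in> \<pi> v z"
      then have "(w, z) \<in> (E \<inter> K \<times> K)\<^sup>*" "(v, w) \<in> (E \<inter> K \<times> K)\<^sup>*"
        using b rtrancl_Int_mono[OF _ s(2)] by blast+
      then show ?thesis using zv by (meson rtrancl_trans)
    qed
  qed
  have "(u, v) \<in> (E \<inter> K \<times> K)\<^sup>*" if "u \<in> K" "v \<in> K" for u v
    using hub[OF that(1)] hub[OF that(2)] by (meson rtrancl_trans)
  then show ?thesis using sub KU cK by blast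
qed

end

text \<open>Vertices of deficit above \<open>L_bd r\<close> number at most \<open>2 * r * n\<close>
  divided by \<open>64 * r * r\<close>, that is \<open>n / (32 * r)\<close>. \<open>K_bd\<close> is
  the size of the seed (two parts of at most \<open>8 * r\<close>, two of \<open>L_bd r + 1\<close>)
  times the factor of \<open>connector\<close> for diameter \<open>16 * r + 5\<close>.
  \<open>c1_bd\<close> bounds the vertices not labelled \<open>V 1\<close> or \<open>W 1\<close>,
  and \<open>c2_bd\<close> the missing arcs that these two labels do not force. Each summand of
  \<open>n_bd\<close> lets \<open>n\<close> dominate one of these.\<close>

definition L_bd :: "nat \<Rightarrow> nat" where "L_bd r = 64 * r\<^sup>2"
definition K_bd :: "nat \<Rightarrow> nat" where
  "K_bd r = (16 * r + 2 * (L_bd r + 1)) * (2 * (16 * r + 5) + 2)"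
definition c1_bd :: "nat \<Rightarrow> nat" where "c1_bd r = 2 * L_bd r * (r + 1) + 2 * r + 2"
definition c2_bd :: "nat \<Rightarrow> nat" where "c2_bd r = 4 * r\<^sup>2 + r * c1_bd r"
definition n_bd :: "nat \<Rightarrow> nat" where
  "n_bd r = 256 * r\<^sup>2 * (2 * r + 1) + 32 * r * K_bd r + 8 * (L_bd r + c1_bd r + 2 * c2_bd r + 1)"

text \<open>
  The right-hand side of \<open>few_missing\<close> is the number of missing arcs of $B_{n,r}$, and \<open>balanced\<close> is
  what remains of $2|X||Y| \ge |A(B_{n,r})|$.
\<close>
locale dense_bip = bip_rel +
  assumes few_missing: "card ms \<le> card (nonarcs r) + (r - 2) * (card U - 2 * r)"
    and balanced: "card U * card U \<le> 4 * (card X * card (U - X)) + 2 * (card (nonarcs r) + (r - 2) * (card U - 2 * r)) + 1"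
    and big: "n_bd r \<le> card U"
begin

abbreviation n :: nat where "n \<equiv> card U"

lemma card_nonarcs_le: "card (nonarcs r) \<le> 4 * r\<^sup>2"
proof -
  have "card (nonarcs r) \<le> card (bverts r \<times> bverts r)"
    by (rule card_mono) (auto simp: finite_bverts nonarcs_def nonout_def)
  also have "\<dots> = (2 * r) * (2 * r)" unfolding card_cartesian_product card_bverts ..
  finally show ?thesis by (simp add: power2_eq_square)
qed

lemma n_ge: "256 * r\<^sup>2 * (2 * r + 1) \<le> n" "32 * r * K_bd r \<le> n" "8 * (L_bd r + c1_bd r + 2 * c2_bd r + 1) \<le> n"
  using big unfolding n_bd_def by linarith+

lemma n_ge': "4 * r\<^sup>2 \<le> n" "16 * r < n" "2 * r \<le> n" "0 < n"
proof -
  have "4 * r\<^sup>2 * 1 \<le> 256 * r\<^sup>2 * (2 * r + 1)" by (rule mult_mono) auto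
  then show "4 * r\<^sup>2 \<le> n" using n_ge(1) by linarith
  have "r * 1 \<le> r * r" using r4 by (intro mult_le_mono2) simp
  then have "r \<le> r\<^sup>2" by (simp add: power2_eq_square)
  moreover have "256 * r\<^sup>2 * 1 \<le> 256 * r\<^sup>2 * (2 * r + 1)" by (rule mult_le_mono2) simp
  ultimately have "256 * r \<le> n" using n_ge(1) by linarith
  then show "16 * r < n" "2 * r \<le> n" "0 < n" using r4 by linarith+
qed

lemma mB_le: "card (nonarcs r) + (r - 2) * (n - 2 * r) \<le> 4 * r\<^sup>2 + (r - 2) * n"
  using card_nonarcs_le by (intro add_mono mult_le_mono2) auto

lemma ms_le: "card ms \<le> 4 * r\<^sup>2 + (r - 2) * n" 
  using few_missing mB_le by linarith

lemma mB_le': "4 * r\<^sup>2 + (r - 2) * n \<le> r * n"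
proof -
  have "r = (r - 2) + 2" using r4 by simp
  then have "r * n = (r - 2) * n + 2 * n" by (metis add_mult_distrib)
  moreover have "4 * r\<^sup>2 \<le> 2 * n" using n_ge'(1) by linarith
  ultimately show ?thesis by (metis add.commute add_le_mono order_refl)
qed

lemma ms_le': "card ms \<le> r * n" using ms_le mB_le' by linarith

text \<open>A common error allowance: it bounds the deviation of a class size from
  \<open>n / 2\<close>, the number of vertices of large deficit, and the size of a kernel.\<close>

definition e :: real where "e = real n / (32 * real r)"

lemma card_XY: "card X + card (U - X) = n"
  using X_sub finV by (metis card_Un_disjoint Diff_disjoint Diff_partition finite_Diff finite_subset)

text \<open>The squared difference of the class sizes equals
  \<open>n * n - 4 * (card X * card (U - X))\<close>, at most \<open>2 * r * n + 1\<close> by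
  \<open>balanced\<close>. The difference is thus of the order of the square root of
  \<open>r * n\<close>, below \<open>2 * e\<close> for large \<open>n\<close>.\<close>

lemma class_size:
  "real n / 2 - e \<le> real (card X)" "real n / 2 - e \<le> real (card (U - X))"
  "real (card X) \<le> real n / 2 + e" "real (card (U - X)) \<le> real n / 2 + e"
proof -
  let ?a = "real (card X)" and ?b = "real (card (U - X))"
  have ab: "?a + ?b = real n" using card_XY by (metis of_nat_add)
  have r0: "0 < real r" using r4 by simp
  have "n * n \<le> 4 * (card X * card (U - X)) + 2 * (r * n) + 1"
    by (rule order_trans[OF balanced]) (intro add_mono mult_le_mono2 order_trans[OF mB_le mB_le'] order_refl)
  then have "real (n * n) \<le> real (4 * (card X * card (U - X)) + 2 * (r * n) + 1)" by (rule of_nat_mono)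
  then have "real n * real n \<le> 4 * (?a * ?b) + 2 * (real r * real n) + 1" by simp
  moreover have "(?a - ?b)\<^sup>2 = real n * real n - 4 * (?a * ?b)"
    unfolding ab[symmetric] by (simp add: power2_eq_square algebra_simps)
  ultimately have 1: "(?a - ?b)\<^sup>2 \<le> 2 * (real r * real n) + 1" by linarith
  have "256 * (real r)\<^sup>2 * (2 * real r + 1) \<le> real n"
    using of_nat_mono[OF n_ge(1), where ?'a = real] by (simp add: algebra_simps)
  then have "256 * (real r)\<^sup>2 * (2 * real r + 1) * real n \<le> real n * real n"
    by (rule mult_right_mono) simp
  moreover have "256 * (real r)\<^sup>2 * (2 * real r * real n + 1) \<le> 256 * (real r)\<^sup>2 * (2 * real r + 1) * real n"
  proof -
    have "1 \<le> real n" using n_ge'(4) by linarith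
    then have "2 * real r * real n + 1 \<le> (2 * real r + 1) * real n" by (simp add: algebra_simps)
    then have "256 * (real r)\<^sup>2 * (2 * real r * real n + 1) \<le> 256 * (real r)\<^sup>2 * ((2 * real r + 1) * real n)"
      by (rule mult_left_mono) simp
    then show ?thesis by (simp only: mult.assoc)
  qed
  ultimately have "256 * (real r)\<^sup>2 * (2 * real r * real n + 1) \<le> real n * real n" by linarith
  then have "256 * (real r)\<^sup>2 * (?a - ?b)\<^sup>2 \<le> real n * real n"
    using mult_left_mono[OF 1, of "256 * (real r)\<^sup>2"] by (simp add: mult.assoc)
  moreover have "(16 * real r * t)\<^sup>2 = 256 * (real r)\<^sup>2 * t\<^sup>2" for t by (simp add: power_mult_distrib)
  ultimately have "(16 * real r * (?a - ?b))\<^sup>2 \<le> (real n)\<^sup>2" by (simp only: power2_eq_square[of "real n"])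
  then have "\<bar>16 * real r * (?a - ?b)\<bar> \<le> real n" using abs_le_square_iff[of "16 * real r * (?a - ?b)" "real n"] by simp
  then have "16 * real r * \<bar>?a - ?b\<bar> \<le> real n" using r0 by (simp add: abs_mult)
  then have "\<bar>?a - ?b\<bar> \<le> 2 * e" unfolding e_def using r0 by (simp add: field_simps)
  then show "real n / 2 - e \<le> ?a" "real n / 2 - e \<le> ?b" "?a \<le> real n / 2 + e" "?b \<le> real n / 2 + e"
    using ab by linarith+
qed

lemma e_le: "128 * e \<le> real n" "0 \<le> e"
proof -
  have "real n * 4 \<le> real n * real r" using r4 by (intro mult_left_mono) auto
  then show "128 * e \<le> real n" unfolding e_def using r4 by (simp add: field_simps)
qed (simp add: e_def)

section \<open>Diameter and kernel of a dense digraph\<close>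

definition P :: "'a set" where "P = {u \<in> U. n \<le> 8 * card (in_miss u)}"
definition Q :: "'a set" where "Q = {u \<in> U. n \<le> 8 * card (out_miss u)}"

lemma card_PQ: "card P \<le> 8 * r" "card Q \<le> 8 * r"
proof -
  have "card P * n \<le> 8 * card ms" unfolding P_def sum_mi[symmetric] by (rule card_threshold[OF finV])
  also have "\<dots> \<le> (8 * r) * n" using ms_le' by simp
  finally show "card P \<le> 8 * r" using n_ge'(4) by simp
  have "card Q * n \<le> 8 * card ms" unfolding Q_def sum_mo[symmetric] by (rule card_threshold[OF finV])
  also have "\<dots> \<le> (8 * r) * n" using ms_le' by simp
  finally show "card Q \<le> 8 * r" using n_ge'(4) by simp
qed

text \<open>\<open>u\<close> has at least \<open>n / 4\<close> out-neighbours and \<open>v\<close>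
  at least \<open>n / 4\<close> in-neighbours. Within one class these sets meet. Across the classes
  some arc joins them, since otherwise \<open>n * n / 16\<close> arcs would be missing, more than
  \<open>r * n\<close>. The set \<open>A\<close> is the class of \<open>u\<close>, so both classes
  are treated at once.\<close>

lemma d_le_3_aux:
  assumes uv: "u \<in> U - Q" "v \<in> U - P" and A: "A = X \<or> A = U - X" "u \<in> A"
  shows "d u v \<le> 3"
proof -
  have fA: "finite A" "A \<subseteq> U" using A finV X_sub finite_subset by auto
  have cA: "real n / 2 - e \<le> real (card A)" "real n / 2 - e \<le> real (card (U - A))"
    using class_size A X_sub by (auto simp: double_diff)
  have out_miss: "8 * real (card (out_miss u)) < real n" and in_miss: "8 * real (card (in_miss v)) < real n"
    using uv unfolding P_def Q_def by auto
  have cls: "w \<in> A \<longleftrightarrow> (w \<in> X \<longleftrightarrow> u \<in> X)" if "w \<in> U" for w using A that X_sub by auto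
  have moA: "out_miss u \<subseteq> U - A" using cls by (auto simp: mo_iff)
  have outE: "(u, w) \<in> E" if "w \<in> (U - A) - out_miss u" for w
    using that uv cls by (auto simp: mo_iff)
  have c1: "real n / 4 \<le> real (card ((U - A) - out_miss u))"
  proof -
    have "card ((U - A) - out_miss u) = card (U - A) - card (out_miss u)" by (rule card_Diff_subset[OF fin_mo moA])
    then show ?thesis using cA out_miss e_le by linarith
  qed
  show ?thesis
  proof (cases "v \<in> A")
    case True
    have miA: "in_miss v \<subseteq> U - A" using cls[of v] cls uv True by (auto simp: mi_iff)
    have "\<exists>w. w \<in> ((U - A) - out_miss u) - in_miss v"
    proof (rule ccontr)
      assume "\<not> ?thesis"
      then have "(U - A) - out_miss u \<subseteq> in_miss v" by blast
      then have "card ((U - A) - out_miss u) \<le> card (in_miss v)" by (rule card_mono[OF fin_mi])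
      then show False using c1 in_miss n_ge'(4) by linarith
    qed
    then obtain w where w: "w \<in> (U - A) - out_miss u" "w \<notin> in_miss v" by blast
    have "(w, v) \<in> E" using w True uv cls[of w] cls[of v] by (auto simp: mi_iff)
    then show ?thesis using d_arc_step[of u w v] d_arc_le[OF outE[OF w(1)]] uv by auto
  next
    case False
    have miA: "in_miss v \<subseteq> A" using cls[of v] cls uv False by (auto simp: mi_iff)
    have "card (A - in_miss v) = card A - card (in_miss v)" by (rule card_Diff_subset[OF fin_mi miA])
    then have c2: "real n / 4 \<le> real (card (A - in_miss v))" using cA in_miss e_le by linarith
    have "\<exists>w w'. w \<in> (U - A) - out_miss u \<and> w' \<in> A - in_miss v \<and> (w, w') \<in> E"
    proof (rule ccontr)
      assume no: "\<not> ?thesis"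
      have "((U - A) - out_miss u) \<times> (A - in_miss v) \<subseteq> ms"
        using no cls fA unfolding missing_def by blast
      then have "card ((U - A) - out_miss u) * card (A - in_miss v) \<le> card ms"
        using card_mono[OF fin_ms] card_cartesian_product by metis
      then have "real (card ((U - A) - out_miss u)) * real (card (A - in_miss v)) \<le> real (r * n)"
        using ms_le' by (metis of_nat_mono of_nat_mult order_trans)
      moreover have "real n / 4 * (real n / 4) \<le> real (card ((U - A) - out_miss u)) * real (card (A - in_miss v))"
        by (rule mult_mono[OF c1 c2]) auto
      ultimately have "real n * real n \<le> 16 * real r * real n" by simp
      then have "real n \<le> 16 * real r" using n_ge'(4) by simp
      then show False using n_ge'(2) by linarith
    qed
    then obtain w w' where w: "w \<in> (U - A) - out_miss u" "w' \<in> A - in_miss v" "(w, w') \<in> E" by blast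
    have "(w', v) \<in> E" using w False uv cls[of w'] cls[of v] fA by (auto simp: mi_iff)
    then show ?thesis using d_arc_step[of u w' v] d_arc_step[of u w w'] d_arc_le[OF outE[OF w(1)]] w(3) uv by fastforce
  qed
qed

lemma d_le_3: "u \<in> U - Q \<Longrightarrow> v \<in> U - P \<Longrightarrow> d u v \<le> 3"
  using d_le_3_aux[of u v X] d_le_3_aux[of u v "U - X"] by auto

text \<open>On a shortest path the first \<open>8 * r + 1\<close> vertices cannot all lie in
  \<open>Q\<close>. From one outside \<open>Q\<close>, all vertices at least 4 further along lie in
  \<open>P\<close> by \<open>d_le_3\<close>, and \<open>P\<close> has at most \<open>8 * r\<close>
  elements.\<close>

lemma diameter:
  assumes "u \<in> U" "v \<in> U" shows "d u v \<le> 16 * r + 5"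
proof (rule ccontr)
  assume "\<not> ?thesis"
  then have big: "16 * r + 6 \<le> d u v" by simp
  obtain p where p: "\<forall>i\<le>d u v. p i \<in> U" "\<forall>i j. i \<le> j \<longrightarrow> j \<le> d u v \<longrightarrow> d (p i) (p j) = j - i"
    using d_path[OF assms] by blast
  have inj: "inj_on p {..d u v}"
  proof (rule linorder_inj_onI)
    fix i j assume ij: "i < j" "i \<in> {..d u v}" "j \<in> {..d u v}"
    then have "d (p i) (p j) = j - i" using p(2) by simp
    then show "p i \<noteq> p j" using ij by auto
  qed auto
  have "\<exists>i\<le>8 * r. p i \<notin> Q"
  proof (rule ccontr)
    assume "\<not> ?thesis"
    then have "p ` {..8 * r} \<subseteq> Q" by auto
    then have "card (p ` {..8 * r}) \<le> card Q" by (rule card_mono[rotated]) (simp add: Q_def finV)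
    moreover have "card (p ` {..8 * r}) = 8 * r + 1"
      using inj big by (subst card_image) (auto intro: inj_on_subset)
    ultimately show False using card_PQ by simp
  qed
  then obtain i where i: "i \<le> 8 * r" "p i \<notin> Q" by auto
  have "p ` {i + 4..i + 4 + 8 * r} \<subseteq> P"
  proof clarify
    fix j assume j: "j \<in> {i + 4..i + 4 + 8 * r}"
    then have "j \<le> d u v" "i \<le> j" using i big by auto
    then have "d (p i) (p j) = j - i" "p i \<in> U" "p j \<in> U" using p by auto
    moreover have "\<not> j - i \<le> 3" using j by auto
    ultimately show "p j \<in> P" using d_le_3[of "p i" "p j"] i by auto
  qed
  then have "card (p ` {i + 4..i + 4 + 8 * r}) \<le> card P" by (rule card_mono[rotated]) (simp add: P_def finV)
  moreover have "card (p ` {i + 4..i + 4 + 8 * r}) = 8 * r + 1"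
    using inj big i by (subst card_image) (auto intro: inj_on_subset)
  ultimately show False using card_PQ by simp
qed

lemma kernel:
  obtains K where "K \<subseteq> U" "card K \<le> K_bd r" "\<And>u. u \<in> U \<Longrightarrow> \<exists>v\<in>K. r \<le> d u v"
    "\<And>u v. u \<in> K \<Longrightarrow> v \<in> K \<Longrightarrow> (u, v) \<in> (E \<inter> K \<times> K)\<^sup>*"
    "L_bd r < card (K \<inter> X)" "L_bd r < card (K - X)"
proof -
  obtain far' where far': "\<And>u. u \<in> U \<Longrightarrow> far' u \<in> U \<and> r \<le> d u (far' u)"
    using far_d by metis
  have "real (L_bd r + 1) \<le> real n / 8" using of_nat_mono[OF n_ge(3), where ?'a = real] by simp
  then have "L_bd r + 1 \<le> card X" "L_bd r + 1 \<le> card (U - X)"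
    using class_size(1,2) e_le by linarith+
  then obtain X0 Y0 where X0: "X0 \<subseteq> X" "card X0 = L_bd r + 1" and Y0: "Y0 \<subseteq> U - X" "card Y0 = L_bd r + 1"
    by (metis obtain_subset_with_card_n)
  \<comment> \<open>A vertex outside \<open>Q\<close> is within distance 3 of everything outside
    \<open>P\<close>, so its far vertex is in \<open>P\<close>; each vertex of \<open>Q\<close> gets
    a far vertex of its own. \<open>X0\<close> and \<open>Y0\<close> exceed \<open>L_bd r\<close>,
    so a vertex of deficit at most \<open>L_bd r\<close> cannot miss all of the one in the opposite
    class.\<close>
  define K0 where "K0 = (P \<union> far' ` Q) \<union> (X0 \<union> Y0)"
  have PQ: "P \<subseteq> U" "Q \<subseteq> U" unfolding P_def Q_def by auto
  have finQ: "finite Q" using PQ finV finite_subset by blast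
  have "K0 \<subseteq> U" unfolding K0_def using X0 Y0 X_sub PQ far' by blast
  moreover obtain z where "z \<in> X0" using X0 by fastforce
  then have "z \<in> K0" unfolding K0_def by blast
  ultimately obtain K where K: "K0 \<subseteq> K" "K \<subseteq> U" "card K \<le> card K0 * (2 * (16 * r + 5) + 2)"
    "\<And>u v. u \<in> K \<Longrightarrow> v \<in> K \<Longrightarrow> (u, v) \<in> (E \<inter> K \<times> K)\<^sup>*"
    using connector[of K0 z "16 * r + 5"] diameter by metis
  have "card K0 \<le> card P + card (far' ` Q) + (card X0 + card Y0)"
    unfolding K0_def using card_Un_le[of "P \<union> far' ` Q" "X0 \<union> Y0"] card_Un_le[of P "far' ` Q"] card_Un_le[of X0 Y0] by linarith
  also have "\<dots> \<le> 16 * r + 2 * (L_bd r + 1)"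
    using card_PQ card_image_le[OF finQ, of far'] unfolding X0(2) Y0(2) by simp
  finally have "card K0 * (2 * (16 * r + 5) + 2) \<le> K_bd r" unfolding K_bd_def by (rule mult_le_mono1)
  then have cK: "card K \<le> K_bd r" using K(3) by linarith
  have finK: "finite K" using K finV finite_subset by blast
  have farK: "\<exists>v\<in>K. r \<le> d u v" if u: "u \<in> U" for u
  proof (cases "u \<in> Q")
    case True
    then show ?thesis using far'[OF u] K(1) unfolding K0_def by blast
  next
    case False
    then have "far' u \<in> P" using d_le_3[of u "far' u"] far'[OF u] u r4 by fastforce
    then show ?thesis using far'[OF u] K(1) unfolding K0_def by blast
  qed
  have "X0 \<subseteq> K \<inter> X" "Y0 \<subseteq> K - X" using X0 Y0 K(1) unfolding K0_def by blast+
  then have "card X0 \<le> card (K \<inter> X)" "card Y0 \<le> card (K - X)" using finK by (auto intro: card_mono)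
  then show ?thesis using that[OF K(2) cK farK K(4)] X0 Y0 by simp
qed

end

section \<open>Stability\<close>

text \<open>To leading order the left side of \<open>le\<close> is
  \<open>(2 * \<rho> - 3) * N\<^sup>2 / 4\<close> and the right side at most
  \<open>(2 * \<rho> - 4) * N\<^sup>2 / 4\<close>. Of the gap \<open>N\<^sup>2 / 4\<close> the
  errors in \<open>e\<close> consume less than \<open>7 * \<rho> * e * N\<close>, that is
  \<open>7 * N\<^sup>2 / 32\<close>. The remaining \<open>N\<^sup>2 / 32\<close> absorbs the terms
  linear in \<open>N\<close>; hence the 32 in the choice of \<open>e\<close>.\<close>

lemma averaging_arith:
  fixes \<rho> N e a b m s1 s2 :: real
  assumes \<rho>: "4 \<le> \<rho>" and N: "N = 32 * \<rho> * e" and big: "128 * \<rho>\<^sup>2 \<le> N" and e0: "0 \<le> e"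
    and ab: "N / 2 - 3 * e \<le> a" "N / 2 - 3 * e \<le> b" "a \<le> N / 2 + e" "b \<le> N / 2 + e"
    and m: "m \<le> 4 * \<rho>\<^sup>2 + (\<rho> - 2) * N" "m \<le> \<rho> * N"
    and s: "0 \<le> s1" "0 \<le> s2" "s1 + s2 \<le> m"
    and le: "(2 * \<rho> - 3) * (a * b - m) \<le> b * s1 + a * s2"
  shows False
proof -
  have N0: "0 < N" using big \<rho> by (smt (verit) zero_less_power)
  have "4 * e \<le> \<rho> * e" using \<rho> e0 by (rule mult_right_mono)
  then have e_small: "128 * e \<le> N" using N by linarith
  have "b * s1 \<le> (N / 2 + e) * s1" "a * s2 \<le> (N / 2 + e) * s2" using ab s by (auto intro: mult_right_mono)
  moreover have "(N / 2 + e) * (s1 + s2) \<le> (N / 2 + e) * (4 * \<rho>\<^sup>2 + (\<rho> - 2) * N)"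
    using s m N0 e0 by (intro mult_left_mono) auto
  ultimately have up: "b * s1 + a * s2 \<le> (N / 2 + e) * (4 * \<rho>\<^sup>2 + (\<rho> - 2) * N)"
    by (simp add: distrib_left)
  have "(N / 2 - 3 * e) * (N / 2 - 3 * e) \<le> a * b" using ab e_small e0 N0 by (intro mult_mono) auto
  moreover have "(N / 2 - 3 * e) * (N / 2 - 3 * e) = N\<^sup>2 / 4 - 3 * e * N + 9 * (e * e)"
    by (simp add: power2_eq_square algebra_simps)
  moreover have "0 \<le> e * e" by simp
  ultimately have "N\<^sup>2 / 4 - 3 * e * N - \<rho> * N \<le> a * b - m" using m by linarith
  then have "(2 * \<rho> - 3) * (N\<^sup>2 / 4 - 3 * e * N - \<rho> * N) \<le> (2 * \<rho> - 3) * (a * b - m)"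
    using \<rho> by (intro mult_left_mono) auto
  then have "(2 * \<rho> - 3) * (N\<^sup>2 / 4 - 3 * e * N - \<rho> * N) \<le> (N / 2 + e) * (4 * \<rho>\<^sup>2 + (\<rho> - 2) * N)"
    using le up by linarith
  moreover have "(2 * \<rho> - 3) * (N\<^sup>2 / 4 - 3 * e * N - \<rho> * N) - (N / 2 + e) * (4 * \<rho>\<^sup>2 + (\<rho> - 2) * N)
    = N * (N / 32 - 4 * \<rho>\<^sup>2) + 11 * e * N + 23 / 8 * \<rho> * N"
    unfolding N by (simp add: power2_eq_square algebra_simps)
  moreover have "0 \<le> N * (N / 32 - 4 * \<rho>\<^sup>2)" using big N0 by (intro mult_nonneg_nonneg) auto
  moreover have "0 \<le> 11 * e * N" using e0 N0 by simp
  moreover have "0 < 23 / 8 * \<rho> * N" using \<rho> N0 by simp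
  ultimately show False by linarith
qed

context dense_bip
begin

definition kernel_deficit :: "'a set \<Rightarrow> 'a \<Rightarrow> nat" where
  "kernel_deficit K u = card (out_miss u \<inter> K) + card (in_miss u \<inter> K)"

definition is_kernel :: "'a set \<Rightarrow> bool" where
  "is_kernel K \<longleftrightarrow> K \<subseteq> U \<and> card K \<le> K_bd r \<and> (\<forall>u\<in>U. \<exists>v\<in>K. r \<le> d u v) \<and>
    (\<forall>u\<in>K. \<forall>v\<in>K. (u, v) \<in> (E \<inter> K \<times> K)\<^sup>*) \<and> L_bd r < card (K \<inter> X) \<and> L_bd r < card (K - X)"

lemma kern_exists: "\<exists>K. is_kernel K"
  using kernel unfolding is_kernel_def by metis

definition attached :: "'a set \<Rightarrow> 'a \<Rightarrow> bool" where
  "attached K u \<longleftrightarrow> (\<exists>k\<in>K. (u, k) \<in> E) \<and> (\<exists>k\<in>K. (k, u) \<in> E)"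

lemma att_low:
  assumes K: "is_kernel K" and u: "u \<in> U" "deficit u \<le> L_bd r"
  shows "attached K u"
proof -
  define B where "B = (if u \<in> X then K - X else K \<inter> X)"
  have B: "L_bd r < card B" "B \<subseteq> K" using K unfolding B_def is_kernel_def by auto
  have KU: "K \<subseteq> U" using K unfolding is_kernel_def by auto
  have "\<not> B \<subseteq> out_miss u" "\<not> B \<subseteq> in_miss u"
    using card_mono[OF fin_mo, of B u] card_mono[OF fin_mi, of B u] B u unfolding deficit_def by linarith+
  then obtain k k' where "k \<in> B" "k \<notin> out_miss u" "k' \<in> B" "k' \<notin> in_miss u" by blast
  then have "(u, k) \<in> E" "(k', u) \<in> E" "k \<in> K" "k' \<in> K"
    using u KU B(2) unfolding B_def by (auto simp: mo_iff mi_iff split: if_splits)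
  then show ?thesis unfolding attached_def by blast
qed

text \<open>\<open>K\<close> already supplies a far vertex for everyone, so only strong connectivity
  is at stake, and each vertex of \<open>S\<close> reaches \<open>K\<close> and is reached from it
  directly or through an attached neighbour.\<close>

lemma kern_extend:
  assumes K: "is_kernel K" and S: "K \<subseteq> S" "S \<subseteq> U"
    and s: "\<And>s. s \<in> S \<Longrightarrow> s \<in> K \<or> attached K s \<or> (\<exists>t\<in>S. attached K t \<and> (s, t) \<in> E \<and> (t, s) \<in> E)"
  shows "bip_rel S (E \<inter> S \<times> S) (X \<inter> S) r"
proof (rule restrict[OF S(2)])
  show "\<exists>v\<in>S. r \<le> d u v" if "u \<in> S" for u using K S that unfolding is_kernel_def by blast
  let ?R = "(E \<inter> S \<times> S)\<^sup>*"
  have KK: "(u, v) \<in> ?R" if "u \<in> K" "v \<in> K" for u v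
    using K that rtrancl_Int_mono[OF _ S(1)] unfolding is_kernel_def by blast
  have attached: "\<exists>k\<in>K. \<exists>k'\<in>K. (t, k) \<in> ?R \<and> (k', t) \<in> ?R" if "t \<in> S" "attached K t" for t
    using that S(1) unfolding attached_def by blast
  have all: "\<exists>k\<in>K. \<exists>k'\<in>K. (t, k) \<in> ?R \<and> (k', t) \<in> ?R" if t: "t \<in> S" for t
    using s[OF t]
  proof (elim disjE bexE conjE)
    fix w assume w: "w \<in> S" "attached K w" "(t, w) \<in> E" "(w, t) \<in> E"
    then have "(t, w) \<in> ?R" "(w, t) \<in> ?R" using t by auto
    then show ?thesis using attached[OF w(1,2)] by (meson rtrancl_trans)
  qed (use attached[OF t] in blast)+
  show "(u, v) \<in> ?R" if "u \<in> S" "v \<in> S" for u v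
    using all[OF that(1)] all[OF that(2)] KK by (meson rtrancl_trans)
qed

text \<open>A missing arc with one end in \<open>K\<close> is charged only to its other end, in
  contrast to the factor 2 in \<open>sum_dfc\<close>.\<close>

lemma sum_dK_le: 
  assumes "K \<subseteq> U"
  shows "(\<Sum>u\<in>U - K. kernel_deficit K u) \<le> card ms"
proof -
  let ?A = "Sigma (U - K) (\<lambda>u. out_miss u \<inter> K)" and ?B = "Sigma (U - K) (\<lambda>u. in_miss u \<inter> K)"
  let ?B' = "(\<lambda>(u, v). (v, u)) ` ?B"
  have fin: "finite ?A" "finite ?B" using finV fin_mo fin_mi by auto
  have "(\<Sum>u\<in>U - K. kernel_deficit K u) = card ?A + card ?B"
    unfolding kernel_deficit_def sum.distrib using finV fin_mo fin_mi by simp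
  also have "card ?B = card ?B'" by (rule card_image[symmetric]) (auto simp: inj_on_def)
  also have "card ?A + card ?B' = card (?A \<union> ?B')"
    by (rule card_Un_disjoint[symmetric]) (use fin in auto)
  also have "\<dots> \<le> card ms"
    by (rule card_mono[OF fin_ms]) (auto simp: out_miss_def in_miss_def)
  finally show ?thesis .
qed

lemma L_pos: "0 < r" using r4 by simp

lemma e_eq: "real n = 32 * real r * e" unfolding e_def using L_pos by simp

lemma few_high: "real (card {u \<in> U. L_bd r + 1 \<le> 1 * deficit u}) \<le> e"
proof -
  let ?h = "card {u \<in> U. L_bd r + 1 \<le> 1 * deficit u}"
  have "?h * (L_bd r + 1) \<le> 2 * card ms"
    using card_threshold[OF finV, of "L_bd r + 1" 1 deficit] sum_dfc by simp
  then have "?h * L_bd r \<le> 2 * (r * n)" using ms_le' by simp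
  then have "real (?h * L_bd r) \<le> real (2 * (r * n))" by (rule of_nat_mono)
  then have "real ?h * (64 * (real r)\<^sup>2) \<le> 2 * (real r * real n)" by (simp add: L_bd_def)
  then have "(64 * (real r)\<^sup>2) * real ?h \<le> (64 * (real r)\<^sup>2) * e" 
    unfolding e_eq by (simp add: power2_eq_square mult_ac)
  then show ?thesis using L_pos by simp
qed

lemma K_small: "is_kernel K \<Longrightarrow> real (card K) \<le> e"
proof -
  assume "is_kernel K"
  then have "32 * r * card K \<le> 32 * r * K_bd r" unfolding is_kernel_def by simp
  then have "32 * r * card K \<le> n" using n_ge(2) by linarith
  then have "real (32 * r * card K) \<le> real n" by (rule of_nat_mono)
  then have "32 * real r * real (card K) \<le> 32 * real r * e" unfolding e_eq by simp
  then show ?thesis using L_pos by simp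
qed

text \<open>
  Only arcs to and from the bounded kernel are charged here, so that no missing arc is counted twice.
\<close>
lemma good_pair:
  assumes K: "is_kernel K"
  shows "\<exists>x\<in>X - K. \<exists>y\<in>(U - X) - K. deficit x \<le> L_bd r \<and> deficit y \<le> L_bd r \<and>
    (x, y) \<in> E \<and> (y, x) \<in> E \<and> kernel_deficit K x + kernel_deficit K y \<le> 2 * r - 4"
proof (rule ccontr)
  assume neg: "\<not> ?thesis"
  have no: "2 * r - 3 \<le> kernel_deficit K x + kernel_deficit K y" if "x \<in> X - K" "y \<in> (U - X) - K" "deficit x \<le> L_bd r" "deficit y \<le> L_bd r"
    "(x, y) \<in> E" "(y, x) \<in> E" for x y
  proof -
    have "\<not> kernel_deficit K x + kernel_deficit K y \<le> 2 * r - 4" using neg that by blast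
    then show ?thesis by linarith
  qed
  have KU: "K \<subseteq> U" and finK: "finite K" using K finV finite_subset unfolding is_kernel_def by auto
  let ?H = "{u \<in> U. L_bd r + 1 \<le> 1 * deficit u}"
  define A where "A = {x \<in> X - K. deficit x \<le> L_bd r}"
  define B where "B = {y \<in> (U - X) - K. deficit y \<le> L_bd r}"
  have AB: "A \<subseteq> X" "B \<subseteq> U - X" "A \<subseteq> U - K" "B \<subseteq> U - K" unfolding A_def B_def using X_sub by auto
  have fin: "finite A" "finite B" using AB finV by (auto intro: finite_subset)
  have "card X \<le> card (A \<union> (K \<union> ?H))"
    by (rule card_mono) (use fin finK finV X_sub in \<open>auto simp: A_def\<close>)
  then have cA: "card X \<le> card A + (card K + card ?H)"
    using card_Un_le[of A "K \<union> ?H"] card_Un_le[of K ?H] by linarith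
  have "card (U - X) \<le> card (B \<union> (K \<union> ?H))"
    by (rule card_mono) (use fin finK finV X_sub in \<open>auto simp: B_def\<close>)
  then have cB: "card (U - X) \<le> card B + (card K + card ?H)"
    using card_Un_le[of B "K \<union> ?H"] card_Un_le[of K ?H] by linarith
  have "real (card X) \<le> real (card A) + (real (card K) + real (card ?H))"
    "real (card (U - X)) \<le> real (card B) + (real (card K) + real (card ?H))"
    using cA cB by (metis of_nat_add of_nat_mono)+
  then have lowAB: "real n / 2 - 3 * e \<le> real (card A)" "real n / 2 - 3 * e \<le> real (card B)"
    using class_size(1,2) few_high K_small[OF K] by linarith+
  have "card A \<le> card X" "card B \<le> card (U - X)" using AB finV X_sub by (auto intro!: card_mono intro: finite_subset)
  then have upAB: "real (card A) \<le> real n / 2 + e" "real (card B) \<le> real n / 2 + e"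
    using class_size(3,4) by linarith+
  let ?s1 = "\<Sum>x\<in>A. kernel_deficit K x" and ?s2 = "\<Sum>y\<in>B. kernel_deficit K y"
  have "?s1 + ?s2 = (\<Sum>u\<in>A \<union> B. kernel_deficit K u)"
    by (rule sum.union_disjoint[symmetric]) (use fin AB in auto)
  also have "\<dots> \<le> (\<Sum>u\<in>U - K. kernel_deficit K u)" by (rule sum_mono2) (use AB finV in auto)
  finally have s12: "?s1 + ?s2 \<le> card ms" using sum_dK_le[OF KU] by linarith
  \<comment> \<open>Pairs that lack an arc between them. Picking one absent arc per pair injects
    them into \<open>ms\<close>, so almost all of \<open>A \<times> B\<close> remains.\<close>
  define N where "N = {(x, y) \<in> A \<times> B. (x, y) \<notin> E \<or> (y, x) \<notin> E}"
  have finN: "finite N" unfolding N_def by (rule finite_subset[of _ "A \<times> B"]) (use fin in auto)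
  have "card N \<le> card ms"
  proof (rule card_inj_on_le[OF _ _ fin_ms])
    let ?\<phi> = "\<lambda>(x, y). if (x, y) \<notin> E then (x, y) else (y, x)"
    show "inj_on ?\<phi> N" unfolding N_def inj_on_def using AB by (auto split: if_splits)
    show "?\<phi> ` N \<subseteq> ms" unfolding N_def missing_def using AB X_sub by (auto split: if_splits)
  qed
  \<comment> \<open>Double counting over the remaining pairs: each contributes at least
    \<open>2 * r - 3\<close>, while in the sum over all pairs a vertex of \<open>A\<close> is
    counted \<open>card B\<close> times and vice versa.\<close>
  have "(2 * r - 3) * (card A * card B - card ms) \<le> (2 * r - 3) * card (A \<times> B - N)"
    using \<open>card N \<le> card ms\<close> diff_card_le_card_Diff[OF finN, of "A \<times> B"]
    by (intro mult_le_mono2) (simp add: card_cartesian_product)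
  also have "\<dots> = (\<Sum>(x, y)\<in>A \<times> B - N. 2 * r - 3)" by simp
  also have "\<dots> \<le> (\<Sum>(x, y)\<in>A \<times> B - N. kernel_deficit K x + kernel_deficit K y)"
    by (rule sum_mono) (use no in \<open>auto simp: N_def A_def B_def\<close>)
  also have "\<dots> \<le> (\<Sum>(x, y)\<in>A \<times> B. kernel_deficit K x + kernel_deficit K y)"
    by (rule sum_mono2) (use fin in auto)
  also have "\<dots> = (\<Sum>x\<in>A. \<Sum>y\<in>B. kernel_deficit K x + kernel_deficit K y)" by (rule sum.cartesian_product[symmetric])
  also have "\<dots> = card B * ?s1 + card A * ?s2"
    by (simp add: sum.distrib sum_distrib_left)
  finally have "(2 * r - 3) * (card A * card B - card ms) \<le> card B * ?s1 + card A * ?s2" .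
  then have "real ((2 * r - 3) * (card A * card B - card ms)) \<le> real (card B * ?s1 + card A * ?s2)" by (rule of_nat_mono)
  then have main: "real (2 * r - 3) * real (card A * card B - card ms) \<le> real (card B) * real ?s1 + real (card A) * real ?s2"
    by (simp only: of_nat_mult of_nat_add)
  have r3: "real (2 * r - 3) = 2 * real r - 3" using r4 by (simp add: of_nat_diff)
  have "real (card A) * real (card B) - real (card ms) \<le> real (card A * card B - card ms)"
  proof -
    have "real p - real q \<le> real (p - q)" for p q :: nat by (cases "q \<le> p") (auto simp: of_nat_diff)
    then show ?thesis by (metis of_nat_mult)
  qed
  then have main': "(2 * real r - 3) * (real (card A) * real (card B) - real (card ms)) \<le> real (card B) * real ?s1 + real (card A) * real ?s2"
  proof -
    have "0 \<le> 2 * real r - 3" using r4 by simp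
    then have "(2 * real r - 3) * (real (card A) * real (card B) - real (card ms))
      \<le> (2 * real r - 3) * real (card A * card B - card ms)"
      using \<open>real (card A) * real (card B) - real (card ms) \<le> real (card A * card B - card ms)\<close> by (rule mult_left_mono[rotated])
    then show ?thesis using main unfolding r3 by (rule order_trans)
  qed
  show False
  proof (rule averaging_arith[OF _ e_eq _ _ lowAB upAB _ _ _ _ _ main'])
    show "4 \<le> real r" using r4 by simp
    have "128 * r\<^sup>2 * 1 \<le> 256 * r\<^sup>2 * (2 * r + 1)" by (rule mult_le_mono) auto
    then have "128 * r\<^sup>2 \<le> n" using n_ge(1) by linarith
    then show "128 * (real r)\<^sup>2 \<le> real n" by (metis of_nat_mono of_nat_mult of_nat_numeral of_nat_power)
    show "0 \<le> e" by (rule e_le)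
    have "real (card ms) \<le> real (4 * r\<^sup>2 + (r - 2) * n)" using ms_le by (rule of_nat_mono)
    then show "real (card ms) \<le> 4 * (real r)\<^sup>2 + (real r - 2) * real n" using r4 by (simp add: of_nat_diff)
    show "real (card ms) \<le> real r * real n" using ms_le' by (metis of_nat_mono of_nat_mult)
    show "real ?s1 + real ?s2 \<le> real (card ms)" using s12 by (metis of_nat_add of_nat_mono)
  qed (rule of_nat_0_le_iff)+
qed

lemma nearly_template:
  obtains S l where "S \<subseteq> U" "n \<le> card S + 2 * L_bd r" "tmpl_lab r S (E \<inter> S \<times> S) (X \<inter> S) l"
proof -
  obtain K where K: "is_kernel K" using kern_exists by blast
  obtain x y where xy: "x \<in> X - K" "y \<in> (U - X) - K" "deficit x \<le> L_bd r" "deficit y \<le> L_bd r"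
    "(x, y) \<in> E" "(y, x) \<in> E" "kernel_deficit K x + kernel_deficit K y \<le> 2 * r - 4" using good_pair[OF K] by blast
  have KU: "K \<subseteq> U" using K unfolding is_kernel_def by blast
  have xyU: "x \<in> U" "y \<in> U" using xy X_sub by auto
  \<comment> \<open>Every member of \<open>S\<close> outside \<open>K\<close> is joined both ways to
    the end in the opposite class, so within \<open>S\<close> the ends miss arcs only to and from
    \<open>K\<close>. The deficits of \<open>x\<close> and \<open>y\<close> bound the number of
    vertices outside \<open>S\<close>.\<close>
  define S where "S = K \<union> {z \<in> X. (z, y) \<in> E \<and> (y, z) \<in> E} \<union> {z \<in> U - X. (z, x) \<in> E \<and> (x, z) \<in> E}"
  have S: "K \<subseteq> S" "S \<subseteq> U" unfolding S_def using KU X_sub by auto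
  have xyS: "x \<in> X \<inter> S" "y \<in> S - X" unfolding S_def using xy by auto
  have "U - S \<subseteq> (out_miss x \<union> in_miss x) \<union> (out_miss y \<union> in_miss y)"
    unfolding S_def using xy xyU by (auto simp: mo_iff mi_iff)
  then have "card (U - S) \<le> card ((out_miss x \<union> in_miss x) \<union> (out_miss y \<union> in_miss y))"
    by (rule card_mono[rotated]) (simp add: fin_mo fin_mi)
  also have "\<dots> \<le> deficit x + deficit y" unfolding deficit_def
    using card_Un_le[of "out_miss x \<union> in_miss x" "out_miss y \<union> in_miss y"] card_Un_le[of "out_miss x" "in_miss x"] card_Un_le[of "out_miss y" "in_miss y"] by linarith
  finally have "card (U - S) \<le> 2 * L_bd r" using xy by linarith
  moreover have "card (U - S) = n - card S" using S(2) finV by (meson card_Diff_subset finite_subset)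
  ultimately have cS: "n \<le> card S + 2 * L_bd r" by linarith
  have attxy: "attached K x" "attached K y" using att_low[OF K] xyU xy by blast+
  have R: "bip_rel S (E \<inter> S \<times> S) (X \<inter> S) r"
  proof (rule kern_extend[OF K S])
    fix z assume "z \<in> S"
    then show "z \<in> K \<or> attached K z \<or> (\<exists>t\<in>S. attached K t \<and> (z, t) \<in> E \<and> (t, z) \<in> E)"
      unfolding S_def using attxy xyS unfolding S_def by blast
  qed
  note pair = restrict_pair[OF R S(2) xyS xy(5,6)]
  have sub: "out_miss x \<inter> S \<subseteq> out_miss x \<inter> K" "out_miss y \<inter> S \<subseteq> out_miss y \<inter> K" "in_miss x \<inter> S \<subseteq> in_miss x \<inter> K" "in_miss y \<inter> S \<subseteq> in_miss y \<inter> K"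
    unfolding S_def using xy by (auto simp: mo_iff mi_iff)
  have "card (out_miss x \<inter> S) \<le> card (out_miss x \<inter> K)" "card (out_miss y \<inter> S) \<le> card (out_miss y \<inter> K)"
    "card (in_miss x \<inter> S) \<le> card (in_miss x \<inter> K)" "card (in_miss y \<inter> S) \<le> card (in_miss y \<inter> K)"
    using sub by (auto intro!: card_mono simp: fin_mo fin_mi)
  then have "card (out_miss x \<inter> S \<union> out_miss y \<inter> S) + card (in_miss x \<inter> S \<union> in_miss y \<inter> S) \<le> 2 * r - 4"
    using xy(7) card_Un_le[of "out_miss x \<inter> S" "out_miss y \<inter> S"] card_Un_le[of "in_miss x \<inter> S" "in_miss y \<inter> S"]
    unfolding kernel_deficit_def by linarith
  then obtain l where "tmpl_lab r S (E \<inter> S \<times> S) (X \<inter> S) l"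
    using bip_pair.labelling[OF pair(1)] unfolding pair(2,3) by blast
  then show ?thesis using that[OF S(2) cS] by blast
qed

theorem stable_pair:
  "\<exists>x y. bip_pair U E X r x y \<and>
    card (bip_pair.unseen U E X x y) + card (bip_pair.unseeing U E X x y) \<le> 2 * r - 4"
proof -
  obtain S l where S: "S \<subseteq> U" and cS: "n \<le> card S + 2 * L_bd r"
    and l: "tmpl_lab r S (E \<inter> S \<times> S) (X \<inter> S) l" using nearly_template by blast
  let ?L = "L_bd r" and ?c1 = "c1_bd r" and ?c2 = "c2_bd r"
  have finS: "finite S" using S finV finite_subset by blast
  have cSn: "card S \<le> n" by (rule card_mono[OF finV S])
  define a1 b1 a2 b2 where "a1 = card (fibre S l (V 1))" and "b1 = card (fibre S l (W 1))"
    and "a2 = card (fibre S l (V 2))" and "b2 = card (fibre S l (W 2))"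
  have msS: "missing S (E \<inter> S \<times> S) (X \<inter> S) \<subseteq> ms" unfolding missing_def using S by auto
  have "card (nonarcs r) + (r - 2) * (card S - 2 * r) + (a2 - 1) + (b2 - 1) \<le> card ms"
    using order_trans[OF tmpl_lab_missing_ge[OF l finS evr r4] card_mono[OF fin_ms msS]]
    unfolding a2_def b2_def .
  moreover have "(r - 2) * (n - 2 * r) \<le> (r - 2) * (card S - 2 * r) + r * (2 * ?L)"
  proof -
    have "(r - 2) * (n - 2 * r) \<le> (r - 2) * ((card S - 2 * r) + 2 * ?L)"
      using cS by (intro mult_le_mono2) linarith
    also have "\<dots> = (r - 2) * (card S - 2 * r) + (r - 2) * (2 * ?L)" by (rule distrib_left)
    also have "(r - 2) * (2 * ?L) \<le> r * (2 * ?L)" by (rule mult_le_mono1) simp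
    finally show ?thesis by simp
  qed
  \<comment> \<open>Further copies of \<open>V 2\<close> and \<open>W 2\<close> cost missing arcs
    beyond those of \<open>B_graph\<close>, and the only slack comes from the at most
    \<open>2 * L_bd r\<close> vertices outside \<open>S\<close>.\<close>
  ultimately have "(a2 - 1) + (b2 - 1) \<le> r * (2 * ?L)" using few_missing by linarith
  then have a2b2: "a2 + b2 \<le> r * (2 * ?L) + 2" by linarith
  have sum: "a1 + b1 + (a2 + b2) + (2 * r - 4) = card S"
  proof -
    let ?F = "{V 1, W 1, V 2, W 2}"
    have F: "?F \<subseteq> bverts r" using r4 by auto
    have "card S = (\<Sum>s\<in>bverts r - ?F. card (fibre S l s)) + (\<Sum>s\<in>?F. card (fibre S l s))"
      unfolding tmpl_lab_fib(3)[OF l finS, symmetric] by (rule sum.subset_diff[OF F finite_bverts])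
    also have "(\<Sum>s\<in>bverts r - ?F. card (fibre S l s)) = card (bverts r - ?F)"
      using tmpl_lab_fib(2)[OF l finS] by simp
    also have "card (bverts r - ?F) = 2 * r - 4"
      by (subst card_Diff_subset) (use F in \<open>simp_all add: card_bverts\<close>)
    finally show ?thesis unfolding a1_def b1_def a2_def b2_def by simp
  qed
  have c1: "?c1 = r * (2 * ?L) + 2 * ?L + 2 * r + 2" unfolding c1_bd_def by (simp add: algebra_simps)
  have ab: "n \<le> a1 + b1 + ?c1" using sum a2b2 cS c1 by linarith
  \<comment> \<open>The missing arcs that the labelling forces at \<open>V 1\<close> and
    \<open>W 1\<close>. They amount to nearly \<open>(r - 2) * n\<close> and leave at most
    \<open>c2_bd r\<close> others, whose ends form \<open>B\<close> below.\<close>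
  define N where "N = {(a, b). a \<in> S \<and> b \<in> S \<and> l a \<in> {V 1, W 1} \<and> (l a, l b) \<in> nonarcs r}"
  have cN: "card N = (r - 2) * (a1 + b1)" unfolding N_def a1_def b1_def
    by (rule tmpl_lab_missing_1[OF l finS evr r4])
  have Nms: "N \<subseteq> ms" using tmpl_lab_pull[OF l] msS unfolding N_def by blast
  have "card (ms - N) = card ms - card N"
    using card_Diff_subset[OF finite_subset[OF Nms fin_ms] Nms] .
  moreover have "(r - 2) * n \<le> card N + r * ?c1"
  proof -
    have "(r - 2) * n \<le> (r - 2) * ((a1 + b1) + ?c1)" using ab by (rule mult_le_mono2)
    also have "\<dots> = card N + (r - 2) * ?c1" unfolding cN by (rule distrib_left)
    also have "(r - 2) * ?c1 \<le> r * ?c1" by (rule mult_le_mono1) simp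
    finally show ?thesis by simp
  qed
  ultimately have cM: "card (ms - N) \<le> ?c2" using ms_le unfolding c2_bd_def by linarith
  define B where "B = fst ` (ms - N) \<union> snd ` (ms - N)"
  have finM: "finite (ms - N)" using fin_ms by simp
  then have finB: "finite B" unfolding B_def by simp
  have cB: "card B \<le> 2 * ?c2"
    using card_Un_le[of "fst ` (ms - N)" "snd ` (ms - N)"] card_image_le[OF finM, of fst] card_image_le[OF finM, of snd] cM
    unfolding B_def by linarith
  have lcls: "l u \<in> B_class1 \<longleftrightarrow> u \<in> X" if "u \<in> S" for u using l that unfolding tmpl_lab_def by auto
  have lne: "u \<in> X \<Longrightarrow> l u \<noteq> W 1" "u \<notin> X \<Longrightarrow> l u \<noteq> V 1" if "u \<in> S" for u
    using lcls[OF that] by (metis class_iff(1,3) odd_one)+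
  have fibfin: "finite (fibre S l s)" for s unfolding fibre_def using finS by simp
  have disj: "fibre S l (V 1) \<inter> fibre S l (W 1) = {}" unfolding fibre_def by auto
  have rest: "card (S - (fibre S l (V 1) \<union> fibre S l (W 1))) \<le> ?c1"
  proof -
    have "card (S - (fibre S l (V 1) \<union> fibre S l (W 1))) = card S - (a1 + b1)"
      unfolding a1_def b1_def card_Un_disjoint[OF fibfin fibfin disj, symmetric]
      by (rule card_Diff_subset) (use fibfin in \<open>auto simp: fibre_def\<close>)
    then show ?thesis using ab cSn by linarith
  qed
  \<comment> \<open>\<open>A\<close> will be a whole class. It contains at most one of the labels
    \<open>V 1\<close> and \<open>W 1\<close>, and all but a bounded number of vertices carry one of
    these two.\<close>
  have large: "2 * ?c2 < card (fibre S l s)"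
    if s: "s \<in> {V 1, W 1}" and A: "A \<subseteq> U" "n \<le> 4 * card A" "\<And>u. u \<in> A \<Longrightarrow> u \<in> S \<Longrightarrow> l u \<in> {V 1, W 1} \<Longrightarrow> l u = s" for s A
  proof -
    have "A \<subseteq> (U - S) \<union> (fibre S l s \<union> (S - (fibre S l (V 1) \<union> fibre S l (W 1))))"
      using A unfolding fibre_def by blast
    then have "card A \<le> card ((U - S) \<union> (fibre S l s \<union> (S - (fibre S l (V 1) \<union> fibre S l (W 1)))))"
      by (rule card_mono[rotated]) (simp add: finV finS fibfin)
    also have "\<dots> \<le> card (U - S) + (card (fibre S l s) + card (S - (fibre S l (V 1) \<union> fibre S l (W 1))))"
      by (meson add_left_mono card_Un_le order_trans)
    finally have "card A \<le> card (U - S) + (card (fibre S l s) + ?c1)" using rest by linarith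
    moreover have "card (U - S) \<le> 2 * ?L" using card_Diff_subset[OF finS S] cS by linarith
    moreover have "2 * w < f"
      if "a \<le> u + (f + v)" "u \<le> 2 * t" "8 * (t + v + 2 * w + 1) \<le> m" "m \<le> 4 * a" for a f m t u v w :: nat
    proof -
      have "4 * (2 * (t + v + 2 * w + 1)) \<le> 4 * a" using that(3,4) by simp
      then have "2 * (t + v + 2 * w + 1) \<le> a" by simp
      then show ?thesis using that(1,2) by simp
    qed
    ultimately show ?thesis using n_ge(3) A(2) by blast
  qed
  have cX: "n \<le> 4 * card X" "n \<le> 4 * card (U - X)"
    using class_size(1,2) e_le by linarith+
  have "2 * ?c2 < card (fibre S l (V 1))"
    by (rule large[of _ X]) (use X_sub cX lne in auto)
  then have "\<not> fibre S l (V 1) \<subseteq> B" using card_mono[OF finB, of "fibre S l (V 1)"] cB by linarith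
  then obtain x where x: "x \<in> S" "l x = V 1" "x \<notin> B" unfolding fibre_def by blast
  have "2 * ?c2 < card (fibre S l (W 1))"
    by (rule large[of _ "U - X"]) (use cX lne in auto)
  then have "\<not> fibre S l (W 1) \<subseteq> B" using card_mono[OF finB, of "fibre S l (W 1)"] cB by linarith
  then obtain y where y: "y \<in> S" "l y = W 1" "y \<notin> B" unfolding fibre_def by blast
  have inN: "(a, b) \<in> N" if "(a, b) \<in> ms" "a \<in> {x, y} \<or> b \<in> {x, y}" for a b
  proof (rule ccontr)
    assume "(a, b) \<notin> N"
    then have "(a, b) \<in> ms - N" using that by blast
    then have "a \<in> B" "b \<in> B" unfolding B_def by force+
    then show False using that x y by auto
  qed
  \<comment> \<open>All missing arcs at \<open>x\<close> and \<open>y\<close> lie in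
    \<open>N\<close>, and arcs of \<open>N\<close> never end at a vertex labelled \<open>V 1\<close>
    or \<open>W 1\<close>.\<close>
  have no_in: "in_miss u = {}" if "u \<in> {x, y}" for u
  proof -
    have "(v, u) \<notin> ms" for v
    proof
      assume "(v, u) \<in> ms"
      then have "(v, u) \<in> N" using inN that by blast
      then have "(l v, l u) \<in> nonarcs r" unfolding N_def by blast
      then show False using nonarcsD(3) x y that by fastforce
    qed
    then show ?thesis unfolding in_miss_def by blast
  qed
  \<comment> \<open>The missing out-arcs lead to unrepeated labels, so \<open>l\<close> maps their
    heads injectively into \<open>nonout r (l u)\<close>.\<close>
  have out: "card (out_miss u) \<le> r - 2" if u: "u \<in> {x, y}" for u
  proof -
    have lu: "l u \<in> {V 1, W 1}" using u x y by auto
    have sub: "v \<in> S \<and> l v \<in> nonout r (l u)" if "v \<in> out_miss u" for v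
      using inN[of u v] that u unfolding out_miss_def N_def nonarcs_def by auto
    have "l v \<in> bverts r - {V 1, W 1, V 2, W 2}" if "v \<in> out_miss u" for v
    proof -
      have "l v \<in> nonout r (l u)" "l u \<in> bverts r" using sub[OF that] lu r4 by auto
      then show ?thesis using nonout_not_1[of "l u" r "l v"] nonout_1_not_2[OF lu, of r] unfolding nonout_def by auto
    qed
    then have inj: "inj_on l (out_miss u)"
      using l sub unfolding inj_on_def tmpl_lab_def by metis
    have "card (out_miss u) \<le> card (nonout r (l u))"
      by (rule card_inj_on_le[OF inj _ finite_nonout]) (use sub in blast)
    also have "\<dots> = r - 2" by (rule card_nonout_1_2[OF evr r4]) (use lu in auto)
    finally show ?thesis .
  qed
  have xX: "x \<in> X" and yX: "y \<in> U - X" using lcls[OF x(1)] lcls[OF y(1)] x y S by auto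
  have xyE: "(x, y) \<in> E" "(y, x) \<in> E"
    using no_in[of x] no_in[of y] xX yX X_sub mi_iff[of x y] mi_iff[of y x] by auto
  have P: "bip_pair U E X r x y"
    by (intro bip_pair.intro bip_pair_axioms.intro bip_rel_axioms) (use xX yX xyE in auto)
  have "bip_pair.unseen U E X x y = out_miss x \<union> out_miss y"
    unfolding bip_pair.unseen_def[OF P] using xX yX X_sub by (auto simp: mo_iff)
  moreover have "bip_pair.unseeing U E X x y = in_miss x \<union> in_miss y"
    unfolding bip_pair.unseeing_def[OF P] using xX yX X_sub by (auto simp: mi_iff)
  moreover have "card (out_miss x \<union> out_miss y) \<le> 2 * r - 4"
    using card_Un_le[of "out_miss x" "out_miss y"] out[of x] out[of y] r4 by simp
  ultimately show ?thesis using P no_in by (intro exI[of _ x] exI[of _ y]) simp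
qed

end

section \<open>The extremal digraph\<close>

lemma tmpl_bverts: "(s, t) \<in> tmpl r \<Longrightarrow> s \<in> bverts r \<and> t \<in> bverts r"
  by (cases s; cases t) (auto simp: tmpl_iff)

definition B_V :: "nat \<Rightarrow> nat \<Rightarrow> (base_vert \<times> nat) set" where "B_V n r = pverts (B_graph n r)"
definition B_E :: "nat \<Rightarrow> nat \<Rightarrow> (base_vert \<times> nat) rel" where "B_E n r = parcs (B_graph n r)"
definition B_X :: "nat \<Rightarrow> nat \<Rightarrow> (base_vert \<times> nat) set" where "B_X n r = {p \<in> B_V n r. fst p \<in> B_class1}"

abbreviation cop :: "nat \<Rightarrow> nat \<Rightarrow> base_vert \<Rightarrow> nat" where
  "cop n r \<equiv> copies n r (n div 2 - (r - 1))"

lemma B_V: "B_V n r = (SIGMA s : bverts r. {..<cop n r s})"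
  unfolding B_V_def B_graph_def D_graph_def D_verts_def D_base_def bverts_def by (simp add: Let_def)

text \<open>Clique arcs among copies of \<open>V 1\<close>, or among copies of \<open>W 1\<close>,
  stay inside a class and disappear; those between the two groups are already arcs of the template.
  So the labels alone decide.\<close>

lemma B_E:
  assumes "1 \<le> r" shows "B_E n r = {(p, q). p \<in> B_V n r \<and> q \<in> B_V n r \<and> (fst p, fst q) \<in> tmpl r}"
proof -
  have "(V 1, W 1) \<in> parcs (D_base r)" "(W 1, V 1) \<in> parcs (D_base r)" using assms unfolding D_base_def by auto
  then have base: "((s, t) \<in> parcs (D_base r) \<or> c \<and> s \<in> {V 1, W 1} \<and> t \<in> {V 1, W 1}) \<and>
      (s \<in> B_class1 \<and> t \<in> B_class2 \<or> s \<in> B_class2 \<and> t \<in> B_class1) \<longleftrightarrow> (s, t) \<in> tmpl r" for s t c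
    unfolding tmpl_def by auto
  have "(p, q) \<in> B_E n r \<longleftrightarrow> p \<in> B_V n r \<and> q \<in> B_V n r \<and>
      ((fst p, fst q) \<in> parcs (D_base r) \<or> p \<noteq> q \<and> fst p \<in> {V 1, W 1} \<and> fst q \<in> {V 1, W 1}) \<and>
      (fst p \<in> B_class1 \<and> fst q \<in> B_class2 \<or> fst p \<in> B_class2 \<and> fst q \<in> B_class1)" for p q
    unfolding B_E_def B_V_def B_graph_def D_graph_def Let_def
    by (simp only: pair_pre_digraph.simps mem_Collect_eq case_prod_conv conj_assoc)
  then have "(p, q) \<in> B_E n r \<longleftrightarrow> p \<in> B_V n r \<and> q \<in> B_V n r \<and> (fst p, fst q) \<in> tmpl r" for p q
    unfolding base .
  then show ?thesis by blast
qed

context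
  fixes n r :: nat assumes nr: "2 * r \<le> n" and r4: "4 \<le> r" and evr: "even r"
begin

lemma cop_pos: "1 \<le> cop n r s"
proof -
  have "r \<le> n div 2" using nr by simp
  moreover have "n div 2 \<le> n" by simp
  ultimately show ?thesis using nr r4 by (cases s) auto
qed

lemma cop_one: "s \<in> bverts r - {V 1, W 1} \<Longrightarrow> cop n r s = 1"
  by (cases s) auto

lemma finite_B_V: "finite (B_V n r)" unfolding B_V using finite_bverts by simp

lemma fib_B: "s \<in> bverts r \<Longrightarrow> card (fibre (B_V n r) fst s) = cop n r s"
proof -
  assume "s \<in> bverts r"
  then have "fibre (B_V n r) fst s = {s} \<times> {..<cop n r s}" unfolding fibre_def B_V by auto
  then show ?thesis by simp
qed

lemma cop_V1_W1: "cop n r (V 1) = n div 2 - (r - 1)" "cop n r (V 1) + cop n r (W 1) = n - 2 * r + 2"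
proof -
  have "n div 2 - (r - 1) \<le> n - 2 * r + 2" using nr r4 by linarith
  then show "cop n r (V 1) = n div 2 - (r - 1)" "cop n r (V 1) + cop n r (W 1) = n - 2 * r + 2" by auto
qed

lemma card_B_V: "card (B_V n r) = n"
proof -
  have F: "{V 1, W 1} \<subseteq> bverts r" using r4 by auto
  have "card (B_V n r) = (\<Sum>s\<in>bverts r. cop n r s)"
    unfolding B_V using finite_bverts by (simp add: card_SigmaI)
  also have "\<dots> = (\<Sum>s\<in>bverts r - {V 1, W 1}. cop n r s) + (\<Sum>s\<in>{V 1, W 1}. cop n r s)"
    by (rule sum.subset_diff[OF F finite_bverts])
  also have "(\<Sum>s\<in>bverts r - {V 1, W 1}. cop n r s) = card (bverts r - {V 1, W 1})"
    using cop_one by (simp del: copies.simps)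
  also have "card (bverts r - {V 1, W 1}) = 2 * r - 2"
    by (subst card_Diff_subset) (use F in \<open>simp_all add: card_bverts\<close>)
  also have "(\<Sum>s\<in>{V 1, W 1}. cop n r s) = n - 2 * r + 2" using cop_V1_W1(2) by (simp del: copies.simps)
  finally show ?thesis using nr r4 by simp
qed

lemma B_lab: "tmpl_lab r (B_V n r) (B_E n r) (B_X n r) fst"
proof -
  have "\<exists>u\<in>B_V n r. fst u = s" if "s \<in> bverts r" for s
    using that cop_pos[of s] unfolding B_V by (intro bexI[of _ "(s, 0)"]) auto
  moreover have "u = v" if "s \<in> bverts r - {V 1, W 1, V 2, W 2}" "u \<in> B_V n r" "v \<in> B_V n r" "fst u = s" "fst v = s" for s u v
    using that cop_one[of s] unfolding B_V by (auto simp del: copies.simps simp: prod_eq_iff)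
  ultimately show ?thesis
    unfolding tmpl_lab_def B_X_def using r4 by (auto simp: B_E B_V)
qed

lemma card_class1: "card (bverts r \<inter> B_class1) = r"
proof -
  have "flip ` (bverts r \<inter> B_class1) = bverts r - B_class1"
  proof (intro equalityI subsetI)
    fix t assume "t \<in> bverts r - B_class1"
    then have "flip t \<in> bverts r \<inter> B_class1" by (cases t) auto
    then show "t \<in> flip ` (bverts r \<inter> B_class1)" by (rule rev_image_eqI) simp
  next
    fix t assume "t \<in> flip ` (bverts r \<inter> B_class1)"
    then obtain s where "t = flip s" "s \<in> bverts r" "s \<in> B_class1" by auto
    then show "t \<in> bverts r - B_class1" by (cases s) auto
  qed
  moreover have "inj_on flip (bverts r \<inter> B_class1)" by (metis flip_flip inj_on_inverseI)
  ultimately have "card (bverts r \<inter> B_class1) = card (bverts r - B_class1)" by (metis card_image)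
  moreover have "card (bverts r) = card (bverts r \<inter> B_class1) + card (bverts r - B_class1)"
    using card_Un_disjoint[of "bverts r \<inter> B_class1" "bverts r - B_class1"] finite_bverts
    by (simp add: Int_Diff_Un Int_Diff_disjoint)
  ultimately show ?thesis unfolding card_bverts by simp
qed

text \<open>Among the \<open>r\<close> labels of the first class only \<open>V 1\<close> and
  \<open>W 2\<close> can be repeated, and \<open>W2\<close> settles the latter.\<close>

lemma card_class_fib:
  assumes l: "tmpl_lab r U E X l" and U: "finite U" "X \<subseteq> U" and W2: "card (fibre U l (W 2)) = 1"
  shows "card X = card (fibre U l (V 1)) + (r - 1)"
proof -
  have V1: "{V 1} \<subseteq> bverts r \<inter> B_class1" using r4 by auto
  have f: "fibre X l s = fibre U l s" if "s \<in> bverts r \<inter> B_class1" for s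
    using l that U unfolding fibre_def tmpl_lab_def by auto
  have "card X = (\<Sum>s\<in>bverts r \<inter> B_class1. card (fibre X l s))"
    by (rule sum_fib[symmetric]) (use l U finite_bverts in \<open>auto simp: tmpl_lab_def intro: finite_subset\<close>)
  also have "\<dots> = (\<Sum>s\<in>bverts r \<inter> B_class1. card (fibre U l s))" by (simp add: f)
  also have "\<dots> = (\<Sum>s\<in>bverts r \<inter> B_class1 - {V 1}. card (fibre U l s)) + (\<Sum>s\<in>{V 1}. card (fibre U l s))"
    by (rule sum.subset_diff[OF V1]) (simp add: finite_bverts)
  also have "(\<Sum>s\<in>bverts r \<inter> B_class1 - {V 1}. card (fibre U l s)) = (\<Sum>s\<in>bverts r \<inter> B_class1 - {V 1}. 1)"
  proof (rule sum.cong[OF refl])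
    fix s assume s: "s \<in> bverts r \<inter> B_class1 - {V 1}"
    then have "s \<noteq> W 1" "s \<noteq> V 2" by auto
    then show "card (fibre U l s) = 1" using s tmpl_lab_fib(2)[OF l U(1), of s] W2 by (cases "s = W 2") auto
  qed
  also have "\<dots> = r - 1" using card_class1 V1 finite_bverts by (simp add: card_Diff_singleton_if)
  finally show ?thesis by simp
qed

lemma card_B_X: "card (B_X n r) = n div 2"
proof -
  have "card (B_X n r) = card (fibre (B_V n r) fst (V 1)) + (r - 1)"
    by (rule card_class_fib[OF B_lab finite_B_V])
      (use fib_B[of "W 2"] cop_one[of "W 2"] r4 in \<open>auto simp: B_X_def\<close>)
  also have "card (fibre (B_V n r) fst (V 1)) = n div 2 - (r - 1)" using fib_B[of "V 1"] cop_V1_W1 r4 by simp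
  finally show ?thesis using nr r4 by simp
qed

lemma card_B_E: "card (B_E n r) + (card (nonarcs r) + (r - 2) * (n - 2 * r)) = 2 * ((n div 2) * (n - n div 2))"
proof -
  have E: "B_E n r = {(p, q). p \<in> B_V n r \<and> q \<in> B_V n r \<and> (fst p, fst q) \<in> tmpl r}" using B_E r4 by simp
  have bv: "fst p \<in> bverts r" if "p \<in> B_V n r" for p using that unfolding B_V by auto
  have "missing (B_V n r) (B_E n r) (B_X n r) = {(p, q). p \<in> B_V n r \<and> q \<in> B_V n r \<and> (fst p, fst q) \<in> nonarcs r}"
    unfolding missing_def E nonarcs_def nonout_def B_X_def using bv by auto
  then have "card (missing (B_V n r) (B_E n r) (B_X n r)) = (\<Sum>(s, t)\<in>nonarcs r. card (fibre (B_V n r) fst s) * card (fibre (B_V n r) fst t))"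
    using card_pullback[OF finite_B_V finite_nonarcs] by simp
  also have "\<dots> = card (nonarcs r) + (r - 2) * ((\<Sum>s\<in>bverts r. card (fibre (B_V n r) fst s)) - 2 * r)"
    by (rule nonarcs_sum_eq[OF evr r4]) (use fib_B cop_pos cop_one in \<open>auto simp del: copies.simps\<close>)
  also have "(\<Sum>s\<in>bverts r. card (fibre (B_V n r) fst s)) = n"
    using tmpl_lab_fib(3)[OF B_lab finite_B_V] card_B_V by simp
  finally have m: "card (missing (B_V n r) (B_E n r) (B_X n r)) = card (nonarcs r) + (r - 2) * (n - 2 * r)" .
  have "card (missing (B_V n r) (B_E n r) (B_X n r)) + card (B_E n r) = 2 * (card (B_X n r) * card (B_V n r - B_X n r))"
  proof (rule card_missing[OF finite_B_V])
    show "p \<in> B_X n r \<longleftrightarrow> q \<notin> B_X n r" if "(p, q) \<in> B_E n r" for p q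
      using that unfolding E B_X_def tmpl_def by (auto simp: class_compl)
  qed (auto simp: B_X_def E)
  moreover have "card (B_V n r - B_X n r) = n - n div 2"
    using card_Diff_subset[of "B_X n r" "B_V n r"] finite_B_V card_B_V card_B_X
    by (auto simp: B_X_def)
  ultimately show ?thesis using m card_B_X by simp
qed

text \<open>A potential rising by at most 1 along each arc certifies a lower bound on distances. The
  \<open>V\<close> side is left only from an odd index and only to \<open>W 1\<close>, after which
  the \<open>W\<close> index climbs by at most 1 per step. An even start spends one more step, so
  \<open>W (r - 1)\<close> replaces \<open>W r\<close>.\<close>

lemma tmpl_potential:
  assumes "s \<in> bverts r"
  shows "\<exists>t\<in>bverts r. \<exists>\<pi> :: base_vert \<Rightarrow> nat. \<pi> s = 0 \<and> \<pi> t = r \<and> (\<forall>a b. (a, b) \<in> tmpl r \<longrightarrow> \<pi> b \<le> Suc (\<pi> a))"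
proof -
  have pot: "\<exists>t\<in>bverts r. \<exists>\<pi> :: base_vert \<Rightarrow> nat. \<pi> (V i) = 0 \<and> \<pi> t = r \<and> (\<forall>a b. (a, b) \<in> tmpl r \<longrightarrow> \<pi> b \<le> Suc (\<pi> a))"
    if i: "1 \<le> i" "i \<le> r" for i
  proof (cases "odd i")
    case True
    let ?\<pi> = "\<lambda>s. case s of V j \<Rightarrow> if odd j then 0 else 1 | W j \<Rightarrow> j"
    have "?\<pi> b \<le> Suc (?\<pi> a)" if "(a, b) \<in> tmpl r" for a b
      using that by (cases a; cases b) (auto simp: tmpl_iff)
    then show ?thesis using True r4 by (intro bexI[of _ "W r"] exI[of _ ?\<pi>]) auto
  next
    case False
    let ?\<pi> = "\<lambda>s. case s of V j \<Rightarrow> if even j then 0 else 1 | W j \<Rightarrow> Suc j"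
    have "?\<pi> b \<le> Suc (?\<pi> a)" if "(a, b) \<in> tmpl r" for a b
      using that by (cases a; cases b) (auto simp: tmpl_iff)
    then show ?thesis using False r4 by (intro bexI[of _ "W (r - 1)"] exI[of _ ?\<pi>]) auto
  qed
  show ?thesis
  proof (cases s)
    case (V i)
    then show ?thesis using pot[of i] assms by auto
  next
    case (W i)
    then obtain t \<pi> where t: "t \<in> bverts r" "\<pi> (V i) = (0 :: nat)" "\<pi> t = r" "\<And>a b. (a, b) \<in> tmpl r \<Longrightarrow> \<pi> b \<le> Suc (\<pi> a)"
      using pot[of i] assms by auto
    show ?thesis
    proof (intro bexI[of _ "flip t"] exI[of _ "\<lambda>a. \<pi> (flip a)"] conjI allI impI)
      show "flip t \<in> bverts r" using t(1) by (cases t) auto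
    qed (use t W tmpl_flip in auto)
  qed
qed

lemma B_far:
  assumes "p \<in> B_V n r" shows "\<exists>q\<in>B_V n r. \<forall>k<r. (p, q) \<notin> B_E n r ^^ k"
proof -
  have "fst p \<in> bverts r" using assms unfolding B_V by auto
  then obtain t \<pi> where t: "t \<in> bverts r" "\<pi> (fst p) = (0 :: nat)" "\<pi> t = r" "\<And>a b. (a, b) \<in> tmpl r \<Longrightarrow> \<pi> b \<le> Suc (\<pi> a)"
    using tmpl_potential by blast
  have le: "(p, q) \<in> B_E n r ^^ k \<Longrightarrow> \<pi> (fst q) \<le> k" for q k
  proof (induction k arbitrary: q)
    case 0 then show ?case using t by simp
  next
    case (Suc k)
    then obtain w where "(p, w) \<in> B_E n r ^^ k" "(w, q) \<in> B_E n r" by auto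
    then show ?case using Suc.IH[of w] t(4)[of "fst w" "fst q"] r4 by (auto simp: B_E)
  qed
  have "(t, 0) \<in> B_V n r" unfolding B_V using t(1) cop_pos[of t] by auto
  moreover have "(p, (t, 0)) \<notin> B_E n r ^^ k" if "k < r" for k using le[of "(t, 0)" k] t(3) that by auto
  ultimately show ?thesis by blast
qed

text \<open>A walk of positive length lifts to arbitrary copies of its ends, while length 0 would
  require equal copies; hence \<open>Suc k\<close>. Inner vertices are lifted to copy 0.\<close>

lemma B_lift:
  "(s, t) \<in> tmpl r ^^ Suc k \<Longrightarrow> p \<in> B_V n r \<Longrightarrow> q \<in> B_V n r \<Longrightarrow> fst p = s \<Longrightarrow> fst q = t \<Longrightarrow> (p, q) \<in> B_E n r ^^ Suc k"
proof (induction k arbitrary: t q)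
  case 0
  then show ?case using r4 by (auto simp: B_E)
next
  case (Suc k)
  from Suc.prems(1) obtain w where w: "(s, w) \<in> tmpl r ^^ Suc k" "(w, t) \<in> tmpl r" by auto
  then have wB: "(w, 0) \<in> B_V n r" unfolding B_V using tmpl_bverts[OF w(2)] cop_pos[of w] by auto
  have "(p, (w, 0)) \<in> B_E n r ^^ Suc k" using Suc.IH[OF w(1) Suc.prems(2) wB] Suc.prems by simp
  moreover have "((w, 0), q) \<in> B_E n r" using w wB Suc.prems r4 by (simp add: B_E)
  ultimately show ?case by auto
qed

text \<open>\<open>V 1\<close> is a centre, which gives the upper bound on the outradius of
  \<open>B_graph\<close>; \<open>W r\<close> needs the full \<open>r\<close> steps of this
  walk.\<close>

lemma tmpl_from_V1:
  assumes "t \<in> bverts r" shows "\<exists>k. Suc k \<le> r \<and> (V 1, t) \<in> tmpl r ^^ Suc k"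
proof -
  have toV: "Suc j \<le> r \<Longrightarrow> (V 1, V (Suc j)) \<in> tmpl r ^^ j" for j
  proof (induction j)
    case (Suc j)
    then have "(V (Suc j), V (Suc (Suc j))) \<in> tmpl r" by (simp add: tmpl_iff)
    then show ?case using Suc by auto
  qed simp
  have toW: "Suc j \<le> r \<Longrightarrow> (V 1, W (Suc j)) \<in> tmpl r ^^ Suc j" for j
  proof (induction j)
    case 0
    then show ?case by (simp add: tmpl_iff)
  next
    case (Suc j)
    then have "(W (Suc j), W (Suc (Suc j))) \<in> tmpl r" by (simp add: tmpl_iff)
    then show ?case using Suc by auto
  qed
  show ?thesis
  proof (cases t)
    case (V i)
    show ?thesis
    proof (cases "i = 1")
      case True
      \<comment> \<open>Other copies of \<open>V 1\<close> are reached by a detour of length 2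
        through \<open>W 1\<close>.\<close>
      have "(V 1, W 1) \<in> tmpl r" "(W 1, V 1) \<in> tmpl r" using r4 by (simp_all add: tmpl_iff)
      then have "(V 1, V 1) \<in> tmpl r ^^ Suc 1" by auto
      then show ?thesis using V True r4 by (intro exI[of _ 1]) auto
    next
      case False
      then obtain j where "i = Suc (Suc j)" using V assms by (cases i; cases "i - 1") auto
      then show ?thesis using toV[of "Suc j"] V assms
        by (intro exI[of _ j]) auto
    qed
  next
    case (W i)
    then obtain j where "i = Suc j" using assms by (cases i) auto
    then show ?thesis using toW[of j] W assms
      by (intro exI[of _ j]) auto
  qed
qed

lemma tmpl_to_V1:
  assumes "s \<in> bverts r" shows "\<exists>k. (s, V 1) \<in> tmpl r ^^ Suc k"
proof -
  have a: "(W 1, V 1) \<in> tmpl r" using r4 by (simp add: tmpl_iff)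
  have "(s, V 1) \<in> tmpl r \<or> (s, W 1) \<in> tmpl r"
    using assms by (cases s) (auto simp: tmpl_iff)
  then have "(s, V 1) \<in> tmpl r ^^ Suc 0 \<or> (s, V 1) \<in> tmpl r ^^ Suc 1" using a by auto
  then show ?thesis by blast
qed

lemma V1_in_B: "(V 1, 0) \<in> B_V n r" unfolding B_V using cop_pos[of "V 1"] r4 by auto

lemma B_from_V1:
  assumes "q \<in> B_V n r" shows "\<exists>k\<le>r. ((V 1, 0), q) \<in> B_E n r ^^ k"
proof -
  have "fst q \<in> bverts r" using assms unfolding B_V by auto
  then show ?thesis using tmpl_from_V1 B_lift[OF _ V1_in_B assms] by fastforce
qed

lemma B_strong:
  assumes "p \<in> B_V n r" "q \<in> B_V n r" shows "(p, q) \<in> (B_E n r)\<^sup>*"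
proof -
  have "fst p \<in> bverts r" using assms unfolding B_V by auto
  then obtain k where "(fst p, V 1) \<in> tmpl r ^^ Suc k" using tmpl_to_V1 by blast
  then have "(p, (V 1, 0)) \<in> B_E n r ^^ Suc k" using B_lift[OF _ assms(1) V1_in_B] by simp
  then show ?thesis using B_from_V1[OF assms(2)] by (meson relpow_imp_rtrancl rtrancl_trans)
qed

end

section \<open>Transfer to digraphs\<close>

lemma (in wf_digraph) awalk_relpow:
  "u \<in> verts G \<Longrightarrow> (\<exists>p. awalk u p v \<and> length p = k) \<longleftrightarrow> (u, v) \<in> arcs_ends G ^^ k"
proof (induction k arbitrary: u)
  case 0
  then show ?case by (auto simp: awalk_Nil_iff)
next
  case (Suc k)
  have "(\<exists>p. awalk u p v \<and> length p = Suc k) \<longleftrightarrow> (\<exists>w. (u, w) \<in> arcs_ends G \<and> (\<exists>p. awalk w p v \<and> length p = k))"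
  proof
    assume "\<exists>p. awalk u p v \<and> length p = Suc k"
    then obtain e p where "awalk u (e # p) v" "length p = k" by (auto simp: length_Suc_conv)
    then show "\<exists>w. (u, w) \<in> arcs_ends G \<and> (\<exists>p. awalk w p v \<and> length p = k)"
      by (auto simp: awalk_Cons_iff arcs_ends_conv intro!: exI[of _ "head G e"])
  next
    assume "\<exists>w. (u, w) \<in> arcs_ends G \<and> (\<exists>p. awalk w p v \<and> length p = k)"
    then obtain e p where "e \<in> arcs G" "tail G e = u" "awalk (head G e) p v" "length p = k"
      by (auto simp: arcs_ends_conv)
    then show "\<exists>p. awalk u p v \<and> length p = Suc k"
      by (intro exI[of _ "e # p"]) (auto simp: awalk_Cons_iff)
  qed
  also have "\<dots> \<longleftrightarrow> (\<exists>w. (u, w) \<in> arcs_ends G \<and> (w, v) \<in> arcs_ends G ^^ k)"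
    using Suc.IH by (metis adj_in_verts(2))
  also have "\<dots> \<longleftrightarrow> (u, v) \<in> arcs_ends G ^^ Suc k" by (auto simp: relpow_commute simp del: relpow.simps intro: relpow_Suc_I2 elim: relpow_Suc_E2)
  finally show ?case .
qed

lemma (in wf_digraph) awalk_cost_1: "awalk_cost (\<lambda>_. 1) p = real (length p)"
  by (induction p) auto

lemma (in wf_digraph) distance_le:
  assumes "u \<in> verts G" "(u, v) \<in> arcs_ends G ^^ k"
  shows "distance G u v \<le> ereal (real k)"
proof -
  obtain p where "awalk u p v" "length p = k" using awalk_relpow[OF assms(1)] assms(2) by blast
  then show ?thesis unfolding distance_def using min_cost_le_walk_cost[of u p v "\<lambda>_. 1"] by (simp add: awalk_cost_1)
qed

lemma (in wf_digraph) distance_ge: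
  assumes "u \<in> verts G" "\<forall>j<k. (u, v) \<notin> arcs_ends G ^^ j"
  shows "ereal (real k) \<le> distance G u v"
  unfolding distance_def \<mu>_def
proof (rule INF_greatest)
  fix p assume "p \<in> {p. awalk u p v}"
  then have "(u, v) \<in> arcs_ends G ^^ length p" using awalk_relpow[OF assms(1)] by blast
  then have "k \<le> length p" using assms(2) by (meson not_le)
  then show "ereal (real k) \<le> ereal (awalk_cost (\<lambda>_. 1) p)" by (simp add: awalk_cost_1)
qed

lemma (in wf_digraph) reachable_rtrancl:
  "u \<in> verts G \<Longrightarrow> u \<rightarrow>\<^sup>* v \<longleftrightarrow> (u, v) \<in> (arcs_ends G)\<^sup>*"
  unfolding reachable_awalk rtrancl_power using awalk_relpow by blast

lemma (in fin_digraph) outradius_far: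
  assumes "outradius G = ereal (real r)" "v \<in> verts G"
  shows "\<exists>u\<in>verts G. \<forall>k<r. (v, u) \<notin> arcs_ends G ^^ k"
proof -
  have "ereal (real r) \<le> (MAX u\<in>verts G. distance G v u)"
    unfolding assms(1)[symmetric] outradius_def using assms(2) finite_verts by (intro Min_le) auto
  moreover have "(MAX u\<in>verts G. distance G v u) \<in> distance G v ` verts G"
    using assms(2) finite_verts by (intro Max_in) auto
  ultimately obtain u where u: "u \<in> verts G" "ereal (real r) \<le> distance G v u" by auto
  have "(v, u) \<notin> arcs_ends G ^^ k" if "k < r" for k
  proof
    assume "(v, u) \<in> arcs_ends G ^^ k"
    then have "ereal (real r) \<le> ereal (real k)" using distance_le[OF assms(2)] u(2) order_trans by blast
    then show False using that by simp
  qed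
  then show ?thesis using u(1) by blast
qed

lemma (in fin_digraph) outradius_eqI:
  assumes far: "\<And>v. v \<in> verts G \<Longrightarrow> \<exists>u\<in>verts G. \<forall>k<r. (v, u) \<notin> arcs_ends G ^^ k"
    and c: "c \<in> verts G" "\<And>u. u \<in> verts G \<Longrightarrow> \<exists>k\<le>r. (c, u) \<in> arcs_ends G ^^ k"
  shows "outradius G = ereal (real r)"
proof -
  let ?e = "\<lambda>v. MAX u\<in>verts G. distance G v u"
  have ge: "ereal (real r) \<le> ?e v" if v: "v \<in> verts G" for v
  proof -
    obtain u where u: "u \<in> verts G" "\<forall>k<r. (v, u) \<notin> arcs_ends G ^^ k" using far[OF v] by blast
    then have "distance G v u \<le> ?e v" using finite_verts by (intro Max_ge) auto
    then show ?thesis using distance_ge[OF v u(2)] by (rule order_trans[rotated])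
  qed
  have "?e c \<le> ereal (real r)"
  proof (rule Max.boundedI)
    fix a assume "a \<in> distance G c ` verts G"
    then obtain u where u: "u \<in> verts G" "a = distance G c u" by blast
    then obtain k where "k \<le> r" "(c, u) \<in> arcs_ends G ^^ k" using c(2) by blast
    then have "distance G c u \<le> ereal (real k)" "ereal (real k) \<le> ereal (real r)" using distance_le[OF c(1)] by auto
    then show "a \<le> ereal (real r)" using u(2) order_trans by blast
  qed (use c finite_verts in auto)
  then have "?e c = ereal (real r)" using ge[OF c(1)] by (rule antisym)
  then show ?thesis unfolding outradius_def
    using c(1) ge finite_verts by (intro Min_eqI) (auto intro: rev_image_eqI)
qed

lemma B_bip_biconn:
  assumes nr: "2 * r \<le> n" and r4: "4 \<le> r" and evr: "even r"
  shows "bip_biconn_digraph n r (with_proj (B_graph n r))"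
proof -
  note ctx = nr r4 evr
  let ?G = "with_proj (B_graph n r)"
  have v: "verts ?G = B_V n r" and a: "arcs ?G = B_E n r" "arcs_ends ?G = B_E n r"
    and th: "tail ?G = fst" "head ?G = snd" by (simp_all add: B_V_def B_E_def)
  have E: "B_E n r = {(p, q). p \<in> B_V n r \<and> q \<in> B_V n r \<and> (fst p, fst q) \<in> tmpl r}" using B_E r4 by simp
  have cls: "fst p \<in> B_class1 \<longleftrightarrow> fst q \<notin> B_class1" if "(p, q) \<in> B_E n r" for p q
    using that unfolding E tmpl_def by (auto simp: class_compl)
  have dig: "digraph ?G"
  proof unfold_locales
    fix e assume e: "e \<in> arcs ?G"
    then show "tail ?G e \<in> verts ?G" "head ?G e \<in> verts ?G" unfolding v a th E by auto
    show "tail ?G e \<noteq> head ?G e" using e cls[of "fst e" "snd e"] unfolding a th by auto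
  next
    show "finite (verts ?G)" unfolding v by (rule finite_B_V[OF ctx])
    show "finite (arcs ?G)" unfolding a E
      by (rule finite_subset[of _ "B_V n r \<times> B_V n r"]) (auto simp: finite_B_V[OF ctx])
  next
    fix e1 e2 assume "arc_to_ends ?G e1 = arc_to_ends ?G e2"
    then show "e1 = e2" unfolding arc_to_ends_def th by (simp add: prod_eq_iff)
  qed
  then interpret G: digraph ?G .
  have "bipartite ?G" unfolding bipartite_def
  proof (intro exI conjI ballI)
    show "verts ?G = B_X n r \<union> (B_V n r - B_X n r)" "B_X n r \<inter> (B_V n r - B_X n r) = {}" unfolding v B_X_def by auto
    fix e assume e: "e \<in> arcs ?G"
    then show "\<not> (tail ?G e \<in> B_X n r \<and> head ?G e \<in> B_X n r)"
      "\<not> (tail ?G e \<in> B_V n r - B_X n r \<and> head ?G e \<in> B_V n r - B_X n r)"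
      using cls[of "fst e" "snd e"] unfolding a th B_X_def by auto
  qed
  moreover have "strongly_connected ?G"
  proof
    show "verts ?G \<noteq> {}" unfolding v using V1_in_B[OF ctx] by blast
    show "u \<rightarrow>\<^sup>*\<^bsub>?G\<^esub> w" if "u \<in> verts ?G" "w \<in> verts ?G" for u w
      using B_strong[OF ctx] that G.reachable_rtrancl[of u w] unfolding v a by blast
  qed
  moreover have "outradius ?G = ereal (real r)"
    by (rule G.outradius_eqI[where c = "(V 1, 0)"]) (use B_far[OF ctx] V1_in_B[OF ctx] B_from_V1[OF ctx] v a in auto)
  ultimately show ?thesis
    unfolding bip_biconn_digraph_def using dig card_B_V[OF ctx] v by auto
qed

section \<open>Comparison with \<open>B_graph\<close> and uniqueness\<close>

lemma balanced_product:
  fixes a b n :: nat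
  assumes "a + b = n" "a \<le> b"
  shows "a * b \<le> (n div 2) * (n - n div 2)" "a * b = (n div 2) * (n - n div 2) \<Longrightarrow> a = n div 2"
proof -
  let ?h = "n div 2"
  have ah: "a \<le> ?h" using assms by linarith
  obtain t where t: "?h = a + t" using ah le_Suc_ex by blast
  have "n - ?h = b - t" "a + t \<le> b" "t \<le> b" using t assms by linarith+
  then obtain w where w: "b = a + t + w" "n - ?h = a + w" using le_Suc_ex[of "a + t" b] by auto
  \<comment> \<open>The loss against the balanced product is exactly \<open>t * w\<close>.\<close>
  have e: "?h * (n - ?h) = a * b + t * w" unfolding w(2) unfolding t w(1) by (simp add: algebra_simps)
  then show "a * b \<le> ?h * (n - ?h)" by simp
  assume "a * b = ?h * (n - ?h)"
  then have "t = 0 \<or> w = 0" using e by simp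
  moreover have "w = 0 \<Longrightarrow> t = 0" using w t assms by linarith
  ultimately show "a = ?h" using t by auto
qed

lemma digraph_extremal:
  fixes D :: "('a, 'b) pre_digraph"
  assumes r4: "4 \<le> r" and evr: "even r" and big: "n_bd r \<le> n" and nr: "2 * r \<le> n"
    and D: "bip_biconn_digraph n r D"
  shows "card (arcs D) \<le> card (B_E n r) \<and>
    (card (arcs D) = card (B_E n r) \<longrightarrow> digraph_iso D (with_proj (B_graph n r)))"
proof -
  note ctx = nr r4 evr
  interpret digraph D using D unfolding bip_biconn_digraph_def by blast
  have cn: "card (verts D) = n" and sc: "strongly_connected D" and out: "outradius D = ereal (real r)"
    using D unfolding bip_biconn_digraph_def by auto
  let ?U = "verts D" and ?E = "arcs_ends D"
  obtain X0 Y0 where XY0: "?U = X0 \<union> Y0" "X0 \<inter> Y0 = {}"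
    "\<And>e. e \<in> arcs D \<Longrightarrow> \<not> (tail D e \<in> X0 \<and> head D e \<in> X0) \<and> \<not> (tail D e \<in> Y0 \<and> head D e \<in> Y0)"
    using D unfolding bip_biconn_digraph_def bipartite_def by blast
  \<comment> \<open>The smaller class is chosen to match the class of size \<open>n div 2\<close> in
    \<open>B_graph\<close>.\<close>
  define X where "X = (if card X0 \<le> card Y0 then X0 else Y0)"
  have XU: "X \<subseteq> ?U" unfolding X_def using XY0 by auto
  have UX: "?U - X = (if card X0 \<le> card Y0 then Y0 else X0)" unfolding X_def using XY0 by auto
  have Xle: "card X \<le> card (?U - X)" unfolding UX by (simp add: X_def)
  have bipX: "u \<in> X \<longleftrightarrow> v \<notin> X" if uv: "(u, v) \<in> ?E" for u v
  proof -
    obtain e where "e \<in> arcs D" "tail D e = u" "head D e = v" using uv by (auto simp: arcs_ends_conv)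
    then have "\<not> (u \<in> X0 \<and> v \<in> X0)" "\<not> (u \<in> Y0 \<and> v \<in> Y0)" "u \<in> X0 \<union> Y0" "v \<in> X0 \<union> Y0"
      using XY0(1,3) tail_in_verts head_in_verts by auto
    then show ?thesis unfolding X_def using XY0(2) by auto
  qed
  have EU: "?E \<subseteq> ?U \<times> ?U" by (auto simp: arcs_ends_conv)
  have arcs_inj: "inj_on (arc_to_ends D) (arcs D)" by (rule inj_onI) (rule no_multi_arcs)
  have cE: "card ?E = card (arcs D)" unfolding arcs_ends_def using arcs_inj by (rule card_image)
  have cX: "card X + card (?U - X) = n"
    using cn XU finite_verts by (metis card_Un_disjoint Diff_disjoint Diff_partition finite_Diff finite_subset)
  let ?mB = "card (nonarcs r) + (r - 2) * (n - 2 * r)"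
  have ms: "card (missing ?U ?E X) + card ?E = 2 * (card X * card (?U - X))"
    by (rule card_missing[OF finite_verts XU EU bipX])
  have BE: "card (B_E n r) + ?mB = 2 * ((n div 2) * (n - n div 2))" by (rule card_B_E[OF ctx])
  have prod: "card X * card (?U - X) \<le> (n div 2) * (n - n div 2)" by (rule balanced_product(1)[OF cX Xle])
  have R: "bip_rel ?U ?E X r"
  proof unfold_locales
    show "(u, v) \<in> ?E\<^sup>*" if "u \<in> ?U" "v \<in> ?U" for u v
      using sc that reachable_rtrancl[of u v] unfolding strongly_connected_def by blast
  qed (use finite_verts EU XU bipX outradius_far[OF out] r4 evr in auto)
  show ?thesis
  \<comment> \<open>Having at least as many arcs as \<open>B_graph\<close> is what yields the
    hypotheses of \<open>dense_bip\<close>.\<close>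
  proof (cases "card (B_E n r) \<le> card (arcs D)")
    case False
    then show ?thesis by simp
  next
    case True
    have few: "card (missing ?U ?E X) \<le> ?mB" using ms BE prod True cE by linarith
    have "card (B_E n r) \<le> 2 * (card X * card (?U - X))" using ms True cE by linarith
    then have "2 * ((n div 2) * (n - n div 2)) \<le> 2 * (card X * card (?U - X)) + ?mB" using BE by linarith
    moreover have "n * n \<le> 4 * ((n div 2) * (n - n div 2)) + 1"
    proof (cases "even n")
      case True then show ?thesis by (auto elim!: evenE)
    next
      case False
      then obtain m where "n = 2 * m + 1" by (auto elim!: oddE)
      then show ?thesis by (simp add: algebra_simps)
    qed
    moreover have "k \<le> 4 * q + 2 * m + 1" if "2 * p \<le> 2 * q + m" "k \<le> 4 * p + 1" for k m p q :: nat
      using that by linarith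
    ultimately have bal: "n * n \<le> 4 * (card X * card (?U - X)) + 2 * ?mB + 1" by blast
    have dense: "dense_bip ?U ?E X r"
      by (intro dense_bip.intro R dense_bip_axioms.intro) (use few bal big cn in simp_all)
    obtain x y where xy: "bip_pair ?U ?E X r x y"
      "card (bip_pair.unseen ?U ?E X x y) + card (bip_pair.unseeing ?U ?E X x y) \<le> 2 * r - 4"
      using dense_bip.stable_pair[OF dense] by blast
    obtain l where l: "tmpl_lab r ?U ?E X l"
      using bip_pair.labelling[OF xy] by blast
    have "?mB \<le> card (missing ?U ?E X)"
      using tmpl_lab_missing_ge[OF l finite_verts evr r4] unfolding cn by linarith
    then have le: "card (arcs D) \<le> card (B_E n r)" using ms BE prod cE by linarith
    have "digraph_iso D (with_proj (B_graph n r))" if eq: "card (arcs D) = card (B_E n r)"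
    proof -
      have "card X * card (?U - X) = (n div 2) * (n - n div 2)"
        using ms BE prod cE eq \<open>?mB \<le> card (missing ?U ?E X)\<close> by linarith
      then have cX2: "card X = n div 2" by (rule balanced_product(2)[OF cX Xle])
      note ext = tmpl_lab_extremal[OF l finite_verts evr r4 few[folded cn] EU]
      have f1: "card (fibre ?U l s) = 1" if "s \<in> bverts r - {V 1, W 1}" for s
        using tmpl_lab_fib(2)[OF l finite_verts, of s] ext(1,2) that by (cases "s \<in> {V 2, W 2}") auto
      have fV: "card (fibre ?U l (V 1)) = n div 2 - (r - 1)"
        using card_class_fib[OF ctx l finite_verts XU ext(2)] cX2 by simp
      have F: "{V 1, W 1} \<subseteq> bverts r" using r4 by auto
      have "n = (\<Sum>s\<in>bverts r. card (fibre ?U l s))" using tmpl_lab_fib(3)[OF l finite_verts] cn by simp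
      also have "\<dots> = (\<Sum>s\<in>bverts r - {V 1, W 1}. card (fibre ?U l s)) + (\<Sum>s\<in>{V 1, W 1}. card (fibre ?U l s))"
        by (rule sum.subset_diff[OF F finite_bverts])
      also have "(\<Sum>s\<in>bverts r - {V 1, W 1}. card (fibre ?U l s)) = card (bverts r - {V 1, W 1})" using f1 by simp
      also have "card (bverts r - {V 1, W 1}) = 2 * r - 2"
        by (subst card_Diff_subset) (use F in \<open>simp_all add: card_bverts\<close>)
      finally have "n = 2 * r - 2 + (card (fibre ?U l (V 1)) + card (fibre ?U l (W 1)))" by simp
      then have fW: "card (fibre ?U l (W 1)) = cop n r (W 1)" using cop_V1_W1[OF ctx] fV nr r4 by linarith
      have cf: "card (fibre ?U l s) = cop n r s" if "s \<in> bverts r" for s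
        using that f1[of s] cop_one[OF ctx, of s] fV fW cop_V1_W1(1)[OF ctx] by (cases "s \<in> {V 1, W 1}") auto
      \<comment> \<open>Each fibre can be numbered by the copies of its label. Since the arcs of
        \<open>D\<close> are exactly those pulled back from the template, any such numbering is an
        isomorphism.\<close>
      have "\<exists>\<beta>. bij_betw \<beta> (fibre ?U l s) {..<cop n r s}" if "s \<in> bverts r" for s
        using cf[OF that] finite_verts
        by (intro finite_same_card_bij) (auto simp: fibre_def)
      then obtain \<beta> where \<beta>: "\<And>s. s \<in> bverts r \<Longrightarrow> bij_betw (\<beta> s) (fibre ?U l s) {..<cop n r s}" by metis
      define \<phi> where "\<phi> u = (l u, \<beta> (l u) u)" for u
      have lb: "l u \<in> bverts r" if "u \<in> ?U" for u using l that unfolding tmpl_lab_def by auto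
      have inj: "inj_on \<phi> ?U"
      proof (rule inj_onI)
        fix u v assume uv: "u \<in> ?U" "v \<in> ?U" "\<phi> u = \<phi> v"
        then have "l u = l v" "\<beta> (l u) u = \<beta> (l u) v" unfolding \<phi>_def by auto
        then show "u = v" using bij_betw_imp_inj_on[OF \<beta>[OF lb[OF uv(1)]]] uv
          unfolding inj_on_def fibre_def by auto
      qed
      have img: "\<phi> ` ?U = B_V n r"
      proof (intro equalityI subsetI)
        fix p assume "p \<in> \<phi> ` ?U"
        then obtain u where u: "u \<in> ?U" "p = \<phi> u" by blast
        then have "\<beta> (l u) u \<in> {..<cop n r (l u)}"
          using bij_betwE[OF \<beta>[OF lb[OF u(1)]]] unfolding fibre_def by auto
        then show "p \<in> B_V n r" unfolding u \<phi>_def B_V using lb[OF u(1)] by auto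
      next
        fix p assume "p \<in> B_V n r"
        then obtain s k where p: "p = (s, k)" "s \<in> bverts r" "k \<in> {..<cop n r s}" unfolding B_V by auto
        then have "k \<in> \<beta> s ` fibre ?U l s" using bij_betw_imp_surj_on[OF \<beta>[OF p(2)]] by simp
        then obtain u where "u \<in> ?U" "l u = s" "\<beta> s u = k" unfolding fibre_def by auto
        then show "p \<in> \<phi> ` ?U" unfolding p \<phi>_def by (intro image_eqI[of _ _ u]) auto
      qed
      have fst\<phi>: "fst (\<phi> u) = l u" for u unfolding \<phi>_def by simp
      have Eimg: "(\<lambda>e. (\<phi> (tail D e), \<phi> (head D e))) ` arcs D = B_E n r"
      proof -
        have "(\<lambda>e. (\<phi> (tail D e), \<phi> (head D e))) ` arcs D = (\<lambda>(u, v). (\<phi> u, \<phi> v)) ` ?E"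
          unfolding arcs_ends_conv by (auto simp: image_iff)
        also have "\<dots> = (\<lambda>(u, v). (\<phi> u, \<phi> v)) ` {(a, b). a \<in> ?U \<and> b \<in> ?U \<and> (l a, l b) \<in> tmpl r}"
          using ext(3) by simp
        also have "\<dots> = {(p, q). p \<in> \<phi> ` ?U \<and> q \<in> \<phi> ` ?U \<and> (fst p, fst q) \<in> tmpl r}"
          by (auto simp: fst\<phi>)
        also have "\<dots> = B_E n r" unfolding img using B_E r4 by simp
        finally show ?thesis .
      qed
      define f :: "('a, 'b, base_vert \<times> nat, (base_vert \<times> nat) \<times> (base_vert \<times> nat)) digraph_isomorphism"
        where "f = \<lparr>iso_verts = \<phi>, iso_arcs = (\<lambda>e. (\<phi> (tail D e), \<phi> (head D e))), iso_head = snd, iso_tail = fst\<rparr>"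
      have "inj_on (\<lambda>e. (\<phi> (tail D e), \<phi> (head D e))) (arcs D)"
      proof (rule inj_onI)
        fix e1 e2 assume e: "e1 \<in> arcs D" "e2 \<in> arcs D"
          "(\<phi> (tail D e1), \<phi> (head D e1)) = (\<phi> (tail D e2), \<phi> (head D e2))"
        then have "tail D e1 = tail D e2" "head D e1 = head D e2"
          using inj tail_in_verts head_in_verts unfolding inj_on_def by auto
        then show "e1 = e2" using e by (intro no_multi_arcs) (auto simp: arc_to_ends_def)
      qed
      then have "digraph_isomorphism f"
        unfolding digraph_isomorphism_def f_def using inj wf_digraph_axioms by simp
      moreover have "with_proj (B_graph n r) = app_iso f D"
        unfolding app_iso_def f_def with_proj_def using img Eimg by (simp add: B_V_def B_E_def)
      ultimately show ?thesis unfolding digraph_iso_def by blast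
    qed
    then show ?thesis using le by blast
  qed
qed

theorem theorem6p5:
  fixes r :: nat
  assumes "r \<ge> 4" and "even r"
  shows "\<exists>n1 :: nat. \<forall>n \<ge> n1.
    bip_biconn_digraph n r (with_proj (B_graph n r)) \<and>
    (\<forall>D :: ('a, 'b) pre_digraph. bip_biconn_digraph n r D \<longrightarrow>
       card (arcs D) \<le> card (parcs (B_graph n r)) \<and>
       (card (arcs D) = card (parcs (B_graph n r)) \<longrightarrow>
          digraph_iso D (with_proj (B_graph n r))))"
proof (intro exI allI impI conjI)
  fix n assume n: "n_bd r + 2 * r \<le> n"
  then show "bip_biconn_digraph n r (with_proj (B_graph n r))" using B_bip_biconn assms by simp
  fix D :: "('a, 'b) pre_digraph" assume "bip_biconn_digraph n r D"
  then have *: "card (arcs D) \<le> card (B_E n r) \<and>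
    (card (arcs D) = card (B_E n r) \<longrightarrow> digraph_iso D (with_proj (B_graph n r)))"
    using n by (intro digraph_extremal assms) simp_all
  then show "card (arcs D) \<le> card (parcs (B_graph n r))" unfolding B_E_def by blast
  assume "card (arcs D) = card (parcs (B_graph n r))"
  then show "digraph_iso D (with_proj (B_graph n r))" using * unfolding B_E_def by blast
qed

end
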